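(* Let $(\Omega,\Sigma)$ be a measurable space and let $T=(T_t)_{t\in\mathbb{R}}$ be a sup path attaining representation of $\mathbb{R}$ by isometries of $M(\Sigma)$. Suppose that $\mu\in M(\Sigma)$ is weakly analytic and that $\sigma\in M(\Sigma)$ is quasi-invariant. Write $\mu=\mu_a+\mu_s$ for the Lebesgue decomposition of $\mu$ with respect to $\sigma$ ($\mu_a\ll\sigma$, $\mu_s\perp\sigma$). Then both $\mu_a$ and $\mu_s$ are weakly analytic. In particular, $\mathrm{spec}_T(\mu_a)$ and $\mathrm{spec}_T(\mu_s)$ are contained in $[0,\infty)$.
   Context: $M(\Sigma)$ is the Banach space of complex measures on $(\Omega,\Sigma)$ with total variation norm; $\mathcal{L}^\infty(\Sigma)$ is the space of bounded measurable functions $h:\Omega\to\mathbb{C}$, with $\|h\|_\infty$ the supremum norm. $M(\mathbb{R})$ is the space of complex regular Borel measures on $\mathbb{R}$. $\widehat f(s)=\int_{\mathbb{R}} f(t)e^{-ist}\,dt$. A representation $T$ of $\mathbb{R}$ in $M(\Sigma)$ is a homomorphism $t\mapsto T_t$ from $\mathbb{R}$ into the group of invertible bounded linear operators on $M(\Sigma)$; it is by isometries if each $T_t$ is an isometry. It is uniformly bounded if there is $c>0$ with $\|T_t\|\le c$ for all $t$. A measure $\mu\in M(\Sigma)$ is weakly measurable (written $\mu\in\mathcal{M}_T(\Sigma)$) if for every $A\in\Sigma$ the map $t\mapsto T_t\mu(A)$ is Borel measurable. For $\mu\in\mathcal{M}_T(\Sigma)$ and $\nu\in M(\mathbb{R})$,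 $\nu*_T\mu(A)=\int_{\mathbb{R}} T_{-t}\mu(A)\,d\nu(t)$ for $A\in\Sigma$; for $f\in L^1(\mathbb{R})$, $f*_T\mu$ means $(f\,dt)*_T\mu$. $T$ is sup path attaining if it is uniformly bounded, if $T_t(\nu*_T\mu)=\nu*_T(T_t\mu)$ for all $t\in\mathbb{R}$, $\nu\in M(\mathbb{R})$, $\mu\in\mathcal{M}_T(\Sigma)$, and if there is a constant $C$ such that for every $\mu\in\mathcal{M}_T(\Sigma)$ $$\|\mu\|\le C\sup\Big\{\operatorname{ess\,sup}_{t\in\mathbb{R}}\Big|\int_\Omega h\,d(T_t\mu)\Big| : h\in\mathcal{L}^\infty(\Sigma),\ \|h\|_\infty\le 1\Big\}.$$ $\mathrm{spec}_T(\mu)=\bigcap_{f}\{s\in\mathbb{R}:\widehat f(s)=0\}$, the intersection over all $f\in L^1(\mathbb{R})$ with $f*_T\mu=0$. $H^1(\mathbb{R})=\{f\in L^1(\mathbb{R}):\widehat f(s)=0\text{ for all }s\le 0\}$ and $H^\infty(\mathbb{R})=\{f\in L^\infty(\mathbb{R}):\int_{\mathbb{R}} f(t)g(t)\,dt=0\text{ for all }g\in H^1(\mathbb{R})\}$. A measure $\mu\in\mathcal{M}_T(\Sigma)$ is weakly analytic if $t\mapsto T_t\mu(A)$ is in $H^\infty(\mathbb{R})$ for every $A\in\Sigma$. A weakly measurable $\sigma\in M(\Sigma)$ is quasi-invariant if $T_t\sigma$ and $\sigma$ are mutually absolutely continuous for all $t\in\mathbb{R}$ (i.e. $|T_t\sigma|(A)=0$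 if and only if $|\sigma|(A)=0$, for $A\in\Sigma$). Absolute continuity and singularity with respect to a complex measure $\sigma$ mean with respect to $|\sigma|$. *)

theory Defs
  imports "HOL-Probability.Probability"
begin

section \<open>Complex measures\<close>

text \<open>
  The measurable space is given by \<open>M :: 'a measure\<close>, of which only \<open>space M\<close> and \<open>sets M\<close> are
  used. A complex measure is a set function, normalised to be 0 outside \<open>sets M\<close>, so that
  equality of complex measures is equality of functions.
\<close>

definition complex_measures :: "'a measure \<Rightarrow> ('a set \<Rightarrow> complex) set" where
  "complex_measures M = {\<mu>. (\<forall>A. A \<notin> sets M \<longrightarrow> \<mu> A = 0) \<and> \<mu> {} = 0 \<and>
     (\<forall>A :: nat \<Rightarrow> 'a set. range A \<subseteq> sets M \<longrightarrow> disjoint_family A \<longrightarrow>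
        (\<lambda>i. \<mu> (A i)) sums \<mu> (\<Union>i. A i))}"

definition total_variation :: "'a measure \<Rightarrow> ('a set \<Rightarrow> complex) \<Rightarrow> 'a set \<Rightarrow> ennreal" where
  "total_variation M \<mu> A =
     (SUP P \<in> {P. finite P \<and> disjoint P \<and> P \<subseteq> sets M \<and> \<Union>P = A}. \<Sum>B\<in>P. ennreal (cmod (\<mu> B)))"

text \<open>The conversion to \<open>real\<close> loses nothing: a complex measure has finite total variation.\<close>

definition cm_norm :: "'a measure \<Rightarrow> ('a set \<Rightarrow> complex) \<Rightarrow> real" where
  "cm_norm M \<mu> = enn2real (total_variation M \<mu> (space M))"

definition cm_abs_cont :: "'a measure \<Rightarrow> ('a set \<Rightarrow> complex) \<Rightarrow> ('a set \<Rightarrow> complex) \<Rightarrow> bool" where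
  "cm_abs_cont M \<mu> \<sigma> \<longleftrightarrow> (\<forall>A\<in>sets M. total_variation M \<sigma> A = 0 \<longrightarrow> \<mu> A = 0)"

definition cm_singular :: "'a measure \<Rightarrow> ('a set \<Rightarrow> complex) \<Rightarrow> ('a set \<Rightarrow> complex) \<Rightarrow> bool" where
  "cm_singular M \<mu> \<sigma> \<longleftrightarrow>
     (\<exists>A\<in>sets M. total_variation M \<sigma> A = 0 \<and> total_variation M \<mu> (space M - A) = 0)"

text \<open>
  The positive part in the Jordan decomposition of a finite signed measure \<open>\<nu>\<close>, namely
  \<open>A \<mapsto> sup {\<nu> B | B \<subseteq> A}\<close>. The coercion \<open>ennreal\<close> truncates negative values to 0,
  which does not affect the supremum because \<open>B = {}\<close> is admitted. The negative part is
  \<open>jordan_pos M (\<lambda>A. - \<nu> A)\<close>.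
\<close>

definition jordan_pos :: "'a measure \<Rightarrow> ('a set \<Rightarrow> real) \<Rightarrow> 'a measure" where
  "jordan_pos M \<nu> =
     measure_of (space M) (sets M) (\<lambda>A. SUP B \<in> {B \<in> sets M. B \<subseteq> A}. ennreal (\<nu> B))"

definition cm_integral :: "'a measure \<Rightarrow> ('a set \<Rightarrow> complex) \<Rightarrow> ('a \<Rightarrow> complex) \<Rightarrow> complex" where
  "cm_integral M \<mu> h =
     (integral\<^sup>L (jordan_pos M (\<lambda>A. Re (\<mu> A))) h - integral\<^sup>L (jordan_pos M (\<lambda>A. - Re (\<mu> A))) h)
     + \<i> * (integral\<^sup>L (jordan_pos M (\<lambda>A. Im (\<mu> A))) h - integral\<^sup>L (jordan_pos M (\<lambda>A. - Im (\<mu> A))) h)"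

text \<open>Complex regular Borel measures on the real line.\<close>

definition regular_measures :: "(real set \<Rightarrow> complex) set" where
  "regular_measures = {\<nu> \<in> complex_measures borel. \<forall>A \<in> sets borel.
     total_variation borel \<nu> A = (INF U \<in> {U. open U \<and> A \<subseteq> U}. total_variation borel \<nu> U) \<and>
     total_variation borel \<nu> A = (SUP K \<in> {K. compact K \<and> K \<subseteq> A}. total_variation borel \<nu> K)}"

text \<open>The complex measure \<open>f dt\<close>.\<close>

definition density_cm :: "(real \<Rightarrow> complex) \<Rightarrow> real set \<Rightarrow> complex" where
  "density_cm f A = (if A \<in> sets borel then (LINT t:A|lborel. f t) else 0)"


section \<open>Representations of the real line\<close>

definition bounded_op :: "'a measure \<Rightarrow> (('a set \<Rightarrow> complex) \<Rightarrow> ('a set \<Rightarrow> complex)) \<Rightarrow> bool" where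
  "bounded_op M U \<longleftrightarrow>
     (\<forall>\<mu>\<in>complex_measures M. U \<mu> \<in> complex_measures M) \<and>
     (\<forall>\<mu>\<in>complex_measures M. \<forall>\<nu>\<in>complex_measures M.
        U (\<lambda>A. \<mu> A + \<nu> A) = (\<lambda>A. U \<mu> A + U \<nu> A)) \<and>
     (\<forall>c. \<forall>\<mu>\<in>complex_measures M. U (\<lambda>A. c * \<mu> A) = (\<lambda>A. c * U \<mu> A)) \<and>
     (\<exists>K. \<forall>\<mu>\<in>complex_measures M. cm_norm M (U \<mu>) \<le> K * cm_norm M \<mu>)"

definition op_norm :: "'a measure \<Rightarrow> (('a set \<Rightarrow> complex) \<Rightarrow> ('a set \<Rightarrow> complex)) \<Rightarrow> real" where
  "op_norm M U = (SUP \<mu> \<in> {\<mu> \<in> complex_measures M. cm_norm M \<mu> \<le> 1}. cm_norm M (U \<mu>))"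

definition invertible_bounded_op ::
    "'a measure \<Rightarrow> (('a set \<Rightarrow> complex) \<Rightarrow> ('a set \<Rightarrow> complex)) \<Rightarrow> bool" where
  "invertible_bounded_op M U \<longleftrightarrow> bounded_op M U \<and>
     (\<exists>V. bounded_op M V \<and> (\<forall>\<mu>\<in>complex_measures M. V (U \<mu>) = \<mu> \<and> U (V \<mu>) = \<mu>))"

text \<open>Operators on the space of complex measures matter only on \<open>complex_measures M\<close>.\<close>

definition is_representation ::
    "'a measure \<Rightarrow> (real \<Rightarrow> ('a set \<Rightarrow> complex) \<Rightarrow> ('a set \<Rightarrow> complex)) \<Rightarrow> bool" where
  "is_representation M T \<longleftrightarrow> (\<forall>t. invertible_bounded_op M (T t)) \<and>
     (\<forall>s t. \<forall>\<mu>\<in>complex_measures M. T (s + t) \<mu> = T s (T t \<mu>))"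

definition by_isometries ::
    "'a measure \<Rightarrow> (real \<Rightarrow> ('a set \<Rightarrow> complex) \<Rightarrow> ('a set \<Rightarrow> complex)) \<Rightarrow> bool" where
  "by_isometries M T \<longleftrightarrow> (\<forall>t. \<forall>\<mu>\<in>complex_measures M. cm_norm M (T t \<mu>) = cm_norm M \<mu>)"

definition uniformly_bounded ::
    "'a measure \<Rightarrow> (real \<Rightarrow> ('a set \<Rightarrow> complex) \<Rightarrow> ('a set \<Rightarrow> complex)) \<Rightarrow> bool" where
  "uniformly_bounded M T \<longleftrightarrow> (\<exists>c>0. \<forall>t. op_norm M (T t) \<le> c)"

definition weakly_measurable ::
    "'a measure \<Rightarrow> (real \<Rightarrow> ('a set \<Rightarrow> complex) \<Rightarrow> ('a set \<Rightarrow> complex)) \<Rightarrow> ('a set \<Rightarrow> complex) set" where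
  "weakly_measurable M T =
     {\<mu> \<in> complex_measures M. \<forall>A\<in>sets M. (\<lambda>t. T t \<mu> A) \<in> borel_measurable borel}"

definition cm_conv ::
    "'a measure \<Rightarrow> (real \<Rightarrow> ('a set \<Rightarrow> complex) \<Rightarrow> ('a set \<Rightarrow> complex)) \<Rightarrow>
     (real set \<Rightarrow> complex) \<Rightarrow> ('a set \<Rightarrow> complex) \<Rightarrow> ('a set \<Rightarrow> complex)" where
  "cm_conv M T \<nu> \<mu> = (\<lambda>A. if A \<in> sets M then cm_integral borel \<nu> (\<lambda>t. T (- t) \<mu> A) else 0)"

definition sup_path_attaining ::
    "'a measure \<Rightarrow> (real \<Rightarrow> ('a set \<Rightarrow> complex) \<Rightarrow> ('a set \<Rightarrow> complex)) \<Rightarrow> bool" where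
  "sup_path_attaining M T \<longleftrightarrow> uniformly_bounded M T \<and>
     (\<forall>t. \<forall>\<nu>\<in>regular_measures. \<forall>\<mu>\<in>weakly_measurable M T.
        T t (cm_conv M T \<nu> \<mu>) = cm_conv M T \<nu> (T t \<mu>)) \<and>
     (\<exists>C::real. \<forall>\<mu>\<in>weakly_measurable M T.
        ennreal (cm_norm M \<mu>) \<le> ennreal C *
          (SUP h \<in> {h \<in> borel_measurable M. \<forall>x\<in>space M. cmod (h x) \<le> 1}.
             esssup lborel (\<lambda>t. ennreal (cmod (cm_integral M (T t \<mu>) h)))))"


section \<open>Spectrum and analyticity\<close>

text \<open>
  Elements of the Lebesgue spaces are represented by Borel measurable functions.
\<close>

definition fourier :: "(real \<Rightarrow> complex) \<Rightarrow> real \<Rightarrow> complex" where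
  "fourier f s = (LINT t|lborel. f t * exp (- (\<i> * of_real s * of_real t)))"

definition spec ::
    "'a measure \<Rightarrow> (real \<Rightarrow> ('a set \<Rightarrow> complex) \<Rightarrow> ('a set \<Rightarrow> complex)) \<Rightarrow> ('a set \<Rightarrow> complex) \<Rightarrow> real set" where
  "spec M T \<mu> =
     (\<Inter>f \<in> {f. integrable lborel f \<and> cm_conv M T (density_cm f) \<mu> = (\<lambda>A. 0)}. {s. fourier f s = 0})"

definition H1 :: "(real \<Rightarrow> complex) set" where
  "H1 = {f. integrable lborel f \<and> (\<forall>s\<le>0. fourier f s = 0)}"

definition Linf :: "(real \<Rightarrow> complex) set" where
  "Linf = {f \<in> borel_measurable lborel. \<exists>C. AE t in lborel. cmod (f t) \<le> C}"

definition Hinf :: "(real \<Rightarrow> complex) set" where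
  "Hinf = {f \<in> Linf. \<forall>g\<in>H1. (LINT t|lborel. f t * g t) = 0}"

definition weakly_analytic ::
    "'a measure \<Rightarrow> (real \<Rightarrow> ('a set \<Rightarrow> complex) \<Rightarrow> ('a set \<Rightarrow> complex)) \<Rightarrow> ('a set \<Rightarrow> complex) \<Rightarrow> bool" where
  "weakly_analytic M T \<mu> \<longleftrightarrow>
     \<mu> \<in> weakly_measurable M T \<and> (\<forall>A\<in>sets M. (\<lambda>t. T t \<mu> A) \<in> Hinf)"

definition quasi_invariant ::
    "'a measure \<Rightarrow> (real \<Rightarrow> ('a set \<Rightarrow> complex) \<Rightarrow> ('a set \<Rightarrow> complex)) \<Rightarrow> ('a set \<Rightarrow> complex) \<Rightarrow> bool" where
  "quasi_invariant M T \<sigma> \<longleftrightarrow> \<sigma> \<in> weakly_measurable M T \<and>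
     (\<forall>t. \<forall>A\<in>sets M. total_variation M (T t \<sigma>) A = 0 \<longleftrightarrow> total_variation M \<sigma> A = 0)"

end

theory Submission
  imports Defs "HOL-Complex_Analysis.Complex_Analysis"
begin

text \<open>
  Let \<open>P y \<mu>\<close> be the average of the orbit of \<open>\<mu>\<close> against the Poisson kernel at height \<open>y\<close>. If \<open>f\<close> is
  bounded and analytic in the upper half plane and its modulus has, at height \<open>y\<close>, a mean close to
  \<open>\<bar>f(\<i> y)\<bar>\<close>, then \<open>f\<close> is close to \<open>f(\<i> y)\<close> in the mean; this follows from Szego's extremal problem.
  Summing this over the blocks of a partition of \<open>\<Omega>\<close> and using that the operators are isometries, one
  sees that \<open>T t (P y \<mu>)\<close> is close to \<open>P u \<mu>\<close> in the mean over \<open>t\<close> whenever \<open>y \<le> u / 2\<close> and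
  \<open>\<parallel>P u \<mu>\<parallel>\<close> is close to its supremum, so the \<open>P y \<mu>\<close> are Cauchy in norm as \<open>y\<close> tends to \<open>0\<close>. Their limit
  has the same orbit functions as \<open>\<mu>\<close> almost everywhere, so it is \<open>\<mu>\<close> because \<open>T\<close> is sup path attaining;
  hence the orbit of \<open>\<mu>\<close> is continuous.

  Isometries preserve singularity, which is expressed by norms of sums and differences, so every \<open>T t\<close>
  preserves absolute continuity and singularity with respect to the quasi-invariant \<open>\<sigma>\<close>. By continuity
  one \<open>\<sigma>\<close>-null set \<open>N\<close> carries the singular parts of the whole orbit. So \<open>T t \<mu>\<^sub>s A = T t \<mu> (A \<inter> N)\<close>
  for all \<open>t\<close>, and weak analyticity of \<open>\<mu>\<^sub>s\<close> and \<open>\<mu>\<^sub>a\<close> can be read off.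
\<close>

section \<open>The Poisson kernel\<close>

text \<open>Weak analyticity speaks about each set \<open>A\<close> separately and only for almost
  every \<open>t\<close>, whereas the singular part of \<open>T t \<mu>\<close> sits on a null set
  that may move with \<open>t\<close>. Uncountable unions of null sets are out of control, so
  continuity of the orbit has to be earned before any null set can be chosen. For one scalar
  function, nearness of the value at \<open>\<i> y\<close> to the mean modulus costs a square root,
  and square roots do not add up well over many blocks. After Cauchy-Schwarz only the sum of the
  deficits matters, and it is small: isometry bounds the sum of the mean moduli over all blocks by
  the norm of \<mu>, whatever the partition. The extremal problem takes the place of logarithmic
  integrals. It asks of the mean only that multiplying by an exponential of nonnegative frequency
  acts as multiplication by its value at \<open>\<i> y\<close>, which is exactly what pairing with
  \<open>H1\<close> provides. Poisson kernels are used because their semigroup law links averages at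
  different heights, and because their densities define regular measures, with which
  \<open>T\<close> commutes.\<close>

definition poisson :: "real \<Rightarrow> real \<Rightarrow> real" where
  "poisson y t = y / (pi * (t\<^sup>2 + y\<^sup>2))"

lemma poisson_nonneg: "0 < y \<Longrightarrow> 0 \<le> poisson y t"
  by (simp add: poisson_def)

lemma poisson_minus [simp]: "poisson y (- t) = poisson y t"
  by (simp add: poisson_def)

lemma poisson_minus_commute: "poisson y (s - t) = poisson y (t - s)"
  by (simp add: poisson_def power2_commute)

lemma poisson_measurable [measurable]: "poisson y \<in> borel_measurable borel"
  unfolding poisson_def by measurable

lemma poisson_has_bochner_integral:
  assumes "0 < y"
  shows "has_bochner_integral lborel (poisson y) 1"
proof -
  have "has_bochner_integral lborel (\<lambda>x::real. inverse (1 + x\<^sup>2)) pi"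
    using integrable_inverse_1_plus_square LBINT_inverse_1_plus_square
    by (simp add: has_bochner_integral_iff interval_lebesgue_integral_def set_integrable_def
        set_lebesgue_integral_def)
  from has_bochner_integral_mult_right[OF this, of "1 / (pi * y)"]
  have "has_bochner_integral lborel (\<lambda>x. poisson y (0 + y * x)) (1 /\<^sub>R \<bar>y\<bar>)"
  proof (rule has_bochner_integral_cong[THEN iffD1, rotated 3])
    fix x :: real
    have "(0 + y * x)\<^sup>2 + y\<^sup>2 = y\<^sup>2 * (1 + x\<^sup>2)" by (simp add: power2_eq_square algebra_simps)
    then have "poisson y (0 + y * x) = y / (pi * (y\<^sup>2 * (1 + x\<^sup>2)))" by (simp only: poisson_def)
    then show "1 / (pi * y) * inverse (1 + x\<^sup>2) = poisson y (0 + y * x)"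
      using assms by (simp add: power2_eq_square divide_inverse mult.assoc)
  qed (use assms in \<open>auto simp: divide_inverse\<close>)
  then show ?thesis
    using assms lborel_has_bochner_integral_real_affine_iff[of y "poisson y" 1 0] by simp
qed

lemma poisson_integrable: "0 < y \<Longrightarrow> integrable lborel (poisson y)"
  and poisson_integral: "0 < y \<Longrightarrow> (LINT t|lborel. poisson y t) = 1"
  using poisson_has_bochner_integral by (auto simp: has_bochner_integral_iff)

text \<open>The numerator grows by a factor of at most 2 and the denominator does not shrink. With
  \<open>v = u - y\<close> and \<open>y \<le> u / 2\<close> this carries an estimate at height
  \<open>u - y\<close> over to the fixed height \<open>u\<close>.\<close>

lemma poisson_le_twice:
  assumes "0 < u" "u / 2 \<le> v" "v \<le> u"
  shows "poisson u t \<le> 2 * poisson v t"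
proof -
  have "poisson u t \<le> (2 * v) / (pi * (t\<^sup>2 + v\<^sup>2))"
    unfolding poisson_def using assms
    by (intro frac_le mult_left_mono add_left_mono power_mono mult_pos_pos add_nonneg_pos) auto
  then show ?thesis by (simp add: poisson_def)
qed

text \<open>The bound is a multiple of the kernel itself, so it integrates at once: translating the
  kernel by \<open>s\<close> costs at most the bracket in L1. This is the modulus of continuity for
  orbits of Poisson averages.\<close>

lemma poisson_shift_diff:
  assumes "0 < y"
  shows "\<bar>poisson y (t - s) - poisson y t\<bar> \<le> poisson y t * (\<bar>s\<bar> / y + s\<^sup>2 / y\<^sup>2)"
proof -
  define D where "D = (t - s)\<^sup>2 + y\<^sup>2"
  have D: "0 < D" using assms by (simp add: D_def add_nonneg_pos)
  have E: "0 < t\<^sup>2 + y\<^sup>2" using assms by (simp add: add_nonneg_pos)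
  have eq: "poisson y (t - s) - poisson y t = poisson y t * ((t\<^sup>2 - (t - s)\<^sup>2) / D)"
  proof -
    have "poisson y (t - s) - poisson y t = y / (pi * D) - y / (pi * (t\<^sup>2 + y\<^sup>2))"
      by (simp add: poisson_def D_def)
    also have "\<dots> = y / pi * (1 / D - 1 / (t\<^sup>2 + y\<^sup>2))" by (simp add: algebra_simps)
    also have "1 / D - 1 / (t\<^sup>2 + y\<^sup>2) = ((t\<^sup>2 + y\<^sup>2) - D) / (D * (t\<^sup>2 + y\<^sup>2))"
      using D E by (subst diff_frac_eq) auto
    also have "(t\<^sup>2 + y\<^sup>2) - D = t\<^sup>2 - (t - s)\<^sup>2" by (simp add: D_def)
    finally show ?thesis by (simp add: poisson_def)
  qed
  have "\<bar>t\<^sup>2 - (t - s)\<^sup>2\<bar> = \<bar>s * (2 * (t - s)) + s\<^sup>2\<bar>"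
    by (simp add: power2_eq_square algebra_simps)
  also have "\<dots> \<le> \<bar>s\<bar> * (2 * \<bar>t - s\<bar>) + s\<^sup>2"
    by (rule order_trans[OF abs_triangle_ineq]) (simp only: abs_mult abs_numeral abs_power2 order_refl)
  also have "\<dots> \<le> \<bar>s\<bar> * (D / y) + s\<^sup>2 * (D / y\<^sup>2)"
  proof (intro add_mono mult_left_mono)
    \<comment> \<open>Expanding this square gives
      \<open>2 * \<bar>t - s\<bar> * y \<le> D\<close>.\<close>
    have "0 \<le> (\<bar>t - s\<bar> - y)\<^sup>2" by simp
    then show "2 * \<bar>t - s\<bar> \<le> D / y"
      using assms by (simp add: D_def field_simps power2_eq_square)
    have "y\<^sup>2 \<le> D" by (simp add: D_def)
    then have "s\<^sup>2 * 1 \<le> s\<^sup>2 * (D / y\<^sup>2)"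
      using assms by (intro mult_left_mono) auto
    then show "s\<^sup>2 \<le> s\<^sup>2 * (D / y\<^sup>2)" by simp
  qed auto
  finally have "\<bar>t\<^sup>2 - (t - s)\<^sup>2\<bar> / D \<le> \<bar>s\<bar> / y + s\<^sup>2 / y\<^sup>2"
    using D by (simp add: field_simps)
  then show ?thesis
    unfolding eq abs_mult using D poisson_nonneg[OF assms, of t] by (intro mult_mono) auto
qed

text \<open>The contour is the boundary of a large upper half disc.\<close>

lemma integral_upper_half_plane_eq_0:
  fixes G :: "complex \<Rightarrow> complex"
  assumes hol: "G holomorphic_on {z. - d < Im z}" and d: "0 < d"
    and bnd: "\<And>z. 0 \<le> Im z \<Longrightarrow> R \<le> norm z \<Longrightarrow> norm (G z) \<le> C / (norm z)\<^sup>2"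
    and int: "integrable lborel (\<lambda>t. G (of_real t))"
  shows "(LINT t|lborel. G (of_real t)) = 0"
proof -
  let ?g = "\<lambda>t::real. G (of_real t)"
  have C: "0 \<le> C" 
  proof -
    \<comment> \<open>Nonnegativity of \<open>C\<close> is read off from the bound at one point of
      the imaginary axis, at distance \<open>max R 1\<close> from the origin.\<close>
    define z where "z = \<i> * of_real (max R 1)"
    have "norm z = max R 1" "Im z = max R 1" by (auto simp: z_def norm_mult)
    with bnd[of z] have "0 \<le> C / (max R 1)\<^sup>2" by (smt (verit) norm_ge_zero)
    moreover have "0 < (max R 1)\<^sup>2" by (intro zero_less_power) auto
    ultimately show ?thesis by (simp add: zero_le_divide_iff)
  qed
  \<comment> \<open>The arc has length \<open>pi * r\<close> and \<open>G\<close> is at most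
    \<open>C / r\<^sup>2\<close> on it; the integral over the segment is the negative of that over
    the arc.\<close>
  have le: "norm (LBINT t:{-r..r}. ?g t) \<le> C * pi / r" if r: "R \<le> r" "0 < r" for r
  proof -
    let ?L = "linepath (of_real (-r)) (of_real r) :: real \<Rightarrow> complex"
    let ?A = "part_circlepath 0 r 0 pi"
    have imL: "path_image ?L \<subseteq> {z. - d < Im z}"
      using d by (auto simp: closed_segment_def)
    have imA: "0 \<le> Im z \<and> norm z = r" if "z \<in> path_image ?A" for z
      using that r by (auto simp: path_image_def part_circlepath_def linepath_def Im_exp norm_mult
          intro!: mult_nonneg_nonneg sin_ge_zero)
    have "(G has_contour_integral 0) (?L +++ ?A)"
    proof (rule Cauchy_theorem_convex_simple[OF hol])
      show "convex {z. - d < Im z}" by (rule convex_halfspace_Im_gt)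
      show "path_image (?L +++ ?A) \<subseteq> {z. - d < Im z}"
        using imL imA d by (fastforce simp: path_image_join)
    qed (auto intro!: valid_path_join)
    then have 0: "contour_integral (?L +++ ?A) G = 0" by (rule contour_integral_unique)
    have cont: "continuous_on {z. - d < Im z} G" by (rule holomorphic_on_imp_continuous_on[OF hol])
    have iL: "G contour_integrable_on ?L"
      by (rule contour_integrable_continuous_linepath) (use continuous_on_subset[OF cont] imL in auto)
    have iA: "G contour_integrable_on ?A"
      by (rule contour_integrable_continuous_part_circlepath, rule continuous_on_subset[OF cont])
        (use imA d in fastforce)
    have "contour_integral ?L G + contour_integral ?A G = 0"
      using 0 iL iA by (subst (asm) contour_integral_join) auto
    then have "norm (contour_integral ?L G) = norm (contour_integral ?A G)"
      by (simp add: add_eq_0_iff)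
    also have "\<dots> \<le> C / r\<^sup>2 * r * (pi - 0)"
      using has_contour_integral_integral[OF iA] C r imA
      by (intro has_contour_integral_bound_part_circlepath) (use bnd in fastforce)+
    also have "contour_integral ?L G = integral {-r..r} ?g"
      using r by (subst contour_integral_linepath_Reals_eq) auto
    also have "\<dots> = (LBINT t:{-r..r}. ?g t)"
      using int by (intro set_borel_integral_eq_integral(2)[symmetric])
        (auto simp: set_integrable_def intro: integrable_mult_indicator)
    finally show ?thesis using r by (simp add: power2_eq_square)
  qed
  have lim: "(\<lambda>n. LBINT t:{-real n..real n}. ?g t) \<longlonglongrightarrow> (LINT t|lborel. ?g t)"
    unfolding set_lebesgue_integral_def
  proof (rule integral_dominated_convergence[where w = "\<lambda>t. norm (?g t)"])
    show "AE x in lborel. (\<lambda>n. indicat_real {- real n..real n} x *\<^sub>R ?g x) \<longlonglongrightarrow> ?g x"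
    proof (rule AE_I2)
      fix x :: real
      have "eventually (\<lambda>n. indicat_real {- real n..real n} x *\<^sub>R ?g x = ?g x) sequentially"
        using eventually_ge_at_top[of "nat \<lceil>\<bar>x\<bar>\<rceil>"]
        by eventually_elim (auto simp: indicator_def nat_le_iff ceiling_le_iff)
      then show "(\<lambda>n. indicat_real {- real n..real n} x *\<^sub>R ?g x) \<longlonglongrightarrow> ?g x"
        by (rule tendsto_eventually)
    qed
  qed (use int in \<open>auto simp: indicator_def\<close>)
  have "(\<lambda>n. LBINT t:{-real n..real n}. ?g t) \<longlonglongrightarrow> 0"
  proof (rule Lim_null_comparison)
    show "eventually (\<lambda>n. norm (LBINT t:{-real n..real n}. ?g t) \<le> C * pi / real n) sequentially"
      using eventually_ge_at_top[of "nat \<lceil>\<bar>R\<bar>\<rceil> + 1"]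
    proof eventually_elim
      case (elim n)
      then have "\<bar>R\<bar> \<le> real n" "0 < n" by linarith+
      then show ?case by (intro le) auto
    qed
    show "(\<lambda>n. C * pi / real n) \<longlonglongrightarrow> 0" by (rule lim_const_over_n)
  qed
  with lim show ?thesis using LIMSEQ_unique by blast
qed

lemma integrable_bounded_poisson:
  fixes f :: "real \<Rightarrow> complex"
  assumes "0 < y" "f \<in> borel_measurable borel" "\<And>t. norm (f t) \<le> B"
  shows "integrable lborel (\<lambda>t. f t * of_real (poisson y (x - t)))"
    and "integrable lborel (\<lambda>t. f t * of_real (poisson y (t - x)))"
    and "integrable lborel (\<lambda>t. f t * of_real (poisson y t))"
proof -
  have 1: "integrable lborel (\<lambda>t. poisson y (-x + 1 * t))"
    using poisson_integrable[OF assms(1)] by (subst lborel_integrable_real_affine_iff) auto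
  have "integrable lborel (\<lambda>t. B * poisson y (t - x))"
    using integrable_mult_right[OF 1, of B] by simp
  then show "integrable lborel (\<lambda>t. f t * of_real (poisson y (t - x)))"
    by (rule Bochner_Integration.integrable_bound)
      (use assms(2) in \<open>auto simp: norm_mult abs_mult intro!: mult_right_mono order_trans[OF assms(3) abs_ge_self]\<close>)
  then show "integrable lborel (\<lambda>t. f t * of_real (poisson y (x - t)))"
    by (simp add: poisson_minus_commute)
  have "integrable lborel (\<lambda>t. B * poisson y t)"
    using integrable_mult_right[OF poisson_integrable[OF assms(1)], of B] by simp
  then show "integrable lborel (\<lambda>t. f t * of_real (poisson y t))"
    by (rule Bochner_Integration.integrable_bound)
      (use assms(2) in \<open>auto simp: norm_mult abs_mult intro!: mult_right_mono order_trans[OF assms(3) abs_ge_self]\<close>)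
qed

lemma poisson_formula:
  fixes F :: "complex \<Rightarrow> complex"
  assumes hol: "F holomorphic_on {z. - d < Im z}" and d: "0 < d" and y: "0 < y"
    and bnd: "\<And>z. 0 \<le> Im z \<Longrightarrow> norm (F z) \<le> B"
  shows "(LINT t|lborel. F (of_real t) * of_real (poisson y t)) = F (\<i> * of_real y)"
proof -
  let ?w = "\<i> * complex_of_real y"
  define H where "H = (\<lambda>z. if z = ?w then deriv F ?w else (F z - F ?w) / (z - ?w))"
  define G where "G = (\<lambda>z. H z / (z + ?w))"
  have "open {z. - d < Im z}" by (rule open_halfspace_Im_gt)
  then have H: "H holomorphic_on {z. - d < Im z}"
    unfolding H_def by (rule pole_lemma_open[OF hol])
  \<comment> \<open>The factor \<open>z + ?w\<close> vanishes at height \<open>- y\<close>;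
    shrinking the half plane to \<open>min d y\<close> keeps this pole of \<open>G\<close>
    outside.\<close>
  have "{z. - min d y < Im z} \<subseteq> {z. - d < Im z}" by auto
  moreover have "z + ?w \<noteq> 0" if "- min d y < Im z" for z
    using that by (auto simp: complex_eq_iff)
  ultimately have G: "G holomorphic_on {z. - min d y < Im z}"
    unfolding G_def by (intro holomorphic_intros holomorphic_on_subset[OF H]) auto
  have "norm (F 0) \<le> B" by (rule bnd) simp
  then have B: "0 \<le> B" using norm_ge_zero[of "F 0"] by linarith
  have cont: "continuous_on {z. - d < Im z} F" by (rule holomorphic_on_imp_continuous_on[OF hol])
  have Fm [measurable]: "(\<lambda>t::real. F (of_real t)) \<in> borel_measurable borel"
    by (intro borel_measurable_continuous_onI continuous_on_compose2[OF cont] continuous_intros)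
      (use d in auto)
  have Fi: "integrable lborel (\<lambda>t. F (of_real t) * of_real (poisson y t))"
    by (rule integrable_bounded_poisson[OF y _ bnd]) auto
  have Pi: "integrable lborel (\<lambda>t. F ?w * complex_of_real (poisson y t))"
    using poisson_integrable[OF y] by simp
  have Geq: "G (of_real t) =
      of_real (pi / y) * (F (of_real t) * of_real (poisson y t) - F ?w * of_real (poisson y t))" for t
  proof -
    have ne: "complex_of_real t \<noteq> ?w" using y by (auto simp: complex_eq_iff)
    have p: "complex_of_real (poisson y t) = of_real (y / pi) / ((of_real t - ?w) * (of_real t + ?w))"
      by (simp add: poisson_def power2_eq_square algebra_simps)
    have "of_real (pi / y) * complex_of_real (poisson y t) = 1 / ((of_real t - ?w) * (of_real t + ?w))"
      unfolding p using y by simp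
    then have "1 / ((of_real t - ?w) * (of_real t + ?w)) * (F (of_real t) - F ?w) =
      of_real (pi / y) * (F (of_real t) * of_real (poisson y t) - F ?w * of_real (poisson y t))"
      by (metis (no_types, lifting) left_diff_distrib mult.assoc mult.commute)
    then show ?thesis using ne unfolding G_def H_def by simp
  qed
  have Gi: "integrable lborel (\<lambda>t. G (of_real t))"
    unfolding Geq using Fi Pi by (intro integrable_mult_right integrable_diff) auto
  have "(LINT t|lborel. G (of_real t)) = 0"
  proof (rule integral_upper_half_plane_eq_0[OF G _ _ Gi])
    \<comment> \<open>Beyond radius \<open>2 * y\<close> both factors of the denominator are at
      least half of \<open>norm z\<close>, which turns the numerator bound \<open>2 * B\<close> into
      \<open>8 * B\<close>.\<close>
    fix z :: complex assume z: "0 \<le> Im z" "2 * y \<le> norm z"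
    have nz: "0 < norm z" using z y by linarith
    have nw: "norm ?w = y" using y by (simp add: norm_mult)
    have 1: "norm z / 2 \<le> norm (z - ?w)" using norm_triangle_ineq2[of z ?w] z nw by linarith
    have 2: "norm z / 2 \<le> norm (z + ?w)" using norm_triangle_ineq2[of z "-?w"] z nw by simp
    have "z \<noteq> ?w" using 1 nz by auto
    then have "norm (G z) = norm (F z - F ?w) / (norm (z - ?w) * norm (z + ?w))"
      by (simp add: G_def H_def norm_divide norm_mult)
    also have "\<dots> \<le> (2 * B) / (norm z / 2 * (norm z / 2))"
      using 1 2 nz bnd[OF z(1)] bnd[of ?w] y B
      by (intro frac_le mult_mono order_trans[OF norm_triangle_ineq4]) auto
    finally show "norm (G z) \<le> 8 * B / (norm z)\<^sup>2" by (simp add: power2_eq_square)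
  qed (use d y in auto)
  then have "(LINT t|lborel. F (of_real t) * of_real (poisson y t)) =
      (LINT t|lborel. F ?w * of_real (poisson y t))"
    unfolding Geq using Fi Pi y by simp
  also have "\<dots> = F ?w" using poisson_integral[OF y] by simp
  finally show ?thesis .
qed

section \<open>Fourier transform and semigroup law of the Poisson kernel\<close>

lemma poisson_exp:
  assumes y: "0 < y" and a: "0 \<le> a"
  shows "(LINT t|lborel. exp (\<i> * of_real (a * t)) * of_real (poisson y t)) = of_real (exp (- (y * a)))"
proof -
  have "(LINT t|lborel. exp (\<i> * of_real a * of_real t) * of_real (poisson y t))
      = exp (\<i> * of_real a * (\<i> * of_real y))"
  proof (rule poisson_formula[OF _ zero_less_one y])
    show "norm (exp (\<i> * complex_of_real a * z)) \<le> 1" if "0 \<le> Im z" for z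
      using that a by (simp add: norm_exp)
  qed (intro holomorphic_intros)
  also have "\<i> * of_real a * (\<i> * of_real y) = complex_of_real (- (y * a))"
    by (simp add: algebra_simps)
  finally show ?thesis by (simp only: exp_of_real of_real_mult mult.assoc)
qed

lemma poisson_exp_minus:
  assumes y: "0 < y" and a: "0 \<le> a"
  shows "(LINT t|lborel. exp (- (\<i> * of_real (a * t))) * of_real (poisson y t)) = of_real (exp (- (y * a)))"
proof -
  have "(LINT t|lborel. exp (- (\<i> * of_real (a * t))) * of_real (poisson y t)) =
     (LINT t|lborel. cnj (exp (\<i> * of_real (a * t)) * of_real (poisson y t)))"
    by (intro Bochner_Integration.integral_cong refl) (simp add: exp_cnj)
  also have "\<dots> = cnj (LINT t|lborel. exp (\<i> * of_real (a * t)) * of_real (poisson y t))"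
    by (rule Bochner_Integration.integral_cnj)
  finally show ?thesis by (simp only: poisson_exp[OF assms] complex_cnj_complex_of_real)
qed

lemma fourier_poisson:
  assumes "0 < y"
  shows "fourier (\<lambda>t. of_real (poisson y t)) s = of_real (exp (- (y * \<bar>s\<bar>)))"
proof (cases "0 \<le> s")
  case True
  then show ?thesis
    using poisson_exp_minus[OF assms True] by (simp add: fourier_def ac_simps)
next
  case False
  then show ?thesis
    using poisson_exp[OF assms, of "- s"] by (simp add: fourier_def ac_simps)
qed

text \<open>As a function of \<open>t\<close>, \<open>poisson b (x - t)\<close> is
  \<open>- 1 / pi\<close> times the imaginary part of the Cauchy kernel with pole \<open>w\<close>
  in the lower half plane. That kernel is bounded and analytic above, so convolving with
  \<open>poisson a\<close> just evaluates it at \<open>\<i> * a\<close>.\<close>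

lemma poisson_conv:
  assumes a: "0 < a" and b: "0 < b"
  shows "(LINT t|lborel. poisson a t * poisson b (x - t)) = poisson (a + b) x"
proof -
  define w where "w = Complex x (- b)"
  have w: "z \<noteq> w" if "- b < Im z" for z using that by (auto simp: w_def)
  have eq: "(LINT t|lborel. 1 / (of_real t - w) * of_real (poisson a t)) = 1 / (\<i> * of_real a - w)"
  proof (rule poisson_formula[OF _ b a])
    show "(\<lambda>z. 1 / (z - w)) holomorphic_on {z. - b < Im z}"
      using w by (intro holomorphic_intros) auto
    show "norm (1 / (z - w)) \<le> 1 / b" if "0 \<le> Im z" for z
    proof -
      have "b \<le> norm (z - w)"
        using that b abs_Im_le_cmod[of "z - w"] by (simp add: w_def)
      then show ?thesis using b by (simp add: norm_divide frac_le)
    qed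
  qed
  have p: "poisson b (x - t) = - (1 / pi) * Im (1 / (of_real t - w))" for t
    by (simp add: w_def poisson_def Im_divide power2_commute[of x])
  have meas: "(\<lambda>t::real. 1 / (of_real t - w)) \<in> borel_measurable borel" by measurable
  have bd: "norm (1 / (of_real t - w)) \<le> 1 / b" for t
  proof -
    have "b \<le> norm (of_real t - w)"
      using b abs_Im_le_cmod[of "of_real t - w"] by (simp add: w_def)
    then show ?thesis using b by (simp add: norm_divide frac_le)
  qed
  have int: "integrable lborel (\<lambda>t. 1 / (of_real t - w) * of_real (poisson a t))"
    by (rule integrable_bounded_poisson(3)[OF a meas bd])
  have "(LINT t|lborel. poisson a t * poisson b (x - t)) =
    (LINT t|lborel. - (1 / pi) * Im (1 / (of_real t - w) * of_real (poisson a t)))"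
    unfolding p by (intro Bochner_Integration.integral_cong refl) (simp add: Im_divide)
  also have "\<dots> = - (1 / pi) * Im (1 / (\<i> * of_real a - w))"
    using int eq by (simp add: integral_Im)
  also have "\<dots> = poisson (a + b) x"
    by (simp add: w_def poisson_def Im_divide) (simp add: minus_divide_left)
  finally show ?thesis .
qed

section \<open>Recovering a bounded function from its Poisson averages\<close>

lemma poisson_box_integral:
  assumes "0 < y" "a \<le> b"
  shows "(LINT x|lborel. indicator {a..b} x * poisson y (x - t)) =
    (arctan ((b - t) / y) - arctan ((a - t) / y)) / pi"
proof -
  have "(LBINT x. poisson y (x - t) * indicator {a..b} x) =
    arctan ((b - t) / y) / pi - arctan ((a - t) / y) / pi"
  proof (rule integral_FTC_Icc_real[OF assms(2)])
    fix x :: real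
    have "0 < y\<^sup>2 + (x - t)\<^sup>2" using assms by (simp add: add_pos_nonneg)
    then show "DERIV (\<lambda>x. arctan ((x - t) / y) / pi) x :> poisson y (x - t)"
      unfolding poisson_def using assms
      by (auto intro!: derivative_eq_intros simp: divide_simps power2_eq_square)
    show "isCont (\<lambda>x. poisson y (x - t)) x"
      unfolding poisson_def using \<open>0 < y\<^sup>2 + (x - t)\<^sup>2\<close> by (intro continuous_intros) (auto simp: add.commute)
  qed
  then show ?thesis by (simp add: mult.commute diff_divide_distrib)
qed

lemma poisson_box_integral_tendsto:
  assumes y: "\<And>n. 0 < y n" "y \<longlonglongrightarrow> 0" and ab: "a \<le> b" "t \<noteq> a" "t \<noteq> b"
  shows "(\<lambda>n::nat. LINT x|lborel. indicator {a..b} x * poisson (y n) (x - t)) \<longlonglongrightarrow> indicat_real {a..b} t"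
proof -
  have top: "LIM n sequentially. inverse (y n) :> at_top"
    using y by (intro filterlim_inverse_at_top) auto
  have pos: "(\<lambda>n. arctan (c / y n)) \<longlonglongrightarrow> pi / 2" if "0 < c" for c
  proof -
    have "LIM n sequentially. c * inverse (y n) :> at_top"
      by (rule filterlim_tendsto_pos_mult_at_top[OF tendsto_const that top])
    then have "(\<lambda>n. arctan (c * inverse (y n))) \<longlonglongrightarrow> pi / 2"
      by (rule filterlim_compose[OF tendsto_arctan_at_top])
    then show ?thesis by (simp only: divide_inverse)
  qed
  have neg: "(\<lambda>n. arctan (c / y n)) \<longlonglongrightarrow> - (pi / 2)" if "c < 0" for c
    using tendsto_minus[OF pos[of "- c"]] that by (simp add: arctan_minus)
  consider "t < a" | "a < t" "t < b" | "b < t" using ab by linarith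
  then show ?thesis
  proof cases
    case 1
    then have "(\<lambda>n. (arctan ((b - t) / y n) - arctan ((a - t) / y n)) / pi) \<longlonglongrightarrow> (pi / 2 - pi / 2) / pi"
      using ab by (intro tendsto_intros pos) auto
    then show ?thesis using 1 ab y by (simp add: poisson_box_integral)
  next
    case 2
    then have "(\<lambda>n. (arctan ((b - t) / y n) - arctan ((a - t) / y n)) / pi) \<longlonglongrightarrow> (pi / 2 - (- (pi / 2))) / pi"
      using ab by (intro tendsto_intros pos neg) auto
    then show ?thesis using 2 ab y by (simp add: poisson_box_integral)
  next
    case 3
    then have "(\<lambda>n. (arctan ((b - t) / y n) - arctan ((a - t) / y n)) / pi) \<longlonglongrightarrow> (- (pi / 2) - (- (pi / 2))) / pi"
      using ab by (intro tendsto_intros neg) auto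
    then show ?thesis using 3 ab y by (simp add: poisson_box_integral)
  qed
qed

lemma integrable_poisson_shift:
  assumes "0 < y"
  shows "integrable lborel (\<lambda>x. poisson y (x - t))" and "(LINT x|lborel. poisson y (x - t)) = 1"
  using poisson_has_bochner_integral[OF assms]
    lborel_has_bochner_integral_real_affine_iff[of 1 "poisson y" 1 "-t"]
  by (auto simp: has_bochner_integral_iff)

text \<open>An integrable majorant in \<open>t\<close> that does not depend on the height
  \<open>y \<le> 1\<close>, for dominated convergence as \<open>y\<close> tends to 0: near the box
  the total mass 1 of the kernel suffices, far away its quadratic decay.\<close>

lemma poisson_box_integral_bound:
  assumes y: "0 < y" "y \<le> 1" and ab: "a \<le> b" and R: "\<bar>a\<bar> \<le> R" "\<bar>b\<bar> \<le> R"
  shows "(LINT x|lborel. indicator {a..b} x * poisson y (x - t))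
    \<le> indicator {-(2*R+1)..2*R+1} t + 8 * (b - a) * poisson 1 t" (is "?K \<le> _")
    and "0 \<le> (LINT x|lborel. indicator {a..b} x * poisson y (x - t))"
proof -
  have int: "integrable lborel (\<lambda>x. indicator {a..b} x * poisson y (x - t))"
    using integrable_mult_indicator[OF _ integrable_poisson_shift(1)[OF y(1)], of "{a..b}" t] by simp
  have p: "0 \<le> poisson y x" for x using y by (rule_tac poisson_nonneg)
  show "?K \<le> indicator {-(2*R+1)..2*R+1} t + 8 * (b - a) * poisson 1 t"
  proof (cases "\<bar>t\<bar> \<le> 2 * R + 1")
    case True
    have "?K \<le> (LINT x|lborel. poisson y (x - t))"
      by (intro integral_mono int integrable_poisson_shift(1)[OF y(1)]) (auto simp: indicator_def p)
    also have "\<dots> = 1" by (rule integrable_poisson_shift(2)[OF y(1)])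
    also have "\<dots> \<le> indicator {-(2*R+1)..2*R+1} t + 8 * (b - a) * poisson 1 t"
      using True ab poisson_nonneg[of 1 t] by (simp add: abs_le_iff)
    finally show ?thesis .
  next
    case False
    have "?K \<le> (LINT x|lborel. indicator {a..b} x * (8 * poisson 1 t))"
    proof (intro integral_mono int)
      show "integrable lborel (\<lambda>x. indicator {a..b} x * (8 * poisson 1 t))"
        by (intro integrable_mult_left integrable_real_indicator) (auto simp: emeasure_lborel_Icc_eq)
      fix x
      show "indicator {a..b} x * poisson y (x - t) \<le> indicator {a..b} x * (8 * poisson 1 t)"
      proof (cases "x \<in> {a..b}")
        case True
        then have x: "\<bar>x\<bar> \<le> R" using R by auto
        \<comment> \<open>Here \<open>\<bar>x\<bar> \<le> R\<close> and
          \<open>\<bar>t\<bar> > 2 * R + 1\<close>, so \<open>x\<close> is at least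
          \<open>\<bar>t\<bar> / 2\<close> away from \<open>t\<close>, and
          \<open>\<bar>t\<bar> \<ge> 1\<close> gives
          \<open>t\<^sup>2 / 4 \<ge> (t\<^sup>2 + 1) / 8\<close>. This is the origin of the constant
          8.\<close>
        have "\<bar>t\<bar> / 2 \<le> \<bar>x - t\<bar>" using x False by linarith
        then have "(\<bar>t\<bar> / 2)\<^sup>2 \<le> \<bar>x - t\<bar>\<^sup>2" by (rule power_mono) auto
        moreover have "1 \<le> \<bar>t\<bar>" using False x by linarith
        then have "1\<^sup>2 \<le> \<bar>t\<bar>\<^sup>2" by (rule power_mono) auto
        ultimately have "t\<^sup>2 / 4 \<le> (x - t)\<^sup>2" "1 \<le> t\<^sup>2" by (simp_all add: power_divide)
        then have 1: "(t\<^sup>2 + 1) / 8 \<le> (x - t)\<^sup>2 + y\<^sup>2" using zero_le_power2[of y] by argo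
        have "poisson y (x - t) \<le> 1 / (pi * ((t\<^sup>2 + 1) / 8))"
          unfolding poisson_def using y 1 by (intro frac_le mult_left_mono) (auto simp: add_nonneg_pos)
        then show ?thesis using True by (simp add: poisson_def)
      qed auto
    qed
    also have "\<dots> = 8 * (b - a) * poisson 1 t"
      using ab by simp
    finally show ?thesis using False by (auto simp: indicator_def)
  qed
  show "0 \<le> ?K" by (intro integral_nonneg_AE) (auto simp: p)
qed

text \<open>Cut off to \<open>{-N..N}\<close> the function is integrable, and the Borel sets over
  which its integral vanishes contain the intervals and are closed under complements and disjoint
  unions. Countably many \<open>N\<close> exhaust the line.\<close>

lemma AE_eq_0_of_box_integrals:
  fixes h :: "real \<Rightarrow> complex"
  assumes m [measurable]: "h \<in> borel_measurable borel" and bd: "\<And>t. norm (h t) \<le> B"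
    and box: "\<And>a b. a \<le> b \<Longrightarrow> (LINT t|lborel. indicator {a..b} t * h t) = 0"
  shows "AE t in lborel. h t = 0"
proof -
  have *: "AE t in lborel. indicator {-N..N} t * h t = 0" if N: "0 \<le> N" for N :: real
  proof (rule sigma_finite_measure.density_zero[OF sigma_finite_lborel])
    have int: "integrable lborel (\<lambda>t. indicator {-N..N} t * h t)"
    proof (rule Bochner_Integration.integrable_bound)
      show "integrable lborel (\<lambda>t. B * indicat_real {-N..N} t)"
        by (intro integrable_mult_right integrable_real_indicator) (auto simp: emeasure_lborel_Icc_eq)
    qed (auto simp: indicator_def intro: order_trans[OF bd abs_ge_self])
    then show "integrable lborel (\<lambda>t. indicator {-N..N} t * h t)" .
    fix S :: "real set" assume "S \<in> sets lborel"
    then have "S \<in> sets borel" by simp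
    then show "(LINT t:S|lborel. indicator {-N..N} t * h t) = 0"
    proof (induction rule: borel_set_induct)
      case (interval a b)
      have "(LINT t:{a..b}|lborel. indicator {-N..N} t * h t) =
        (LINT t|lborel. indicator {max a (-N)..min b N} t * h t)"
        unfolding set_lebesgue_integral_def
        by (intro Bochner_Integration.integral_cong) (auto simp: indicator_def)
      also have "\<dots> = 0"
        using box[of "max a (-N)" "min b N"] by (cases "max a (-N) \<le> min b N") auto
      finally show ?case .
    next
      case (compl A)
      have "(LINT t:-A|lborel. indicator {-N..N} t * h t) =
         (LINT t|lborel. indicator {-N..N} t * h t - indicat_real A t *\<^sub>R (indicator {-N..N} t * h t))"
        unfolding set_lebesgue_integral_def
        by (intro Bochner_Integration.integral_cong) (auto simp: indicator_def)
      also have "\<dots> = (LINT t|lborel. indicator {-N..N} t * h t) - (LINT t:A|lborel. indicator {-N..N} t * h t)"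
        unfolding set_lebesgue_integral_def using compl
        by (intro Bochner_Integration.integral_diff int integrable_mult_indicator) auto
      finally show ?case
        using compl box[of "-N" N] N by simp
    next
      case (union A)
      have "(LINT t:(\<Union>i. A i)|lborel. indicator {-N..N} t * h t) =
        (\<Sum>i. (LINT t:A i|lborel. indicator {-N..N} t * h t))"
      proof (rule lebesgue_integral_countable_add)
        show "A i \<inter> A j = {}" if "i \<noteq> j" for i j
          using union(1) that by (auto simp: disjoint_family_on_def)
        show "set_integrable lborel (\<Union>i. A i) (\<lambda>t. indicator {-N..N} t * h t)"
          unfolding set_integrable_def using union(2) by (intro integrable_mult_indicator int) auto
      qed (use union(2) in auto)
      then show ?case
        using union(3) by simp
    qed (simp add: set_lebesgue_integral_def)
  qed
  have "AE t in lborel. \<forall>N::nat. indicator {-real N..real N} t * h t = 0"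
    unfolding AE_all_countable by (intro allI *) auto
  then show ?thesis
  proof eventually_elim
    case (elim t)
    obtain N :: nat where "\<bar>t\<bar> \<le> real N" using real_arch_simple by blast
    with elim[rule_format, of N] show ?case by (auto simp: indicator_def abs_le_iff split: if_splits)
  qed
qed

text \<open>A weak substitute for Fatou's theorem that avoids differentiation of integrals: the
  functions are compared only through their integrals over boxes. Fubini moves the kernel from
  \<open>f\<close> to the indicator of the box, where convergence is explicit.\<close>

lemma AE_eq_of_poisson_tendsto:
  fixes f g :: "real \<Rightarrow> complex"
  assumes f [measurable]: "f \<in> borel_measurable borel" and fB: "\<And>t. norm (f t) \<le> B"
    and g [measurable]: "g \<in> borel_measurable borel" and gB: "\<And>t. norm (g t) \<le> B"
    and y: "\<And>n. 0 < y n" "\<And>n. y n \<le> 1" "y \<longlonglongrightarrow> 0"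
    and lim: "\<And>x. (\<lambda>n::nat. LINT t|lborel. f t * of_real (poisson (y n) (x - t))) \<longlonglongrightarrow> g x"
  shows "AE t in lborel. f t = g t"
proof -
  have B: "0 \<le> B" using fB[of 0] norm_ge_zero[of "f 0"] by linarith
  have indg: "integrable lborel (\<lambda>t. indicator {a..b} t * F t)"
    if "F \<in> borel_measurable borel" "\<And>t. norm (F t) \<le> C" for F :: "real \<Rightarrow> complex" and a b C
  proof (rule Bochner_Integration.integrable_bound)
    show "integrable lborel (\<lambda>t. C * indicat_real {a..b} t)"
      by (intro integrable_mult_right integrable_real_indicator) (auto simp: emeasure_lborel_Icc_eq)
  qed (use that in \<open>auto simp: indicator_def intro: order_trans[OF _ abs_ge_self]\<close>)
  have "AE t in lborel. f t - g t = 0"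
  proof (rule AE_eq_0_of_box_integrals)
    show "norm (f t - g t) \<le> B + B" for t
      using norm_triangle_ineq4[of "f t" "g t"] fB[of t] gB[of t] by linarith
    fix a b :: real assume ab: "a \<le> b"
    define R where "R = max \<bar>a\<bar> \<bar>b\<bar>"
    define I where "I n = (LINT x|lborel. indicator {a..b} x *
        (LINT t|lborel. f t * of_real (poisson (y n) (x - t))))" for n
    have inner: "norm (LINT t|lborel. f t * of_real (poisson (y n) (x - t))) \<le> B" for n x
    proof -
      have "norm (LINT t|lborel. f t * of_real (poisson (y n) (x - t))) \<le>
        (LINT t|lborel. B * poisson (y n) (t - x))"
      proof (rule Bochner_Integration.integral_norm_bound_integral)
        show "integrable lborel (\<lambda>t. f t * of_real (poisson (y n) (x - t)))"
          by (rule integrable_bounded_poisson[OF y(1) f fB])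
        show "integrable lborel (\<lambda>t. B * poisson (y n) (t - x))"
          using integrable_poisson_shift(1)[OF y(1)] by auto
      qed (use fB y in \<open>auto simp: norm_mult poisson_minus_commute poisson_nonneg intro!: mult_right_mono\<close>)
      then show ?thesis using integrable_poisson_shift(2)[OF y(1)] by simp
    qed
    have "I \<longlonglongrightarrow> (LINT x|lborel. indicator {a..b} x * g x)"
      unfolding I_def
    proof (rule integral_dominated_convergence[where w = "\<lambda>x. B * indicator {a..b} x"])
      show "integrable lborel (\<lambda>x. B * indicat_real {a..b} x)"
        by (intro integrable_mult_right integrable_real_indicator) (auto simp: emeasure_lborel_Icc_eq)
      show "AE x in lborel. (\<lambda>n. indicator {a..b} x *
          (LINT t|lborel. f t * of_real (poisson (y n) (x - t)))) \<longlonglongrightarrow> indicator {a..b} x * g x"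
        using lim by (auto intro!: tendsto_intros)
    qed (use inner in \<open>auto simp: indicator_def\<close>)
    moreover have "I \<longlonglongrightarrow> (LINT t|lborel. indicator {a..b} t * f t)"
    proof -
      \<comment> \<open>\<open>K n\<close> is the Poisson integral of the box, so that
        \<open>I n\<close> becomes an integral of \<open>f\<close> against it.\<close>
      define K where "K n t = (LINT x|lborel. indicator {a..b} x * poisson (y n) (x - t))" for n t
      have IK: "I n = (LINT t|lborel. f t * of_real (K n t))" for n
      proof -
        have "I n = (LINT x|lborel. LINT t|lborel. indicator {a..b} x * (f t * of_real (poisson (y n) (x - t))))"
          unfolding I_def by simp
        also have "\<dots> = (LINT t|lborel. LINT x|lborel. indicator {a..b} x * (f t * of_real (poisson (y n) (x - t))))"
        proof (rule lborel_pair.Fubini_integral[symmetric], rule lborel_pair.Fubini_integrable)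
          have *: "(LINT t|lborel. norm (case (x, t) of (x, t) \<Rightarrow>
             indicator {a..b} x * (f t * complex_of_real (poisson (y n) (x - t))))) =
             indicator {a..b} x * (LINT t|lborel. norm (f t * of_real (poisson (y n) (x - t))))" for x
            by (simp add: norm_mult indicator_def)
          show "integrable lborel (\<lambda>x. LINT t|lborel. norm (case (x, t) of (x, t) \<Rightarrow>
             indicator {a..b} x * (f t * complex_of_real (poisson (y n) (x - t)))))"
            unfolding *
          proof (rule Bochner_Integration.integrable_bound)
            show "integrable lborel (\<lambda>x. B * indicat_real {a..b} x)"
              by (intro integrable_mult_right integrable_real_indicator) (auto simp: emeasure_lborel_Icc_eq)
            have "(LINT t|lborel. norm (f t * of_real (poisson (y n) (x - t)))) \<le> B" for x
            proof -
              have "(LINT t|lborel. norm (f t * of_real (poisson (y n) (x - t)))) \<le>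
                (LINT t|lborel. B * poisson (y n) (t - x))"
                using integrable_poisson_shift(1)[OF y(1), of n x]
                  integrable_norm[OF integrable_bounded_poisson(1)[OF y(1) f fB, of n x]] fB y
                by (intro integral_mono)
                  (auto simp: norm_mult poisson_minus_commute poisson_nonneg intro!: mult_right_mono)
              then show ?thesis using integrable_poisson_shift(2)[OF y(1)] by simp
            qed
            then show "AE x in lborel. norm (indicat_real {a..b} x *
               (LINT t|lborel. norm (f t * of_real (poisson (y n) (x - t))))) \<le> norm (B * indicat_real {a..b} x)"
              using B by (auto simp: indicator_def)
          qed measurable
          show "AE x in lborel. integrable lborel (\<lambda>t. case (x, t) of (x, t) \<Rightarrow>
             indicator {a..b} x * (f t * complex_of_real (poisson (y n) (x - t))))"
            using integrable_bounded_poisson(1)[OF y(1) f fB] by auto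
        qed measurable
        also have "\<dots> = (LINT t|lborel. f t * of_real (K n t))"
        proof (rule Bochner_Integration.integral_cong[OF refl])
          fix t
          have "(LINT x|lborel. indicator {a..b} x * (f t * of_real (poisson (y n) (x - t)))) =
            (LINT x|lborel. f t * complex_of_real (indicator {a..b} x * poisson (y n) (x - t)))"
            by (intro Bochner_Integration.integral_cong) (auto simp: indicator_def)
          also have "\<dots> = f t * of_real (K n t)"
            unfolding K_def by (simp only: integral_mult_right_zero integral_complex_of_real)
          finally show "(LINT x|lborel. indicator {a..b} x * (f t * of_real (poisson (y n) (x - t)))) =
            f t * of_real (K n t)" .
        qed
        finally show ?thesis .
      qed
      have "(\<lambda>n. LINT t|lborel. f t * of_real (K n t)) \<longlonglongrightarrow> (LINT t|lborel. f t * of_real (indicator {a..b} t))"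
      proof (rule integral_dominated_convergence[where
            w = "\<lambda>t. B * (indicator {-(2*R+1)..2*R+1} t + 8 * (b - a) * poisson 1 t)"])
        show "integrable lborel (\<lambda>t. B * (indicator {-(2*R+1)..2*R+1} t + 8 * (b - a) * poisson 1 t))"
          using poisson_integrable[of 1]
          by (intro integrable_mult_right Bochner_Integration.integrable_add integrable_real_indicator)
            (auto simp: emeasure_lborel_Icc_eq)
        \<comment> \<open>At the ends of a nondegenerate box the Poisson integrals tend to 1/2 and
          not to the value of the indicator.\<close>
        have "AE t in lborel. t \<notin> {a, b}"
          using AE_lborel_singleton[of a] AE_lborel_singleton[of b] by eventually_elim auto
        then show "AE t in lborel. (\<lambda>n. f t * of_real (K n t)) \<longlonglongrightarrow> f t * of_real (indicator {a..b} t)"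
        proof eventually_elim
          case (elim t)
          then show ?case unfolding K_def
            by (intro tendsto_intros poisson_box_integral_tendsto y ab) auto
        qed
        show "AE t in lborel. norm (f t * of_real (K n t)) \<le>
           B * (indicator {-(2*R+1)..2*R+1} t + 8 * (b - a) * poisson 1 t)" for n
        proof (rule AE_I2)
          fix t
          have "K n t \<le> indicator {-(2*R+1)..2*R+1} t + 8 * (b - a) * poisson 1 t"
            unfolding K_def by (rule poisson_box_integral_bound(1)[OF y(1,2) ab]) (simp_all add: R_def)
          moreover have "0 \<le> K n t"
            unfolding K_def by (rule poisson_box_integral_bound(2)[OF y(1,2) ab, of R]) (simp_all add: R_def)
          ultimately show "norm (f t * of_real (K n t)) \<le>
             B * (indicator {-(2*R+1)..2*R+1} t + 8 * (b - a) * poisson 1 t)"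
            using fB[of t] B by (auto simp: norm_mult intro!: mult_mono)
        qed
      qed (auto simp: K_def)
      moreover have "f t * of_real (indicator {a..b} t) = indicator {a..b} t * f t" for t
        by (simp add: indicator_def)
      moreover have "I = (\<lambda>n. LINT t|lborel. f t * of_real (K n t))" using IK by blast
      ultimately show ?thesis by (simp only:)
    qed
    ultimately have "(LINT x|lborel. indicator {a..b} x * g x) = (LINT t|lborel. indicator {a..b} t * f t)"
      by (rule LIMSEQ_unique)
    then show "(LINT t|lborel. indicator {a..b} t * (f t - g t)) = 0"
      using indg[OF f fB, of a b] indg[OF g gB, of a b] by (simp add: algebra_simps)
  qed measurable
  then show ?thesis by auto
qed

section \<open>Deviation from the mean for bounded analytic functions\<close>

inductive trigpoly :: "(real \<Rightarrow> complex) \<Rightarrow> bool" where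
  iexp: "trigpoly (\<lambda>t. iexp (a * t))"
| add: "trigpoly g \<Longrightarrow> trigpoly h \<Longrightarrow> trigpoly (\<lambda>t. g t + h t)"
| scale: "trigpoly h \<Longrightarrow> trigpoly (\<lambda>t. c * h t)"

text \<open>
  In \<open>expoly y p v\<close> the number \<open>v\<close> is the value at \<open>\<i> y\<close> of the analytic extension of the
  exponential polynomial \<open>p\<close> to the upper half plane.
\<close>

inductive expoly :: "real \<Rightarrow> (real \<Rightarrow> complex) \<Rightarrow> complex \<Rightarrow> bool" for y where
  iexp: "0 \<le> a \<Longrightarrow> expoly y (\<lambda>t. iexp (a * t)) (of_real (exp (- (y * a))))"
| add: "expoly y p u \<Longrightarrow> expoly y q v \<Longrightarrow> expoly y (\<lambda>t. p t + q t) (u + v)"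
| scale: "expoly y p u \<Longrightarrow> expoly y (\<lambda>t. c * p t) (c * u)"

lemma trigpoly_measurable: "trigpoly h \<Longrightarrow> h \<in> borel_measurable borel"
  by (induction rule: trigpoly.induct) simp_all

lemma trigpoly_bounded: "trigpoly h \<Longrightarrow> \<exists>K. \<forall>t. norm (h t) \<le> K"
proof (induction rule: trigpoly.induct)
  case (iexp a)
  then show ?case by (auto intro!: exI[of _ 1])
next
  case (add g h)
  then obtain K L where "\<And>t. norm (g t) \<le> K" "\<And>t. norm (h t) \<le> L" by auto
  then have "norm (g t + h t) \<le> K + L" for t
    by (meson add_mono norm_triangle_le)
  then show ?case by blast
next
  case (scale h c)
  then obtain K where "\<And>t. norm (h t) \<le> K" by auto
  then have "norm (c * h t) \<le> norm c * K" for t by (simp add: norm_mult mult_left_mono)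
  then show ?case by blast
qed

lemma trigpoly_const: "trigpoly (\<lambda>t. c)"
  using trigpoly.scale[OF trigpoly.iexp[of 0], of c] by simp

lemma trigpoly_mult: "trigpoly g \<Longrightarrow> trigpoly h \<Longrightarrow> trigpoly (\<lambda>t. g t * h t)"
proof (induction rule: trigpoly.induct)
  case (iexp a)
  from iexp show ?case
  proof (induction rule: trigpoly.induct)
    case (iexp b)
    have "iexp (a * t) * iexp (b * t) = iexp ((a + b) * t)" for t
      by (simp add: exp_add[symmetric] algebra_simps)
    then show ?case using trigpoly.iexp[of "a + b"] by simp
  next
    case (add g h)
    then show ?case using trigpoly.add by (fastforce simp: algebra_simps)
  next
    case (scale h c)
    then show ?case using trigpoly.scale[OF scale(2), of c] by (simp add: algebra_simps)
  qed
next
  case (add g' g)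
  then show ?case using trigpoly.add by (fastforce simp: algebra_simps)
next
  case (scale g c)
  then show ?case using trigpoly.scale[of "\<lambda>t. g t * h t" c] by (simp add: algebra_simps)
qed

lemma expoly_const: "expoly y (\<lambda>t. c) c"
  using expoly.scale[OF expoly.iexp[of 0], of y c] by simp

text \<open>Evaluation at \<open>\<i> y\<close> is multiplicative because it is so on exponentials.
  Consequently a product vanishes there as soon as one factor does, which keeps perturbations of a
  competitor normalised in the extremal problem.\<close>

lemma expoly_mult: "expoly y p u \<Longrightarrow> expoly y q v \<Longrightarrow> expoly y (\<lambda>t. p t * q t) (u * v)"
proof (induction rule: expoly.induct)
  case (iexp a)
  from iexp(2,1) show ?case
  proof (induction rule: expoly.induct)
    case (iexp b)
    have "iexp (a * t) * iexp (b * t) = iexp ((a + b) * t)" for t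
      by (simp add: exp_add[symmetric] algebra_simps)
    moreover have "complex_of_real (exp (- (y * a))) * of_real (exp (- (y * b))) = of_real (exp (- (y * (a + b))))"
      by (simp add: exp_add[symmetric] algebra_simps flip: of_real_mult)
    ultimately show ?case using expoly.iexp[of "a + b" y] iexp by simp
  next
    case (add g u h v)
    then show ?case using expoly.add by (fastforce simp: algebra_simps)
  next
    case (scale h u c)
    then show ?case using expoly.scale[OF scale(2), of c] by (simp add: algebra_simps)
  qed
next
  case (add p u p' u')
  then show ?case using expoly.add[OF add.IH] by (fastforce simp: algebra_simps)
next
  case (scale p u c)
  then show ?case using expoly.scale[of y "\<lambda>t. p t * q t" "u * v" c] by (simp add: algebra_simps)
qed

lemma expoly_imp_trigpoly: "expoly y p u \<Longrightarrow> trigpoly p"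
proof (induction rule: expoly.induct)
  case (iexp a)
  show ?case by (rule trigpoly.iexp)
next
  case (add p u q v)
  then show ?case by (rule_tac trigpoly.add)
next
  case (scale p u c)
  then show ?case by (rule_tac trigpoly.scale)
qed

text \<open>This makes Stone-Weierstrass on the unit circle usable: a real-linear functional on the
  complex plane is a combination of real and imaginary part, and both are trigonometric polynomials
  along \<open>iexp (c * t)\<close>.\<close>

lemma trigpoly_real_polynomial_function:
  assumes "real_polynomial_function q"
  shows "trigpoly (\<lambda>t. of_real (q (iexp (c * t))))"
  using assms
proof (induction rule: real_polynomial_function.induct)
  case (linear f)
  interpret bounded_linear f by fact
  have lin: "f z = Re z * f 1 + Im z * f \<i>" for z
  proof -
    have "z = Re z *\<^sub>R 1 + Im z *\<^sub>R \<i>" by (simp add: complex_eq_iff)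
    then have "f z = f (Re z *\<^sub>R 1 + Im z *\<^sub>R \<i>)" by (rule arg_cong)
    then show ?thesis by (simp add: add scaleR)
  qed
  have re_im: "complex_of_real (Re (iexp s)) = (1/2) * (iexp s + iexp (- s))"
    "complex_of_real (Im (iexp s)) = (1/(2*\<i>)) * (iexp s + (-1) * iexp (- s))" for s
    by (simp_all add: complex_eq_iff Re_exp Im_exp Re_divide Im_divide)
  have "f (iexp (c * t)) = f 1 * Re (iexp (c * t)) + f \<i> * Im (iexp (c * t))" for t
    by (subst lin) (simp only: mult.commute)
  then have "complex_of_real (f (iexp (c * t))) =
      of_real (f 1) * of_real (Re (iexp (c * t))) + of_real (f \<i>) * of_real (Im (iexp (c * t)))" for t
    by (metis of_real_add of_real_mult)
  then have "complex_of_real (f (iexp (c * t))) =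
    of_real (f 1) * ((1/2) * (iexp (c * t) + iexp ((- c) * t))) +
    of_real (f \<i>) * ((1/(2*\<i>)) * (iexp (c * t) + (-1) * iexp ((- c) * t)))" for t
    by (simp only: re_im mult_minus_left)
  moreover have "trigpoly (\<lambda>t. of_real (f 1) * ((1/2) * (iexp (c * t) + iexp ((- c) * t))) +
    of_real (f \<i>) * ((1/(2*\<i>)) * (iexp (c * t) + (-1) * iexp ((- c) * t))))"
    by (rule trigpoly.add[OF
          trigpoly.scale[OF trigpoly.scale[OF trigpoly.add[OF trigpoly.iexp[of c] trigpoly.iexp[of "- c"]], of "1/2"],
            of "of_real (f 1)"]
          trigpoly.scale[OF trigpoly.scale[OF trigpoly.add[OF trigpoly.iexp[of c]
              trigpoly.scale[OF trigpoly.iexp[of "- c"], of "-1"]], of "1/(2*\<i>)"], of "of_real (f \<i>)"]])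
  ultimately show ?case by simp
next
  case (const d)
  show ?case by (rule trigpoly_const)
next
  case (add f g)
  then show ?case using trigpoly.add by force
next
  case (mult f g)
  then show ?case using trigpoly_mult by force
qed

section \<open>Cauchy-Schwarz, compact approximation and norming by trigonometric
  polynomials\<close>

lemma (in finite_measure) integrable_bounded:
  fixes f :: "'a \<Rightarrow> 'b :: {banach, second_countable_topology}"
  assumes "f \<in> borel_measurable M" "\<And>x. norm (f x) \<le> B"
  shows "integrable M f"
  by (rule integrable_const_bound[where B = B]) (use assms in auto)

lemma (in prob_space) weighted_Cauchy_Schwarz:
  fixes w a b :: "'a \<Rightarrow> real"
  assumes "integrable M (\<lambda>x. w x * (a x)\<^sup>2)" "integrable M (\<lambda>x. w x * (b x)\<^sup>2)"
    "integrable M (\<lambda>x. w x * (a x * b x))" and w: "\<And>x. 0 \<le> w x"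
  shows "(LINT x|M. w x * (a x * b x)) \<le> sqrt (LINT x|M. w x * (a x)\<^sup>2) * sqrt (LINT x|M. w x * (b x)\<^sup>2)"
proof -
  let ?A = "LINT x|M. w x * (a x)\<^sup>2" and ?B = "LINT x|M. w x * (b x)\<^sup>2" and ?C = "LINT x|M. w x * (a x * b x)"
  have q: "0 \<le> s\<^sup>2 * ?A + 2 * s * r * ?C + r\<^sup>2 * ?B" for s r
  proof -
    have "0 \<le> (LINT x|M. w x * (s * a x + r * b x)\<^sup>2)"
      using w by (intro integral_nonneg_AE) auto
    also have "(\<lambda>x. w x * (s * a x + r * b x)\<^sup>2) =
        (\<lambda>x. s\<^sup>2 * (w x * (a x)\<^sup>2) + 2 * s * r * (w x * (a x * b x)) + r\<^sup>2 * (w x * (b x)\<^sup>2))"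
      by (auto simp: power2_eq_square algebra_simps)
    also have "(LINT x|M. \<dots> x) = s\<^sup>2 * ?A + 2 * s * r * ?C + r\<^sup>2 * ?B"
      using assms by simp
    finally show ?thesis .
  qed
  have A: "0 \<le> ?A" and B: "0 \<le> ?B" using w by (auto intro!: integral_nonneg_AE)
  have "?C\<^sup>2 \<le> ?A * ?B"
  proof (cases "?B = 0")
    case True
    have "?C = 0"
    proof (rule ccontr)
      assume "?C \<noteq> 0"
      \<comment> \<open>With \<open>?B = 0\<close> the quadratic form at these arguments equals
        \<open>?A - (?A + 1) = -1\<close>.\<close>
      then show False using q[of 1 "- (?A + 1) / (2 * ?C)"] True by (simp add: field_simps)
    qed
    then show ?thesis using A B by simp
  next
    case False
    then have "0 < ?B" using B by simp
    \<comment> \<open>The arguments \<open>?B\<close> and \<open>- ?C\<close> minimise the form up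
      to scaling.\<close>
    have "0 \<le> ?B * (?A * ?B - ?C\<^sup>2)"
      using q[of ?B "- ?C"] by (simp add: power2_eq_square algebra_simps)
    then show ?thesis using \<open>0 < ?B\<close> by (simp add: zero_le_mult_iff)
  qed
  then have "sqrt (?C\<^sup>2) \<le> sqrt (?A * ?B)" by (rule real_sqrt_le_mono)
  then show ?thesis by (simp add: real_sqrt_mult)
qed

lemma compact_inner_approx:
  fixes m :: "real measure"
  assumes "finite_measure m" "sets m = sets borel" "A \<in> sets borel" "0 < e"
  obtains K where "compact K" "K \<subseteq> A" "measure m (A - K) < e"
proof -
  interpret finite_measure m by fact
  have eq: "emeasure m A = (SUP K \<in> {K. K \<subseteq> A \<and> compact K}. emeasure m K)"
    by (rule inner_regular) (use assms in auto)
  have "\<exists>K. K \<subseteq> A \<and> compact K \<and> measure m A < measure m K + e"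
  proof (cases "measure m A = 0")
    case True
    then show ?thesis using assms(4) by (intro exI[of _ "{}"]) auto
  next
    case False
    then have "0 < measure m A" by (simp add: less_le)
    then have "emeasure m A - ennreal e < emeasure m A"
      using assms(4) by (intro ennreal_between) (auto simp: emeasure_eq_measure)
    then obtain K where K: "K \<subseteq> A" "compact K" "emeasure m A - ennreal e < emeasure m K"
      unfolding eq less_SUP_iff by auto
    then have "ennreal (measure m A - e) < ennreal (measure m K)"
      using assms(4) by (simp add: emeasure_eq_measure ennreal_minus)
    then have "measure m A - e < measure m K"
      by (meson ennreal_leI leD not_le)
    then show ?thesis using K by (intro exI[of _ K]) auto
  qed
  then obtain K where K: "K \<subseteq> A" "compact K" "measure m A < measure m K + e" by auto
  moreover have "measure m (A - K) = measure m A - measure m K"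
    using K assms by (intro finite_measure_Diff) (auto simp: borel_compact)
  ultimately show ?thesis using that K by auto
qed

lemma le_of_le_add_small:
  fixes x c C :: real
  assumes "\<And>e. 0 < e \<Longrightarrow> e < 1 \<Longrightarrow> x \<le> c + C * e"
  shows "x \<le> c"
proof (rule ccontr)
  assume *: "\<not> x \<le> c"
  define e where "e = min (1/2) ((x - c) / (2 * (\<bar>C\<bar> + 1)))"
  have e: "0 < e" "e < 1" using * by (auto simp: e_def)
  have "C * e \<le> \<bar>C\<bar> * e" using e by (intro mult_right_mono) auto
  also have "\<dots> \<le> (\<bar>C\<bar> + 1) * ((x - c) / (2 * (\<bar>C\<bar> + 1)))"
    using e by (intro mult_mono) (auto simp: e_def)
  also have "\<dots> = (x - c) / 2" by (simp add: field_simps)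
  finally have "C * e \<le> (x - c) / 2" .
  moreover have "x - c \<le> C * e" using assms[OF e] by simp
  ultimately show False using * by simp
qed

text \<open>The sign of \<open>g\<close> is a norming function for its L1 norm. Off a set of small
  measure it is a continuous function of a point running around the circle, and such a function is a
  uniform limit of trigonometric polynomials. Factoring through the circle keeps the approximation
  uniform on the whole line, so the sup norm in the hypothesis stays near 1.\<close>

lemma trigpoly_norming:
  fixes m :: "real measure" and g :: "real \<Rightarrow> real"
  assumes "prob_space m" and sets: "sets m = sets borel"
    and g: "g \<in> borel_measurable borel" "\<And>t. \<bar>g t\<bar> \<le> B"
    and le: "\<And>h K. trigpoly h \<Longrightarrow> (\<And>t. norm (h t) \<le> K) \<Longrightarrow> norm (LINT t|m. of_real (g t) * h t) \<le> c * K"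
  shows "(LINT t|m. \<bar>g t\<bar>) \<le> c"
proof (rule le_of_le_add_small)
  interpret prob_space m by fact
  have sp: "space m = UNIV" using sets_eq_imp_space_eq[OF sets] by simp
  have meas': "borel_measurable m = (borel_measurable borel :: (real \<Rightarrow> real) set)"
    by (intro measurable_cong_sets sets refl)
  note [measurable] = g(1)
  have B: "0 \<le> B" using g(2)[of 0] by linarith
  fix e :: real assume e: "0 < e" "e < 1"
  let ?A = "{t. 0 < g t}"
  have Am: "?A \<in> sets borel" by measurable
  obtain K1 where K1: "compact K1" "K1 \<subseteq> ?A" "measure m (?A - K1) < e"
    using compact_inner_approx[OF finite_measure_axioms sets Am e(1)] by blast
  obtain K2 where K2: "compact K2" "K2 \<subseteq> - ?A" "measure m (- ?A - K2) < e"
    using compact_inner_approx[OF finite_measure_axioms sets _ e(1), of "- ?A"] Am by auto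
  obtain R where R: "0 < R" "\<And>t. t \<in> K1 \<union> K2 \<Longrightarrow> \<bar>t\<bar> \<le> R"
    using compact_imp_bounded[OF compact_Un[OF K1(1) K2(1)]] unfolding bounded_pos by auto
  \<comment> \<open>This frequency maps \<open>[-R, R]\<close> to angles between
    \<open>- pi / 2\<close> and \<open>pi / 2\<close>, where the sine, the imaginary part of
    \<open>om\<close>, is injective. So the images of \<open>K1\<close> and \<open>K2\<close> stay
    disjoint.\<close>
  define om where "om t = iexp (pi / (2 * R) * t)" for t :: real
  have om_cont: "continuous_on S om" for S unfolding om_def by (intro continuous_intros)
  have om_inj: "s = t" if "om s = om t" "\<bar>s\<bar> \<le> R" "\<bar>t\<bar> \<le> R" for s t
  proof -
    have bd: "- (pi / 2) \<le> pi / (2 * R) * u \<and> pi / (2 * R) * u \<le> pi / 2" if "\<bar>u\<bar> \<le> R" for u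
    proof -
      have "\<bar>pi / (2 * R) * u\<bar> \<le> pi / (2 * R) * R"
        unfolding abs_mult using that R(1) by (intro mult_mono) auto
      also have "\<dots> = pi / 2" using R(1) by simp
      finally show ?thesis by linarith
    qed
    have "Im (om s) = Im (om t)" using that by simp
    then have "sin (pi / (2 * R) * s) = sin (pi / (2 * R) * t)" by (simp add: om_def Im_exp)
    then have "pi / (2 * R) * s = pi / (2 * R) * t"
      using bd[OF that(2)] bd[OF that(3)] sin_inj_pi by blast
    then show ?thesis using R(1) by simp
  qed
  have c1: "closed (om ` K1)" "closed (om ` K2)"
    by (intro compact_imp_closed compact_continuous_image om_cont K1 K2)+
  have "om ` K1 \<inter> om ` K2 = {}"
  proof (rule ccontr)
    assume "om ` K1 \<inter> om ` K2 \<noteq> {}"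
    then obtain s t where st: "s \<in> K1" "t \<in> K2" "om s = om t" by (auto simp: image_iff)
    then have "s = t" by (intro om_inj R(2)) auto
    then show False using st K1(2) K2(2) by auto
  qed
  \<comment> \<open>The values 1 and -1 are the sign of \<open>g\<close> on \<open>K1\<close>, where
    it is positive, and an admissible sign on \<open>K2\<close>, where
    \<open>g \<le> 0\<close>.\<close>
  from Urysohn[OF c1 this, of "1::real" "-1"] obtain f where f: "continuous_on UNIV f"
    "\<And>z. f z \<in> closed_segment 1 (-1::real)" "\<And>z. z \<in> om ` K1 \<Longrightarrow> f z = 1" "\<And>z. z \<in> om ` K2 \<Longrightarrow> f z = -1"
    by blast
  have f1: "\<bar>f z\<bar> \<le> 1" for z
    using f(2)[of z] by (auto simp: closed_segment_eq_real_ivl)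
  obtain q where q: "real_polynomial_function q" "\<And>z. z \<in> sphere (0::complex) 1 \<Longrightarrow> \<bar>f z - q z\<bar> < e"
    using Stone_Weierstrass_real_polynomial_function[OF compact_sphere continuous_on_subset[OF f(1)] e(1)]
    by blast
  have om1: "om t \<in> sphere 0 1" for t by (simp add: om_def)
  have qb: "\<bar>f (om t) - q (om t)\<bar> \<le> e" for t using q(2)[OF om1] by (rule less_imp_le)
  define h where "h t = q (om t)" for t
  have h: "trigpoly (\<lambda>t. of_real (h t))"
    unfolding h_def om_def by (rule trigpoly_real_polynomial_function[OF q(1)])
  have hb: "norm (complex_of_real (h t)) \<le> 1 + e" for t
    using qb[of t] f1[of "om t"] by (simp add: h_def)
  have hm [measurable]: "h \<in> borel_measurable borel"
  proof -
    have "h = (\<lambda>t. Re (complex_of_real (h t)))" by simp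
    also have "\<dots> \<in> borel_measurable borel" using trigpoly_measurable[OF h] by measurable
    finally show ?thesis .
  qed
  have fm [measurable]: "(\<lambda>t. f (om t)) \<in> borel_measurable borel"
    by (intro borel_measurable_continuous_onI continuous_on_compose2[OF f(1) om_cont]) auto
  have I1: "integrable m (\<lambda>t. g t * h t)"
    by (rule integrable_bounded[where B = "B * (1 + e)"])
      (use g hb B in \<open>auto simp: meas' abs_mult intro!: mult_mono\<close>)
  have I2: "integrable m (\<lambda>t. g t * f (om t))"
    by (rule integrable_bounded[where B = "B * 1"])
      (use g f1 B in \<open>auto simp: meas' abs_mult simp del: mult_1_right intro!: mult_mono\<close>)
  have I3: "integrable m (\<lambda>t. \<bar>g t\<bar>)"
    by (rule integrable_bounded[where B = B]) (use g in \<open>auto simp: meas'\<close>)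
  have "(LINT t|m. \<bar>g t\<bar>) - (LINT t|m. g t * f (om t)) = (LINT t|m. \<bar>g t\<bar> - g t * f (om t))"
    using I2 I3 by simp
  also have "\<dots> \<le> (LINT t|m. 2 * B * indicator (?A - K1) t + 2 * B * indicator (- ?A - K2) t)"
  proof (rule integral_mono)
    show "integrable m (\<lambda>t. 2 * B * indicator (?A - K1) t + 2 * B * indicator (- ?A - K2) t)"
      using Am K1(1) K2(1)
      by (intro Bochner_Integration.integrable_add integrable_mult_right integrable_real_indicator)
        (auto simp: sets borel_compact emeasure_eq_measure)
    fix t
    have 0: "\<bar>g t\<bar> - g t * f (om t) \<le> 2 * B"
    proof -
      have "\<bar>g t * f (om t)\<bar> \<le> B * 1" unfolding abs_mult using g f1 B by (intro mult_mono) auto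
      then show ?thesis using g(2)[of t] by linarith
    qed
    show "\<bar>g t\<bar> - g t * f (om t) \<le> 2 * B * indicator (?A - K1) t + 2 * B * indicator (- ?A - K2) t"
    proof (cases "t \<in> K1 \<or> t \<in> K2")
      case True
      then have "\<bar>g t\<bar> - g t * f (om t) = 0" using f(3)[of "om t"] f(4)[of "om t"] K1(2) K2(2) by auto
      then show ?thesis using B by simp
    next
      case False
      then show ?thesis using 0 by (auto simp: indicator_def)
    qed
  qed (use I2 I3 in auto)
  also have "\<dots> = 2 * B * measure m (?A - K1) + 2 * B * measure m (- ?A - K2)"
    using Am K1(1) K2(1) by (subst Bochner_Integration.integral_add)
      (auto simp: sets sp borel_compact emeasure_eq_measure intro!: integrable_mult_right integrable_real_indicator)
  also have "\<dots> \<le> 2 * B * e + 2 * B * e"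
    using K1(3) K2(3) B by (intro add_mono mult_left_mono) auto
  finally have 1: "(LINT t|m. \<bar>g t\<bar>) \<le> (LINT t|m. g t * f (om t)) + 4 * B * e" by simp
  have "(LINT t|m. g t * f (om t)) - (LINT t|m. g t * h t) = (LINT t|m. g t * (f (om t) - h t))"
    using I1 I2 by (simp add: algebra_simps)
  also have "\<dots> \<le> (LINT t|m. B * e)"
  proof (rule integral_mono)
    show "integrable m (\<lambda>t. g t * (f (om t) - h t))" using I1 I2 by (simp add: algebra_simps)
    show "g t * (f (om t) - h t) \<le> B * e" for t
    proof -
      have "\<bar>g t * (f (om t) - h t)\<bar> \<le> B * e"
        unfolding abs_mult h_def using g qb B by (intro mult_mono) auto
      then show ?thesis by linarith
    qed
  qed simp
  also have "\<dots> = B * e" by (simp add: prob_space)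
  finally have 2: "(LINT t|m. g t * f (om t)) \<le> (LINT t|m. g t * h t) + B * e" by simp
  have "(LINT t|m. of_real (g t) * complex_of_real (h t)) = of_real (LINT t|m. g t * h t)"
    by (simp flip: of_real_mult)
  then have "\<bar>LINT t|m. g t * h t\<bar> \<le> c * (1 + e)"
    using le[OF h hb] by simp
  \<comment> \<open>The exceptional sets cost \<open>4 * B * e\<close>, the polynomial approximation
    \<open>B * e\<close>, and the norm of \<open>h\<close>, at most \<open>1 + e\<close>, costs
    \<open>c * e\<close>.\<close>
  with 1 2 show "(LINT t|m. \<bar>g t\<bar>) \<le> c + (c + 5 * B) * e"
    by (simp add: algebra_simps)
qed

text \<open>
  The model case is the Poisson measure \<open>m\<close> at \<open>\<i> y\<close> and the boundary function \<open>f\<close> of a bounded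
  analytic function. The number \<open>I\<close> below is then Szego's infimum for the weight \<open>\<bar>f\<bar>\<close>; it plays the
  role of the geometric mean of \<open>\<bar>f\<bar>\<close>, and \<open>(norm f0)\<^sup>2 \<le> W * I\<close> that of Jensen's inequality.
\<close>

locale half_plane_mean = prob_space m for m :: "real measure" +
  fixes y :: real and f :: "real \<Rightarrow> complex" and B :: real
  assumes sets_m [measurable_cong]: "sets m = sets borel"
    and mean_iexp: "\<And>a. 0 \<le> a \<Longrightarrow> (LINT t|m. iexp (a * t)) = of_real (exp (- (y * a)))"
    and f_measurable [measurable]: "f \<in> borel_measurable borel"
    and f_bounded: "\<And>t. norm (f t) \<le> B"
    and mean_f_iexp: "\<And>a. 0 \<le> a \<Longrightarrow>
      (LINT t|m. f t * iexp (a * t)) = of_real (exp (- (y * a))) * (LINT t|m. f t)"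
begin

section \<open>Szego's extremal problem for the weight \<open>norm (f t)\<close>\<close>

definition "f0 = (LINT t|m. f t)"
definition "W = (LINT t|m. norm (f t))"
definition "Q p = (LINT t|m. norm (f t) * (norm (p t :: complex))\<^sup>2)"
definition "I = Inf {Q p |p. expoly y p 1}"

lemma B_nonneg: "0 \<le> B"
  using order_trans[OF norm_ge_zero f_bounded] .

lemma integrable_borel_bounded:
  fixes h :: "real \<Rightarrow> 'b :: {banach, second_countable_topology}"
  assumes "h \<in> borel_measurable borel" "\<And>t. norm (h t) \<le> K"
  shows "integrable m h"
  using assms by (intro integrable_bounded[where B = K]) (simp_all cong: measurable_cong_sets[OF sets_m refl])

lemma integrable_f_trigpoly:
  assumes "trigpoly h"
  shows "integrable m h" "integrable m (\<lambda>t. f t * h t)" "integrable m (\<lambda>t. norm (f t) * norm (h t))"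
    "integrable m (\<lambda>t. norm (f t) * (norm (h t))\<^sup>2)"
proof -
  note [measurable] = trigpoly_measurable[OF assms]
  obtain K where K: "\<And>t. norm (h t) \<le> K" using trigpoly_bounded[OF assms] by auto
  have "0 \<le> K" using order_trans[OF norm_ge_zero K] .
  show "integrable m h" by (rule integrable_borel_bounded[OF _ K]) measurable
  show "integrable m (\<lambda>t. f t * h t)"
    by (rule integrable_borel_bounded[where K = "B * K"])
      (auto simp: norm_mult f_bounded K B_nonneg intro!: mult_mono)
  then show "integrable m (\<lambda>t. norm (f t) * norm (h t))"
    using integrable_norm by (fastforce simp: norm_mult)
  show "integrable m (\<lambda>t. norm (f t) * (norm (h t))\<^sup>2)"
    by (rule integrable_borel_bounded[where K = "B * K\<^sup>2"])
      (auto simp: norm_mult f_bounded K B_nonneg intro!: mult_mono power_mono)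
qed

lemma integrable_weighted:
  assumes "trigpoly h" "trigpoly p"
  shows "integrable m (\<lambda>t. of_real (norm (f t)) * of_real ((norm (p t))\<^sup>2) * h t)"
    "integrable m (\<lambda>t. norm (f t) * \<bar>(norm (p t))\<^sup>2 - 1\<bar>)"
proof -
  note [measurable] = trigpoly_measurable[OF assms(1)] trigpoly_measurable[OF assms(2)]
  obtain K where K: "\<And>t. norm (h t) \<le> K" using trigpoly_bounded[OF assms(1)] by auto
  obtain L where L: "\<And>t. norm (p t) \<le> L" using trigpoly_bounded[OF assms(2)] by auto
  have 0: "0 \<le> K" "0 \<le> L" using order_trans[OF norm_ge_zero K] order_trans[OF norm_ge_zero L] by auto
  show "integrable m (\<lambda>t. of_real (norm (f t)) * of_real ((norm (p t))\<^sup>2) * h t)"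
    by (rule integrable_borel_bounded[where K = "B * L\<^sup>2 * K"])
      (auto simp: norm_mult norm_power f_bounded K L 0 B_nonneg intro!: mult_mono power_mono)
  have "\<bar>(norm (p t))\<^sup>2 - 1\<bar> \<le> L\<^sup>2 + 1" for t
    using power_mono[OF L[of t] norm_ge_zero, of 2] by (smt (verit) zero_le_power2)
  then show "integrable m (\<lambda>t. norm (f t) * \<bar>(norm (p t))\<^sup>2 - 1\<bar>)"
    by (intro integrable_borel_bounded[where K = "B * (L\<^sup>2 + 1)"])
      (auto simp: abs_mult f_bounded B_nonneg intro!: mult_mono)
qed

lemma mean_expoly: "expoly y p v \<Longrightarrow> (LINT t|m. f t * p t) = v * f0"
proof (induction rule: expoly.induct)
  case (iexp a)
  then show ?case by (simp only: mean_f_iexp f0_def)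
next
  case (add p u q v)
  then show ?case
    using integrable_f_trigpoly(2)[OF expoly_imp_trigpoly[OF add(1)]]
      integrable_f_trigpoly(2)[OF expoly_imp_trigpoly[OF add(2)]] by (simp add: distrib_left distrib_right)
next
  case (scale p u c)
  have "(LINT t|m. f t * (c * p t)) = (LINT t|m. c * (f t * p t))"
    by (simp add: ac_simps)
  also have "\<dots> = c * (u * f0)" using scale by simp
  finally show ?case by simp
qed

lemma W_nonneg: "0 \<le> W" unfolding W_def by (intro integral_nonneg_AE) auto

lemma Q_nonneg: "0 \<le> Q p" unfolding Q_def by (intro integral_nonneg_AE) auto

lemma integrable_norm_f: "integrable m (\<lambda>t. norm (f t))"
  using f_bounded by (intro integrable_borel_bounded[where K = B]) auto

text \<open>Every competitor \<open>p\<close> has value 1 at \<open>\<i> y\<close>, so multiplying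
  \<open>f\<close> by it does not change the mean \<open>f0\<close>. Cauchy-Schwarz with weight
  \<open>norm (f t)\<close> then separates \<open>W\<close> from \<open>Q p\<close>.\<close>

lemma Q_lower:
  assumes "expoly y p 1"
  shows "(norm f0)\<^sup>2 \<le> W * Q p" and "I \<le> Q p"
proof -
  note t = expoly_imp_trigpoly[OF assms]
  have "f0 = (LINT t|m. f t * p t)" using mean_expoly[OF assms] by simp
  then have "norm f0 \<le> (LINT t|m. norm (f t) * (1 * norm (p t)))"
    using integral_norm_bound[of m "\<lambda>t. f t * p t"] by (simp add: norm_mult)
  also have "\<dots> \<le> sqrt (LINT t|m. norm (f t) * 1\<^sup>2) * sqrt (LINT t|m. norm (f t) * (norm (p t))\<^sup>2)"
    by (rule weighted_Cauchy_Schwarz) (use integrable_f_trigpoly[OF t] integrable_norm_f in auto)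
  finally have "norm f0 \<le> sqrt W * sqrt (Q p)" by (simp add: W_def Q_def)
  then have "(norm f0)\<^sup>2 \<le> (sqrt W * sqrt (Q p))\<^sup>2" by (rule power_mono) auto
  then show "(norm f0)\<^sup>2 \<le> W * Q p" using W_nonneg Q_nonneg[of p] by (simp add: power_mult_distrib)
  show "I \<le> Q p" unfolding I_def
    by (rule cInf_lower) (use assms Q_nonneg in \<open>auto intro!: bdd_belowI[of _ 0]\<close>)
qed

text \<open>The constant 1 is a competitor with \<open>Q\<close> equal to \<open>W\<close>. Together
  the bounds squeeze \<open>W * I\<close> between \<open>(norm f0)\<^sup>2\<close> and
  \<open>W\<^sup>2\<close>, so \<open>I\<close> is close to \<open>W\<close> when
  \<open>norm f0\<close> is.\<close>

lemma I_bounds: "0 \<le> I" "I \<le> W" "(norm f0)\<^sup>2 \<le> W * I"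
proof -
  have ne: "{Q p |p. expoly y p 1} \<noteq> {}" using expoly_const by blast
  show "0 \<le> I" unfolding I_def by (rule cInf_greatest[OF ne]) (auto simp: Q_nonneg)
  show "I \<le> W" using Q_lower(2)[OF expoly_const] by (simp add: Q_def W_def)
  show "(norm f0)\<^sup>2 \<le> W * I"
  proof (cases "W = 0")
    case True
    then show ?thesis using Q_lower(1)[OF expoly_const] by simp
  next
    case False
    then have "(norm f0)\<^sup>2 / W \<le> I" unfolding I_def
      using Q_lower(1) W_nonneg by (intro cInf_greatest[OF ne]) (auto simp: divide_simps mult.commute)
    then show ?thesis using False W_nonneg by (simp add: divide_simps mult.commute split: if_splits)
  qed
qed

lemma integral_lincomb3:
  fixes a b c :: "'a \<Rightarrow> real"
  assumes "integrable M a" "integrable M b" "integrable M c"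
  shows "(LINT t|M. a t + 2 * b t + r * c t) = (LINT t|M. a t) + 2 * (LINT t|M. b t) + r * (LINT t|M. c t)"
  using assms by simp

lemma integral_lincomb2:
  fixes a b :: "'a \<Rightarrow> real"
  assumes "integrable M a" "integrable M b"
  shows "(LINT t|M. a t - 2 * b t + a t * r) = (LINT t|M. a t) - 2 * (LINT t|M. b t) + (LINT t|M. a t) * r"
  using assms by simp

lemma Re_complex_of_real_mult: "Re (of_real x * z) = x * Re z"
  by simp

text \<open>A near-minimiser \<open>p\<close> of \<open>Q\<close> is almost orthogonal to \<open>p r\<close> whenever \<open>r\<close> vanishes at \<open>\<i> y\<close>.\<close>

lemma almost_orthogonal:
  assumes p: "expoly y p 1" and r: "expoly y r 0" and r2: "\<And>t. norm (r t) \<le> 2"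
    and d: "Q p \<le> I + d"
  defines "J \<equiv> (LINT t|m. of_real (norm (f t)) * of_real ((norm (p t))\<^sup>2) * r t)"
  shows "(norm J)\<^sup>2 \<le> d * (4 * (I + d) + 1)"
proof -
  note tp = expoly_imp_trigpoly[OF p] and tr = expoly_imp_trigpoly[OF r]
  have Id: "0 \<le> I + d" using d Q_nonneg[of p] by linarith
  \<comment> \<open>The step length makes \<open>\<tau> * (4 * (I + d)) \<le> 1\<close>, so the
    quadratic term of the perturbation can eat up at most half of the linear gain.\<close>
  define \<tau> where "\<tau> = 1 / (4 * (I + d) + 1)"
  have \<tau>: "0 < \<tau>" using Id by (simp add: \<tau>_def)
  \<comment> \<open>This is the direction of steepest descent: the linear term
    \<open>2 * Re (s * J)\<close> becomes \<open>- 2 * \<tau> * (norm J)\<^sup>2\<close>.\<close>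
  define s where "s = - of_real \<tau> * cnj J"
  have e: "expoly y (\<lambda>t. p t + s * (p t * r t)) 1"
    using expoly.add[OF p expoly.scale[OF expoly_mult[OF p r], of s]] by simp
  have i1: "integrable m (\<lambda>t. s * (of_real (norm (f t)) * of_real ((norm (p t))\<^sup>2) * r t))"
    by (intro integrable_mult_right integrable_weighted tr tp)
  have i2: "integrable m (\<lambda>t. norm (f t) * (norm (p t * r t))\<^sup>2)"
    by (rule integrable_f_trigpoly(4)[OF trigpoly_mult[OF tp tr]])
  have i3: "integrable m (\<lambda>t. norm (f t) * (norm (p t))\<^sup>2)"
    by (rule integrable_f_trigpoly(4)[OF tp])
  have sq: "(norm (p t + s * (p t * r t)))\<^sup>2 =
     (norm (p t))\<^sup>2 + 2 * Re (s * (of_real ((norm (p t))\<^sup>2) * r t)) + (norm s)\<^sup>2 * (norm (p t * r t))\<^sup>2" for t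
  proof -
    have "(norm (1 + z))\<^sup>2 = 1 + 2 * Re z + (norm z)\<^sup>2" for z
      by (simp only: cmod_power2) (simp add: power2_eq_square algebra_simps)
    then have 1: "(norm (1 + s * r t))\<^sup>2 = 1 + 2 * Re (s * r t) + (norm (s * r t))\<^sup>2" .
    have 2: "p t + s * (p t * r t) = p t * (1 + s * r t)" by (simp add: algebra_simps)
    have 3: "Re (s * (of_real ((norm (p t))\<^sup>2) * r t)) = (norm (p t))\<^sup>2 * Re (s * r t)"
      by (simp only: mult.left_commute[of s] Re_complex_of_real_mult)
    show ?thesis
      unfolding 3 unfolding 2 norm_mult power_mult_distrib 1 by (simp only: norm_mult power_mult_distrib ring_distribs ac_simps mult_1_right)
  qed
  have "I \<le> Q (\<lambda>t. p t + s * (p t * r t))" by (rule Q_lower(2)[OF e])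
  also have "\<dots> = (LINT t|m. norm (f t) * (norm (p t))\<^sup>2 +
      2 * Re (s * (of_real (norm (f t)) * of_real ((norm (p t))\<^sup>2) * r t)) +
      (norm s)\<^sup>2 * (norm (f t) * (norm (p t * r t))\<^sup>2))"
  proof -
    have "Re (s * (of_real (norm (f t)) * of_real ((norm (p t))\<^sup>2) * r t)) =
      norm (f t) * Re (s * (of_real ((norm (p t))\<^sup>2) * r t))" for t
      by (simp only: mult.assoc mult.left_commute[of s "of_real (norm (f t))"] Re_complex_of_real_mult)
    then show ?thesis
      unfolding Q_def sq by (intro Bochner_Integration.integral_cong refl) (simp only: distrib_left ac_simps)
  qed
  also have "\<dots> = Q p + 2 * Re (s * J) + (norm s)\<^sup>2 * (LINT t|m. norm (f t) * (norm (p t * r t))\<^sup>2)"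
  proof -
    have "(LINT t|m. Re (s * (of_real (norm (f t)) * of_real ((norm (p t))\<^sup>2) * r t))) = Re (s * J)"
      by (simp only: J_def integral_Re[OF i1] integral_mult_right_zero)
    then show ?thesis
      using integral_lincomb3[OF i3 integrable_Re[OF i1] i2] by (simp only: Q_def)
  qed
  also have "(LINT t|m. norm (f t) * (norm (p t * r t))\<^sup>2) \<le> (LINT t|m. 4 * (norm (f t) * (norm (p t))\<^sup>2))"
  proof (rule integral_mono[OF i2])
    show "integrable m (\<lambda>t. 4 * (norm (f t) * (norm (p t))\<^sup>2))" using i3 by simp
    fix t
    have "(norm (r t))\<^sup>2 \<le> 2\<^sup>2" by (rule power_mono[OF r2]) simp
    then have "(norm (f t) * (norm (p t))\<^sup>2) * (norm (r t))\<^sup>2 \<le> (norm (f t) * (norm (p t))\<^sup>2) * 4"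
      by (intro mult_left_mono) auto
    then show "norm (f t) * (norm (p t * r t))\<^sup>2 \<le> 4 * (norm (f t) * (norm (p t))\<^sup>2)"
      by (simp add: norm_mult power_mult_distrib mult_ac)
  qed
  also have "\<dots> = 4 * Q p" by (simp add: Q_def)
  finally have 1: "I \<le> Q p + 2 * Re (s * J) + (norm s)\<^sup>2 * (4 * Q p)"
    by (simp add: mult_left_mono)
  have sJ: "Re (s * J) = - \<tau> * (norm J)\<^sup>2" by (simp only: s_def cmod_power2) (simp add: power2_eq_square algebra_simps)
  have ns: "(norm s)\<^sup>2 = \<tau>\<^sup>2 * (norm J)\<^sup>2" using \<tau> by (simp add: s_def norm_mult power_mult_distrib)
  have "(norm s)\<^sup>2 * (4 * Q p) \<le> (norm s)\<^sup>2 * (4 * (I + d))" using d by (intro mult_left_mono) auto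
  also have "\<dots> = \<tau> * (norm J)\<^sup>2 * (\<tau> * (4 * (I + d)))" unfolding ns by (simp only: power2_eq_square ac_simps)
  also have "\<dots> \<le> \<tau> * (norm J)\<^sup>2 * 1"
  proof (rule mult_left_mono)
    show "\<tau> * (4 * (I + d)) \<le> 1" using Id by (simp add: \<tau>_def divide_le_eq)
  qed (use \<tau> in simp)
  finally have "\<tau> * (norm J)\<^sup>2 \<le> d" using 1 d sJ by simp
  then have "(\<tau> * (norm J)\<^sup>2) * (4 * (I + d) + 1) \<le> d * (4 * (I + d) + 1)"
    using Id by (intro mult_right_mono) auto
  moreover have "(\<tau> * (norm J)\<^sup>2) * (4 * (I + d) + 1) = (\<tau> * (4 * (I + d) + 1)) * (norm J)\<^sup>2"
    by (simp only: ac_simps)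
  moreover have "\<tau> * (4 * (I + d) + 1) = 1" using Id by (simp add: \<tau>_def)
  ultimately show ?thesis by (metis mult_1)
qed

text \<open>Both \<open>p\<close> and the constant 1 nearly minimise \<open>Q\<close> when
  \<open>W - I\<close> and \<open>d\<close> are small, and their midpoint is again a competitor. The
  parallelogram law then makes \<open>p - 1\<close> small in the weighted L2 norm, and
  Cauchy-Schwarz turns this into an L1 bound.\<close>

lemma minimiser_near_1:
  assumes p: "expoly y p 1" and d: "Q p \<le> I + d"
  shows "(LINT t|m. norm (f t) * \<bar>(norm (p t))\<^sup>2 - 1\<bar>) \<le>
    sqrt (2 * (W - I) + 2 * d) * sqrt (2 * (I + d) + 2 * W)"
proof -
  note tp = expoly_imp_trigpoly[OF p]
  have m1: "trigpoly (\<lambda>t. p t + (-1))" by (intro trigpoly.add tp trigpoly_const)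
  have p1: "trigpoly (\<lambda>t. p t + 1)" by (intro trigpoly.add tp trigpoly_const)
  have e: "expoly y (\<lambda>t. (1/2) * (p t + 1)) 1"
    using expoly.scale[OF expoly.add[OF p expoly_const[of y 1]], of "1/2"] by simp
  note i = integrable_f_trigpoly(4)[OF tp] integrable_f_trigpoly(4)[OF m1] integrable_f_trigpoly(4)[OF p1]
    integrable_norm_f
  have par: "(norm (p t + (-1)))\<^sup>2 = 2 * (norm (p t))\<^sup>2 + 2 - (norm (p t + 1))\<^sup>2" for t
    by (simp only: cmod_power2) (simp add: power2_eq_square algebra_simps)
  have half: "(norm ((1/2) * (p t + 1)))\<^sup>2 = (1/4) * (norm (p t + 1))\<^sup>2" for t
    by (simp only: norm_mult power_mult_distrib) (simp add: power2_eq_square)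
  have "I \<le> (LINT t|m. norm (f t) * ((1/4) * (norm (p t + 1))\<^sup>2))"
    using Q_lower(2)[OF e] by (simp only: Q_def half)
  also have "\<dots> = (1/4) * Q (\<lambda>t. p t + 1)" by (simp add: Q_def)
  finally have 4: "4 * I \<le> Q (\<lambda>t. p t + 1)" by simp
  have "Q (\<lambda>t. p t + (-1)) = (LINT t|m. 2 * (norm (f t) * (norm (p t))\<^sup>2) + 2 * norm (f t) - norm (f t) * (norm (p t + 1))\<^sup>2)"
    unfolding Q_def par by (simp add: algebra_simps)
  also have "\<dots> = 2 * Q p + 2 * W - Q (\<lambda>t. p t + 1)" using i by (simp add: Q_def W_def)
  finally have a: "Q (\<lambda>t. p t + (-1)) \<le> 2 * (W - I) + 2 * d" using 4 d by simp
  have ib: "integrable m (\<lambda>t. norm (f t) * (norm (p t) + 1)\<^sup>2)"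
    using integrable_f_trigpoly[OF tp] integrable_norm_f by (simp add: power2_sum algebra_simps)
  have "(LINT t|m. norm (f t) * (norm (p t) + 1)\<^sup>2) \<le> (LINT t|m. 2 * (norm (f t) * (norm (p t))\<^sup>2) + 2 * norm (f t))"
  proof (rule integral_mono[OF ib])
    fix t
    have "(norm (p t) + 1)\<^sup>2 \<le> 2 * (norm (p t))\<^sup>2 + 2"
      using zero_le_power2[of "norm (p t) - 1"] by (simp add: power2_eq_square algebra_simps)
    then have "norm (f t) * (norm (p t) + 1)\<^sup>2 \<le> norm (f t) * (2 * (norm (p t))\<^sup>2 + 2)"
      by (intro mult_left_mono) auto
    then show "norm (f t) * (norm (p t) + 1)\<^sup>2 \<le> 2 * (norm (f t) * (norm (p t))\<^sup>2) + 2 * norm (f t)"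
      by (simp add: algebra_simps)
  qed (use i in auto)
  also have "\<dots> = 2 * Q p + 2 * W" using i by (simp add: Q_def W_def)
  finally have b: "(LINT t|m. norm (f t) * (norm (p t) + 1)\<^sup>2) \<le> 2 * (I + d) + 2 * W" using d by simp
  have c: "\<bar>(norm (p t))\<^sup>2 - 1\<bar> \<le> norm (p t + (-1)) * (norm (p t) + 1)" for t
  proof -
    have "(norm (p t))\<^sup>2 - 1 = (norm (p t) - norm (1::complex)) * (norm (p t) + 1)"
      by (simp add: power2_eq_square algebra_simps)
    then have "\<bar>(norm (p t))\<^sup>2 - 1\<bar> = \<bar>norm (p t) - norm (1::complex)\<bar> * (norm (p t) + 1)"
      by (simp add: abs_mult)
    also have "\<dots> \<le> norm (p t - 1) * (norm (p t) + 1)"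
      by (intro mult_right_mono norm_triangle_ineq3) auto
    finally show ?thesis by simp
  qed
  have ic: "integrable m (\<lambda>t. norm (f t) * (norm (p t + (-1)) * (norm (p t) + 1)))"
  proof -
    have "norm (f t) * (norm (p t + (-1)) * (norm (p t) + 1)) =
      norm (f t) * norm ((p t + (-1)) * p t) + norm (f t) * norm (p t + (-1))" for t
      by (simp only: norm_mult distrib_left mult_1_right)
    then show ?thesis
      by (simp only:) (intro Bochner_Integration.integrable_add integrable_f_trigpoly(3) m1 trigpoly_mult tp)
  qed
  have "(LINT t|m. norm (f t) * \<bar>(norm (p t))\<^sup>2 - 1\<bar>) \<le>
     (LINT t|m. norm (f t) * (norm (p t + (-1)) * (norm (p t) + 1)))"
    using integrable_weighted(2)[OF tp tp] ic c by (intro integral_mono) (auto intro!: mult_left_mono)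
  also have "\<dots> \<le> sqrt (LINT t|m. norm (f t) * (norm (p t + (-1)))\<^sup>2) *
     sqrt (LINT t|m. norm (f t) * (norm (p t) + 1)\<^sup>2)"
    by (rule weighted_Cauchy_Schwarz) (use i ib ic in auto)
  also have "\<dots> \<le> sqrt (2 * (W - I) + 2 * d) * sqrt (2 * (I + d) + 2 * W)"
    using a b order_trans[OF Q_nonneg a] by (intro mult_mono) (auto simp: Q_def intro!: integral_nonneg_AE)
  finally show ?thesis .
qed

text \<open>The defect in \<open>norm f0 \<le> W\<close>; it is 0 exactly when the modulus of the
  mean equals the mean of the modulus.\<close>

definition "S = sqrt (W\<^sup>2 - (norm f0)\<^sup>2)"

lemma norm_f0_le: "norm f0 \<le> W"
  unfolding f0_def W_def by (rule integral_norm_bound)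

lemma S_sq: "S\<^sup>2 = W\<^sup>2 - (norm f0)\<^sup>2" and S_nonneg: "0 \<le> S"
proof -
  have "(norm f0)\<^sup>2 \<le> W\<^sup>2" using norm_f0_le by (intro power_mono) auto
  then show "S\<^sup>2 = W\<^sup>2 - (norm f0)\<^sup>2" "0 \<le> S" by (auto simp: S_def)
qed

text \<open>
  For a near-minimiser \<open>p\<close> the measure with density \<open>norm (f t) * (norm (p t))\<^sup>2\<close> almost annihilates
  every \<open>r\<close> vanishing at \<open>\<i> y\<close>, so, being real, it is almost \<open>I\<close> times \<open>m\<close>.
\<close>

lemma modulus_almost_constant: "(LINT t|m. \<bar>norm (f t) - I\<bar>) \<le> 3 * S"
proof -
  \<comment> \<open>The infimum need not be attained within exponential polynomials, so the argument
    runs along a minimising sequence.\<close>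
  have "\<exists>p. expoly y p 1 \<and> Q p < I + 1 / real (Suc n)" for n
  proof -
    have "{Q p |p. expoly y p 1} \<noteq> {}" using expoly_const by blast
    moreover have "Inf {Q p |p. expoly y p 1} < I + 1 / real (Suc n)" by (simp add: I_def)
    ultimately have "\<exists>x\<in>{Q p |p. expoly y p 1}. x < I + 1 / real (Suc n)" by (rule cInf_lessD)
    then show ?thesis by auto
  qed
  then have "\<forall>n. \<exists>p. expoly y p 1 \<and> Q p < I + 1 / real (Suc n)" by (rule allI)
  from choice[OF this] obtain p where p: "\<And>n. expoly y (p n) 1" and Qp: "\<And>n. Q (p n) < I + 1 / real (Suc n)"
    by auto
  note tp = expoly_imp_trigpoly[OF p]
  have d0: "(\<lambda>n. 1 / real (Suc n)) \<longlonglongrightarrow> 0"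
    by (rule LIMSEQ_Suc[OF lim_1_over_n])
  define L where "L h n = (LINT t|m. complex_of_real (norm (f t)) * of_real ((norm (p n t))\<^sup>2) * h t)" for h n
  have QL: "(\<lambda>n. Q (p n)) \<longlonglongrightarrow> I"
  proof (rule tendsto_sandwich)
    show "(\<lambda>n. I) \<longlonglongrightarrow> I" by simp
    show "(\<lambda>n. I + 1 / real (Suc n)) \<longlonglongrightarrow> I" using tendsto_add[OF tendsto_const d0] by simp
    show "eventually (\<lambda>n. I \<le> Q (p n)) sequentially" using Q_lower(2)[OF p] by simp
    show "eventually (\<lambda>n. Q (p n) \<le> I + 1 / real (Suc n)) sequentially"
      by (rule always_eventually) (blast intro: less_imp_le Qp)
  qed
  have L1: "L (\<lambda>_. c) n = of_real (Q (p n)) * c" for c :: complex and n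
  proof -
    have "L (\<lambda>_. c) n = (LINT t|m. of_real (norm (f t) * (norm (p n t))\<^sup>2) * c)" by (simp add: L_def)
    also have "\<dots> = (LINT t|m. complex_of_real (norm (f t) * (norm (p n t))\<^sup>2)) * c"
      by (rule integral_mult_left_zero)
    also have "(LINT t|m. complex_of_real (norm (f t) * (norm (p n t))\<^sup>2)) = of_real (Q (p n))"
      unfolding Q_def by (rule integral_complex_of_real)
    finally show ?thesis .
  qed
  have pos: "L (\<lambda>t. iexp (a * t)) \<longlonglongrightarrow> of_real I * (LINT t|m. iexp (a * t))" if a: "0 \<le> a" for a
  proof -
    let ?v = "complex_of_real (exp (- (y * a)))"
    \<comment> \<open>Subtracting its value at \<open>\<i> y\<close> makes the exponential vanish
      there. That value is a mean of unimodular numbers, whence the bound 2.\<close>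
    define r where "r t = iexp (a * t) + (- ?v)" for t
    have "expoly y r (?v + (- ?v))"
      unfolding r_def by (intro expoly.add expoly.iexp expoly_const a)
    then have er: "expoly y r 0" by simp
    have "norm ?v \<le> (LINT t|m. norm (iexp (a * t)))"
      unfolding mean_iexp[OF a, symmetric] by (rule integral_norm_bound)
    then have v1: "norm ?v \<le> 1" by (simp add: prob_space)
    have r2: "norm (r t) \<le> 2" for t
      unfolding r_def using norm_triangle_ineq[of "iexp (a * t)" "- ?v"] v1
      by (simp only: norm_minus_cancel norm_exp_i_times)
    have "(\<lambda>n. (norm (L r n))\<^sup>2) \<longlonglongrightarrow> 0"
    proof (rule tendsto_sandwich[where f = "\<lambda>_. 0"])
      have "(\<lambda>n. 1 / real (Suc n) * (4 * (I + 1 / real (Suc n)) + 1)) \<longlonglongrightarrow> 0 * (4 * (I + 0) + 1)"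
        by (intro tendsto_intros d0)
      then show "(\<lambda>n. 1 / real (Suc n) * (4 * (I + 1 / real (Suc n)) + 1)) \<longlonglongrightarrow> 0" by simp
      show "eventually (\<lambda>n. (norm (L r n))\<^sup>2 \<le> 1 / real (Suc n) * (4 * (I + 1 / real (Suc n)) + 1)) sequentially"
        unfolding L_def using almost_orthogonal[OF p er r2 less_imp_le[OF Qp]] by auto
    qed auto
    then have "(\<lambda>n. norm (L r n)) \<longlonglongrightarrow> 0"
      using tendsto_real_sqrt[of "\<lambda>n. (norm (L r n))\<^sup>2" 0] by simp
    then have r0: "L r \<longlonglongrightarrow> 0" by (rule tendsto_norm_zero_cancel)
    have "L (\<lambda>t. iexp (a * t)) n = L r n + L (\<lambda>_. ?v) n" for n
      unfolding L_def r_def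
      using integrable_weighted(1)[OF trigpoly.iexp[of a] tp[of n]] integrable_weighted(1)[OF trigpoly_const[of ?v] tp[of n]]
      by (subst Bochner_Integration.integral_add[symmetric])
        (simp_all add: algebra_simps del: of_real_power of_real_mult exp_of_real)
    then have "L (\<lambda>t. iexp (a * t)) = (\<lambda>n. L r n + of_real (Q (p n)) * ?v)" by (intro ext) (simp only: L1)
    also have "\<dots> \<longlonglongrightarrow> 0 + of_real I * ?v"
      by (intro tendsto_intros r0 QL)
    finally show ?thesis by (simp only: mean_iexp[OF a] add_0)
  qed
  have lim: "L h \<longlonglongrightarrow> of_real I * (LINT t|m. h t)" if "trigpoly h" for h
    using that
  proof (induction rule: trigpoly.induct)
    case (iexp a)
    show ?case
    proof (cases "0 \<le> a")
      case True
      then show ?thesis by (rule pos)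
    next
      case False
      \<comment> \<open>Only nonnegative frequencies extend to the half plane; the negative ones
        follow by conjugation because the weight is real.\<close>
      have c: "iexp (a * t) = cnj (iexp ((- a) * t))" for t by (simp add: exp_cnj)
      have "L (\<lambda>t. iexp (a * t)) n = cnj (L (\<lambda>t. iexp ((- a) * t)) n)" for n
      proof -
        have "L (\<lambda>t. iexp (a * t)) n =
          (LINT t|m. cnj (of_real (norm (f t)) * of_real ((norm (p n t))\<^sup>2) * iexp ((- a) * t)))"
          unfolding L_def c by (simp only: complex_cnj_mult complex_cnj_complex_of_real)
        then show ?thesis unfolding L_def by (simp only: Bochner_Integration.integral_cnj)
      qed
      moreover have "(LINT t|m. iexp (a * t)) = cnj (LINT t|m. iexp ((- a) * t))"
        unfolding c by (rule Bochner_Integration.integral_cnj)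
      moreover have "(\<lambda>n. cnj (L (\<lambda>t. iexp ((- a) * t)) n)) \<longlonglongrightarrow> cnj (of_real I * (LINT t|m. iexp ((- a) * t)))"
        by (intro tendsto_cnj pos) (use False in auto)
      ultimately show ?thesis by (simp only: complex_cnj_mult complex_cnj_complex_of_real)
    qed
  next
    case (add g h)
    have "L (\<lambda>t. g t + h t) = (\<lambda>n. L g n + L h n)"
    proof
      fix n
      show "L (\<lambda>t. g t + h t) n = L g n + L h n"
        unfolding L_def
        using integrable_weighted(1)[OF add(1) tp[of n]] integrable_weighted(1)[OF add(2) tp[of n]]
        by (subst Bochner_Integration.integral_add[symmetric])
          (simp_all add: algebra_simps del: of_real_power of_real_mult)
    qed
    moreover have "(LINT t|m. g t + h t) = (LINT t|m. g t) + (LINT t|m. h t)"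
      using integrable_f_trigpoly(1)[OF add(1)] integrable_f_trigpoly(1)[OF add(2)] by simp
    ultimately show ?case using tendsto_add[OF add.IH] by (simp add: algebra_simps)
  next
    case (scale h c)
    have "L (\<lambda>t. c * h t) = (\<lambda>n. c * L h n)"
      unfolding L_def by (simp only: mult.left_commute[of _ c] integral_mult_right_zero)
    moreover have "(LINT t|m. c * h t) = c * (LINT t|m. h t)" by simp
    ultimately show ?case using tendsto_mult[OF tendsto_const scale.IH, of c] by (simp add: algebra_simps)
  qed
  \<comment> \<open>Tested on \<open>h\<close>, the weight \<open>norm (f t)\<close> may be replaced
    by \<open>norm (f t) * (norm (p n t))\<^sup>2\<close> at the cost given by
    \<open>minimiser_near_1\<close>, and the latter weight tends to \<open>I\<close> times
    \<open>m\<close>. The right-hand side is that cost with slack 0.\<close>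
  have "(LINT t|m. \<bar>norm (f t) - I\<bar>) \<le> sqrt (2 * (W - I) + 2 * 0) * sqrt (2 * (I + 0) + 2 * W)"
  proof (rule trigpoly_norming[OF prob_space_axioms sets_m])
    show "\<bar>norm (f t) - I\<bar> \<le> B + \<bar>I\<bar>" for t using f_bounded[of t] norm_ge_zero[of "f t"] by linarith
    fix h :: "real \<Rightarrow> complex" and K assume h: "trigpoly h" and K: "\<And>t. norm (h t) \<le> K"
    have K0: "0 \<le> K" using order_trans[OF norm_ge_zero K] .
    have ih: "integrable m (\<lambda>t. of_real (norm (f t)) * h t)"
      using integrable_weighted(1)[OF h trigpoly_const[of 1]] by simp
    have ii: "integrable m (\<lambda>t. of_real I * h t)" using integrable_f_trigpoly(1)[OF h] by simp
    have lim': "(\<lambda>n. norm ((LINT t|m. of_real (norm (f t)) * h t) - L h n)) \<longlonglongrightarrow>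
      norm ((LINT t|m. of_real (norm (f t)) * h t) - of_real I * (LINT t|m. h t))"
      by (intro tendsto_intros lim h)
    have "norm ((LINT t|m. of_real (norm (f t)) * h t) - L h n) \<le>
       sqrt (2 * (W - I) + 2 * (1 / real (Suc n))) * sqrt (2 * (I + 1 / real (Suc n)) + 2 * W) * K" for n
    proof -
      have "(LINT t|m. of_real (norm (f t)) * h t) - L h n =
        (LINT t|m. of_real (norm (f t)) * h t - of_real (norm (f t)) * of_real ((norm (p n t))\<^sup>2) * h t)"
        unfolding L_def using ih integrable_weighted(1)[OF h tp]
        by (intro Bochner_Integration.integral_diff[symmetric]) auto
      also have "norm \<dots> \<le> (LINT t|m. norm (f t) * \<bar>(norm (p n t))\<^sup>2 - 1\<bar> * K)"
      proof (rule Bochner_Integration.integral_norm_bound_integral)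
        fix t
        have "of_real (norm (f t)) * h t - of_real (norm (f t)) * of_real ((norm (p n t))\<^sup>2) * h t =
          of_real (norm (f t)) * (of_real (1 - (norm (p n t))\<^sup>2) * h t)" by (simp add: algebra_simps)
        then show "norm (of_real (norm (f t)) * h t - of_real (norm (f t)) * of_real ((norm (p n t))\<^sup>2) * h t)
          \<le> norm (f t) * \<bar>(norm (p n t))\<^sup>2 - 1\<bar> * K"
          using K[of t] by (simp add: norm_mult abs_minus_commute mult.assoc mult_left_mono
              del: of_real_diff of_real_power)
      qed (use ih integrable_weighted[OF h tp] in auto)
      also have "\<dots> = (LINT t|m. norm (f t) * \<bar>(norm (p n t))\<^sup>2 - 1\<bar>) * K" by simp
      also have "\<dots> \<le> sqrt (2 * (W - I) + 2 * (1 / real (Suc n))) * sqrt (2 * (I + 1 / real (Suc n)) + 2 * W) * K"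
        by (intro mult_right_mono minimiser_near_1 p less_imp_le[OF Qp] K0)
      finally show ?thesis .
    qed
    moreover have "(\<lambda>n. sqrt (2 * (W - I) + 2 * (1 / real (Suc n))) * sqrt (2 * (I + 1 / real (Suc n)) + 2 * W) * K)
      \<longlonglongrightarrow> sqrt (2 * (W - I) + 2 * 0) * sqrt (2 * (I + 0) + 2 * W) * K"
      by (intro tendsto_intros d0)
    ultimately have "norm ((LINT t|m. of_real (norm (f t)) * h t) - of_real I * (LINT t|m. h t)) \<le>
      sqrt (2 * (W - I) + 2 * 0) * sqrt (2 * (I + 0) + 2 * W) * K"
      using LIMSEQ_le[OF lim'] by blast
    moreover have "(LINT t|m. of_real (norm (f t) - I) * h t) =
      (LINT t|m. of_real (norm (f t)) * h t) - of_real I * (LINT t|m. h t)"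
      using ih ii by (simp add: left_diff_distrib)
    ultimately show "norm (LINT t|m. of_real (norm (f t) - I) * h t) \<le>
      sqrt (2 * (W - I) + 2 * 0) * sqrt (2 * (I + 0) + 2 * W) * K" by simp
  qed measurable
  also have "\<dots> = sqrt ((2 * (W - I)) * (2 * (I + W)))"    unfolding real_sqrt_mult[symmetric] by (rule arg_cong[where f = sqrt]) (simp add: algebra_simps)
  also have "\<dots> \<le> sqrt ((3 * S)\<^sup>2)"
  proof (rule real_sqrt_le_mono)
    \<comment> \<open>By \<open>I \<le> W\<close> and \<open>(norm f0)\<^sup>2 \<le> W * I\<close>
      the product is at most \<open>8 * S\<^sup>2\<close>; rounding 8 up to 9 gives the factor
      3.\<close>
    have "(2 * (W - I)) * (2 * (I + W)) \<le> (2 * (W - I)) * (2 * (2 * W))"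
      using I_bounds by (intro mult_left_mono) auto
    also have "\<dots> = 8 * (W\<^sup>2 - W * I)" by (simp add: power2_eq_square algebra_simps)
    also have "\<dots> \<le> 8 * S\<^sup>2" using I_bounds(3) by (simp add: S_sq)
    also have "\<dots> \<le> (3 * S)\<^sup>2" by (simp add: power_mult_distrib)
    finally show "(2 * (W - I)) * (2 * (I + W)) \<le> (3 * S)\<^sup>2" .
  qed
  also have "\<dots> = 3 * S" using S_nonneg by (intro real_sqrt_unique) auto
  finally show ?thesis .
qed

text \<open>The deviation splits into an angular part, \<open>f t\<close> against
  \<open>of_real (norm (f t)) * c\<close>, and a radial part, \<open>norm (f t)\<close> against
  \<open>W\<close>. The first costs \<open>S\<close> by Cauchy-Schwarz; the second goes through
  \<open>I\<close> and costs \<open>3 * S\<close> twice.\<close>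

theorem mean_deviation: "(LINT t|m. norm (f t - f0)) \<le> 7 * S"
proof (cases "W = 0")
  case True
  then have "f0 = 0" using norm_f0_le by simp
  then show ?thesis using True S_nonneg by (simp add: W_def[symmetric])
next
  case False
  then have W: "0 < W" using W_nonneg by simp
  \<comment> \<open>\<open>c\<close> is the mean of \<open>sgn (f t)\<close> with respect to the
    weight \<open>norm (f t) / W\<close>.\<close>
  define c where "c = f0 / of_real W"
  have c1: "norm c \<le> 1" using norm_f0_le W by (simp add: c_def norm_divide)
  have c0: "f0 = of_real W * c" using W by (simp add: c_def)
  have if1: "integrable m f" by (rule integrable_borel_bounded[OF f_measurable f_bounded])
  have i1: "integrable m (\<lambda>t. norm (f t) * (norm (sgn (f t) - c))\<^sup>2)"
  proof (rule integrable_borel_bounded[where K = "B * 2\<^sup>2"])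
    fix t
    have "norm (sgn (f t) - c) \<le> 2"
      using norm_triangle_ineq4[of "sgn (f t)" c] c1 by (auto simp: norm_sgn split: if_splits)
    then have "(norm (sgn (f t) - c))\<^sup>2 \<le> 2\<^sup>2" by (rule power_mono) simp
    then show "norm (norm (f t) * (norm (sgn (f t) - c))\<^sup>2) \<le> B * 2\<^sup>2"
      unfolding real_norm_def abs_mult abs_norm_cancel abs_power2
      by (intro mult_mono f_bounded B_nonneg) auto
  qed (simp add: sgn_div_norm)
  have eq: "norm (f t - of_real (norm (f t)) * c) = norm (f t) * (1 * norm (sgn (f t) - c))" for t
  proof -
    have "f t - of_real (norm (f t)) * c = of_real (norm (f t)) * (sgn (f t) - c)"
      by (cases "f t = 0") (simp_all add: sgn_div_norm scaleR_conv_of_real field_simps)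
    then show ?thesis by (simp add: norm_mult)
  qed
  have i2: "integrable m (\<lambda>t. norm (f t) * (1 * norm (sgn (f t) - c)))"
    unfolding eq[symmetric] using if1 integrable_norm_f by (intro integrable_norm Bochner_Integration.integrable_diff
        integrable_mult_left integrable_of_real) auto
  have i4: "integrable m (\<lambda>t. norm (f t) - I)" using integrable_norm_f by simp
  have "(LINT t|m. norm (f t) * (norm (sgn (f t) - c))\<^sup>2) =
      (LINT t|m. norm (f t) - 2 * Re (cnj c * f t) + norm (f t) * (norm c)\<^sup>2)"
  proof (rule Bochner_Integration.integral_cong[OF refl])
    fix t
    have s: "f t = of_real (norm (f t)) * sgn (f t)"
      by (cases "f t = 0") (simp_all add: sgn_div_norm scaleR_conv_of_real field_simps)
    have "(norm (sgn (f t) - c))\<^sup>2 = (norm (sgn (f t)))\<^sup>2 - 2 * Re (cnj c * sgn (f t)) + (norm c)\<^sup>2"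
      by (simp only: cmod_power2) (simp add: power2_eq_square algebra_simps)
    then have 1: "norm (f t) * (norm (sgn (f t) - c))\<^sup>2 =
      norm (f t) * (norm (sgn (f t)))\<^sup>2 - 2 * (norm (f t) * Re (cnj c * sgn (f t))) + norm (f t) * (norm c)\<^sup>2"
      by (simp only: right_diff_distrib distrib_left mult.left_commute)
    have "cnj c * f t = of_real (norm (f t)) * (cnj c * sgn (f t))"
      by (metis s mult.left_commute)
    then have 2: "Re (cnj c * f t) = norm (f t) * Re (cnj c * sgn (f t))"
      by (metis Re_complex_of_real_mult)
    have "norm (f t) * (norm (sgn (f t)))\<^sup>2 = norm (f t)" by (simp add: norm_sgn)
    then show "norm (f t) * (norm (sgn (f t) - c))\<^sup>2 = norm (f t) - 2 * Re (cnj c * f t) + norm (f t) * (norm c)\<^sup>2"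
      unfolding 1 2 by (simp only:)
  qed
  also have "\<dots> = W - 2 * Re (cnj c * f0) + W * (norm c)\<^sup>2"
  proof -
    have "(LINT t|m. Re (cnj c * f t)) = Re (cnj c * f0)"
      using if1 by (subst integral_Re) (auto simp: f0_def)
    moreover have "integrable m (\<lambda>t. Re (cnj c * f t))" using if1 by (intro integrable_Re) auto
    ultimately show ?thesis using integral_lincomb2[OF integrable_norm_f] by (simp only: W_def)
  qed
  also have "Re (cnj c * f0) = W * (norm c)\<^sup>2"
    unfolding c0 by (simp only: cmod_power2) (simp add: power2_eq_square algebra_simps)
  \<comment> \<open>This is the weighted variance of \<open>sgn (f t)\<close>, namely
    \<open>W * (1 - (norm c)\<^sup>2)\<close>.\<close>
  also have "W - 2 * (W * (norm c)\<^sup>2) + W * (norm c)\<^sup>2 = S\<^sup>2 / W"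
    using W unfolding S_sq by (simp add: c_def norm_divide power2_eq_square field_simps)
  finally have v: "(LINT t|m. norm (f t) * (norm (sgn (f t) - c))\<^sup>2) = S\<^sup>2 / W" .
  have "(LINT t|m. norm (f t - of_real (norm (f t)) * c)) \<le> sqrt (LINT t|m. norm (f t) * 1\<^sup>2) * sqrt (S\<^sup>2 / W)"
    unfolding eq v[symmetric] by (rule weighted_Cauchy_Schwarz) (use i1 i2 integrable_norm_f in auto)
  also have "\<dots> = S" using W S_nonneg by (simp add: W_def[symmetric] real_sqrt_divide)
  finally have 1: "(LINT t|m. norm (f t - of_real (norm (f t)) * c)) \<le> S" .
  have "W - I = (LINT t|m. norm (f t) - I)" using integrable_norm_f by (simp add: W_def prob_space)
  also have "\<dots> \<le> (LINT t|m. \<bar>norm (f t) - I\<bar>)"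
    using i4 by (intro integral_mono) auto
  finally have WI: "W - I \<le> 3 * S" using modulus_almost_constant by linarith
  have "(LINT t|m. norm (f t - f0)) \<le>
     (LINT t|m. norm (f t - of_real (norm (f t)) * c) + (\<bar>norm (f t) - I\<bar> + (W - I)))"
  proof (rule integral_mono)
    show "integrable m (\<lambda>t. norm (f t - of_real (norm (f t)) * c) + (\<bar>norm (f t) - I\<bar> + (W - I)))"
      unfolding eq using i2 i4 by auto
    show "integrable m (\<lambda>t. norm (f t - f0))" using if1 by auto
    fix t
    have "f t - f0 = (f t - of_real (norm (f t)) * c) + of_real (norm (f t) - W) * c"
      unfolding c0 by (simp add: algebra_simps)
    then have "norm (f t - f0) \<le> norm (f t - of_real (norm (f t)) * c) + norm (of_real (norm (f t) - W) * c)"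
      by (metis norm_triangle_ineq)
    also have "norm (of_real (norm (f t) - W) * c) \<le> \<bar>norm (f t) - W\<bar> * 1"
      unfolding norm_mult using c1 by (intro mult_mono) auto
    also have "\<bar>norm (f t) - W\<bar> * 1 \<le> \<bar>norm (f t) - I\<bar> + (W - I)"
      using abs_triangle_ineq[of "norm (f t) - I" "I - W"] I_bounds(2) by simp
    finally show "norm (f t - f0) \<le> norm (f t - of_real (norm (f t)) * c) + (\<bar>norm (f t) - I\<bar> + (W - I))" by simp
  qed
  also have "\<dots> = (LINT t|m. norm (f t - of_real (norm (f t)) * c)) + ((LINT t|m. \<bar>norm (f t) - I\<bar>) + (W - I))"
    unfolding eq using i2 i4 by (simp add: prob_space del: mult_1)
  also have "\<dots> \<le> S + (3 * S + 3 * S)" using 1 modulus_almost_constant WI by linarith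
  finally show ?thesis by simp
qed

end

section \<open>Complex measures\<close>

text \<open>A family need not cover \<open>space M\<close>. It still bounds the norm from below, and
  passing to traces or subfamilies stays inside the class.\<close>

definition set_families :: "'a measure \<Rightarrow> 'a set set set" where
  "set_families M = {P. finite P \<and> disjoint P \<and> P \<subseteq> sets M}"

definition psum :: "'a set set \<Rightarrow> ('a set \<Rightarrow> complex) \<Rightarrow> real" where
  "psum P \<mu> = (\<Sum>B\<in>P. cmod (\<mu> B))"

text \<open>For measurable \<open>A\<close> this is vanishing of the total variation on
  \<open>A\<close>, expressed by values of \<mu> alone.\<close>

definition cm_null :: "'a measure \<Rightarrow> ('a set \<Rightarrow> complex) \<Rightarrow> 'a set \<Rightarrow> bool" where
  "cm_null M \<mu> A \<longleftrightarrow> (\<forall>B\<in>sets M. B \<subseteq> A \<longrightarrow> \<mu> B = 0)"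

lemma cmI:
  assumes "\<And>A. A \<notin> sets M \<Longrightarrow> \<mu> A = 0" "\<mu> {} = 0"
    "\<And>A :: nat \<Rightarrow> 'a set. range A \<subseteq> sets M \<Longrightarrow> disjoint_family A \<Longrightarrow>
      (\<lambda>i. \<mu> (A i)) sums \<mu> (\<Union>i. A i)"
  shows "\<mu> \<in> complex_measures M"
  using assms by (simp add: complex_measures_def)

lemma cm_outside: "\<mu> \<in> complex_measures M \<Longrightarrow> A \<notin> sets M \<Longrightarrow> \<mu> A = 0"
  by (simp add: complex_measures_def)

lemma cm_empty: "\<mu> \<in> complex_measures M \<Longrightarrow> \<mu> {} = 0"
  by (simp add: complex_measures_def)

lemma cm_sums:
  "\<mu> \<in> complex_measures M \<Longrightarrow> range A \<subseteq> sets M \<Longrightarrow> disjoint_family A \<Longrightarrow>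
    (\<lambda>i::nat. \<mu> (A i)) sums \<mu> (\<Union>i. A i)"
  by (simp add: complex_measures_def)

lemma cm_Un:
  assumes "\<mu> \<in> complex_measures M" "A \<in> sets M" "B \<in> sets M" "A \<inter> B = {}"
  shows "\<mu> (A \<union> B) = \<mu> A + \<mu> B"
proof -
  have "(\<lambda>i. \<mu> (binaryset A B i)) sums \<mu> (\<Union>i. binaryset A B i)"
    using assms by (intro cm_sums) (auto simp: range_binaryset_eq disjoint_family_on_def binaryset_def)
  moreover have "(\<lambda>i. \<mu> (binaryset A B i)) sums (\<mu> A + \<mu> B)"
    by (rule binaryset_sums) (rule cm_empty[OF assms(1)])
  ultimately show ?thesis by (simp add: UN_binaryset_eq sums_unique2)
qed

lemma cm_Diff:
  assumes "\<mu> \<in> complex_measures M" "A \<in> sets M" "B \<in> sets M" "B \<subseteq> A"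
  shows "\<mu> (A - B) = \<mu> A - \<mu> B"
  using cm_Un[of \<mu> M B "A - B"] assms by (auto simp: Un_absorb1)

lemma cm_split:
  assumes "\<mu> \<in> complex_measures M" "A \<in> sets M" "B \<in> sets M"
  shows "\<mu> A = \<mu> (A \<inter> B) + \<mu> (A - B)"
  using cm_Un[of \<mu> M "A \<inter> B" "A - B"] assms by (auto simp: Int_Diff_Un)

lemma cm_UN_finite:
  assumes "\<mu> \<in> complex_measures M" "finite I" "\<And>i. i \<in> I \<Longrightarrow> A i \<in> sets M" "disjoint_family_on A I"
  shows "\<mu> (\<Union>i\<in>I. A i) = (\<Sum>i\<in>I. \<mu> (A i))"
  using assms(2-4)
proof (induction I rule: finite_induct)
  case empty
  then show ?case using cm_empty[OF assms(1)] by simp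
next
  case (insert i I)
  have "\<mu> (A i \<union> (\<Union>i\<in>I. A i)) = \<mu> (A i) + \<mu> (\<Union>i\<in>I. A i)"
    using insert by (intro cm_Un[OF assms(1)]) (auto simp: disjoint_family_on_def)
  then show ?case using insert by (auto simp: disjoint_family_on_def)
qed

lemma cm_Union:
  assumes "\<mu> \<in> complex_measures M" "P \<in> set_families M"
  shows "\<mu> (\<Union>P) = (\<Sum>B\<in>P. \<mu> B)"
  using cm_UN_finite[OF assms(1), of P "\<lambda>B. B"] assms(2)
  by (auto simp: set_families_def disjoint_family_on_def disjoint_def subset_eq)

section \<open>Finiteness and approximation of the total variation\<close>

text \<open>If \<mu> were unbounded, one could shrink a set with unbounded subsets again and again,
  removing a piece of modulus above 1 each time. The removed pieces are disjoint, and countable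
  additivity forces their measures to tend to 0.\<close>

lemma cm_bounded:
  assumes \<mu>: "\<mu> \<in> complex_measures M"
  shows "\<exists>K. \<forall>A. cmod (\<mu> A) \<le> K"
proof (rule ccontr)
  assume unbounded: "\<nexists>K. \<forall>A. cmod (\<mu> A) \<le> K"
  define unb where "unb E \<longleftrightarrow> (\<forall>K. \<exists>B\<in>sets M. B \<subseteq> E \<and> K < cmod (\<mu> B))" for E
  have step: "\<exists>E'. (E' \<in> sets M \<and> unb E') \<and> E' \<subseteq> E \<and> 1 < cmod (\<mu> (E - E'))"
    if E: "E \<in> sets M \<and> unb E" for E
  proof -
    \<comment> \<open>With this margin both \<open>A\<close> and \<open>E - A\<close> have measure
      of modulus above 1, so whichever of them still has unbounded subsets can be kept and the other
      removed.\<close>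
    obtain A where A: "A \<in> sets M" "A \<subseteq> E" "1 + cmod (\<mu> E) < cmod (\<mu> A)"
      using E unfolding unb_def by blast
    have "unb A \<or> unb (E - A)"
    proof (rule ccontr)
      assume "\<not> ?thesis"
      then obtain K L where K: "\<And>B. B \<in> sets M \<Longrightarrow> B \<subseteq> A \<Longrightarrow> cmod (\<mu> B) \<le> K"
        and L: "\<And>B. B \<in> sets M \<Longrightarrow> B \<subseteq> E - A \<Longrightarrow> cmod (\<mu> B) \<le> L"
        unfolding unb_def by (meson not_le)
      obtain B where B: "B \<in> sets M" "B \<subseteq> E" "K + L < cmod (\<mu> B)" using E unfolding unb_def by blast
      have "cmod (\<mu> B) \<le> cmod (\<mu> (B \<inter> A)) + cmod (\<mu> (B - A))"
        using cm_split[OF \<mu> B(1) A(1)] norm_triangle_ineq by metis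
      also have "\<dots> \<le> K + L" using A B by (intro add_mono K L) auto
      finally show False using B by simp
    qed
    then show ?thesis
    proof
      assume "unb A"
      have "\<mu> (E - A) = \<mu> E - \<mu> A" using E A by (intro cm_Diff[OF \<mu>]) auto
      then have "1 < cmod (\<mu> (E - A))"
        using A(3) norm_triangle_ineq2[of "\<mu> A" "\<mu> E"] by (simp add: norm_minus_commute)
      then show ?thesis using A \<open>unb A\<close> by blast
    next
      assume "unb (E - A)"
      moreover have "E - (E - A) = A" using A by auto
      moreover have "1 < cmod (\<mu> A)" using A(3) norm_ge_zero[of "\<mu> E"] by linarith
      ultimately show ?thesis using A E by (intro exI[of _ "E - A"]) auto
    qed
  qed
  have "unb (space M)"
    unfolding unb_def
  proof
    fix K
    obtain A where "max K 0 < cmod (\<mu> A)" using unbounded by (meson not_le)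
    moreover from this have "A \<in> sets M" using cm_outside[OF \<mu>, of A] by (cases "A \<in> sets M") auto
    ultimately show "\<exists>B\<in>sets M. B \<subseteq> space M \<and> K < cmod (\<mu> B)" using sets.sets_into_space by auto
  qed
  then have "\<exists>E. E \<in> sets M \<and> unb E" by blast
  from dependent_nat_choice[of "\<lambda>n E. E \<in> sets M \<and> unb E"
        "\<lambda>n E E'. E' \<subseteq> E \<and> 1 < cmod (\<mu> (E - E'))", OF this step]
  obtain E where E: "\<And>n::nat. E n \<in> sets M \<and> unb (E n)"
    and dec: "\<And>n. E (Suc n) \<subseteq> E n \<and> 1 < cmod (\<mu> (E n - E (Suc n)))"
    by auto
  have anti: "E n \<subseteq> E m" if "m \<le> n" for m n
    using that dec by (rule_tac lift_Suc_antimono_le) auto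
  have "disjoint_family (\<lambda>n. E n - E (Suc n))"
    unfolding disjoint_family_on_def
  proof (intro ballI impI)
    fix m n :: nat assume "m \<noteq> n"
    then show "(E m - E (Suc m)) \<inter> (E n - E (Suc n)) = {}"
      using anti[of "Suc m" n] anti[of "Suc n" m] by (cases "m < n") auto
  qed
  moreover have "range (\<lambda>n. E n - E (Suc n)) \<subseteq> sets M" using E by blast
  ultimately have "summable (\<lambda>n. \<mu> (E n - E (Suc n)))"
    using cm_sums[OF \<mu>] by (blast intro: sums_summable)
  then have "(\<lambda>n. cmod (\<mu> (E n - E (Suc n)))) \<longlonglongrightarrow> 0"
    by (intro tendsto_norm_zero summable_LIMSEQ_zero)
  then have "eventually (\<lambda>n. cmod (\<mu> (E n - E (Suc n))) < 1) sequentially"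
    by (rule order_tendstoD) simp
  then obtain N where "\<forall>n\<ge>N. cmod (\<mu> (E n - E (Suc n))) < 1"
    unfolding eventually_sequentially by auto
  then show False using dec[of N] by force
qed

lemma psum_nonneg: "0 \<le> psum P \<mu>"
  by (simp add: psum_def sum_nonneg)

text \<open>For a real part, the members of the family where it is nonnegative and those where it is
  negative can each be united to one set, where the uniform bound applies. The factor
  \<open>c\<close> lets one argument serve real and imaginary parts.\<close>

lemma psum_bounded:
  assumes \<mu>: "\<mu> \<in> complex_measures M"
  shows "\<exists>K. \<forall>P\<in>set_families M. psum P \<mu> \<le> K"
proof -
  obtain K where K: "\<And>A. cmod (\<mu> A) \<le> K" using cm_bounded[OF \<mu>] by auto
  have part: "(\<Sum>B\<in>P. \<bar>Re (c * \<mu> B)\<bar>) \<le> 2 * K" if P: "P \<in> set_families M" and c: "cmod c = 1" for P c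
  proof -
    have fam: "{B\<in>P. Q B} \<in> set_families M" for Q
      using P by (auto simp: set_families_def disjoint_def)
    have fin: "finite P" using P by (simp add: set_families_def)
    have sub: "\<bar>\<Sum>B\<in>{B\<in>P. Q B}. Re (c * \<mu> B)\<bar> \<le> K" for Q
    proof -
      have "(\<Sum>B\<in>{B\<in>P. Q B}. Re (c * \<mu> B)) = Re (c * \<mu> (\<Union>{B\<in>P. Q B}))"
        unfolding cm_Union[OF \<mu> fam] by (simp only: sum_distrib_left Re_sum)
      also have "\<bar>\<dots>\<bar> \<le> cmod (c * \<mu> (\<Union>{B\<in>P. Q B}))" by (rule abs_Re_le_cmod)
      also have "\<dots> \<le> K" using K by (simp only: norm_mult c mult_1)
      finally show ?thesis .
    qed
    have "(\<Sum>B\<in>P. \<bar>Re (c * \<mu> B)\<bar>) =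
      (\<Sum>B\<in>{B\<in>P. 0 \<le> Re (c * \<mu> B)}. \<bar>Re (c * \<mu> B)\<bar>) + (\<Sum>B\<in>{B\<in>P. \<not> 0 \<le> Re (c * \<mu> B)}. \<bar>Re (c * \<mu> B)\<bar>)"
      using fin by (subst sum.union_disjoint[symmetric]) (auto intro!: sum.cong)
    also have "(\<Sum>B\<in>{B\<in>P. 0 \<le> Re (c * \<mu> B)}. \<bar>Re (c * \<mu> B)\<bar>) = (\<Sum>B\<in>{B\<in>P. 0 \<le> Re (c * \<mu> B)}. Re (c * \<mu> B))"
      by (intro sum.cong refl abs_of_nonneg) auto
    also have "(\<Sum>B\<in>{B\<in>P. \<not> 0 \<le> Re (c * \<mu> B)}. \<bar>Re (c * \<mu> B)\<bar>) = (\<Sum>B\<in>{B\<in>P. \<not> 0 \<le> Re (c * \<mu> B)}. - Re (c * \<mu> B))"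
      by (intro sum.cong refl abs_of_neg) auto
    also have "(\<Sum>B\<in>{B\<in>P. 0 \<le> Re (c * \<mu> B)}. Re (c * \<mu> B)) + (\<Sum>B\<in>{B\<in>P. \<not> 0 \<le> Re (c * \<mu> B)}. - Re (c * \<mu> B)) \<le> K + K"
      unfolding sum_negf
      by (intro add_mono order_trans[OF abs_ge_self sub] order_trans[OF abs_ge_minus_self sub])
    finally show ?thesis by simp
  qed
  have "psum P \<mu> \<le> 4 * K" if P: "P \<in> set_families M" for P
  proof -
    have "psum P \<mu> \<le> (\<Sum>B\<in>P. \<bar>Re (1 * \<mu> B)\<bar> + \<bar>Re ((-\<i>) * \<mu> B)\<bar>)"
      unfolding psum_def by (intro sum_mono) (simp add: cmod_le)
    also have "\<dots> \<le> 2 * K + 2 * K"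
      unfolding sum.distrib by (intro add_mono part P) auto
    finally show ?thesis by simp
  qed
  then show ?thesis by blast
qed

abbreviation partitions :: "'a measure \<Rightarrow> 'a set \<Rightarrow> 'a set set set" where
  "partitions M A \<equiv> {P. finite P \<and> disjoint P \<and> P \<subseteq> sets M \<and> \<Union>P = A}"

lemma total_variation_psum: "total_variation M \<mu> A = (SUP P \<in> partitions M A. ennreal (psum P \<mu>))"
  by (simp add: total_variation_def psum_def)

lemma partitions_extend:
  assumes "P \<in> set_families M" "\<Union>P \<subseteq> A" "A \<in> sets M"
  shows "insert (A - \<Union>P) P \<in> partitions M A"
  using assms by (auto simp: set_families_def disjoint_def sets.finite_Union)

lemma family_subset_space: "P \<in> set_families M \<Longrightarrow> \<Union>P \<subseteq> space M"
  unfolding set_families_def by (blast dest: sets.sets_into_space)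

lemma psum_mono: "finite Q \<Longrightarrow> P \<subseteq> Q \<Longrightarrow> psum P \<mu> \<le> psum Q \<mu>"
  unfolding psum_def by (intro sum_mono2) auto

lemma psum_le_total_variation:
  assumes "P \<in> set_families M" "\<Union>P \<subseteq> A" "A \<in> sets M"
  shows "ennreal (psum P \<mu>) \<le> total_variation M \<mu> A"
proof -
  have "ennreal (psum P \<mu>) \<le> ennreal (psum (insert (A - \<Union>P) P) \<mu>)"
    using assms by (intro ennreal_leI psum_mono) (auto simp: set_families_def)
  also have "\<dots> \<le> total_variation M \<mu> A"
    unfolding total_variation_psum by (rule SUP_upper) (rule partitions_extend[OF assms])
  finally show ?thesis .
qed

lemma total_variation_le:
  assumes "\<And>P. P \<in> set_families M \<Longrightarrow> \<Union>P = A \<Longrightarrow> ennreal (psum P \<mu>) \<le> c"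
  shows "total_variation M \<mu> A \<le> c"
  unfolding total_variation_psum by (rule SUP_least) (use assms in \<open>auto simp: set_families_def\<close>)

lemma total_variation_finite:
  assumes "\<mu> \<in> complex_measures M"
  shows "total_variation M \<mu> A < \<infinity>"
proof -
  obtain K where K: "\<And>P. P \<in> set_families M \<Longrightarrow> psum P \<mu> \<le> K" using psum_bounded[OF assms] by auto
  have "total_variation M \<mu> A \<le> ennreal K" by (intro total_variation_le ennreal_leI K)
  also have "\<dots> < \<infinity>" by simp
  finally show ?thesis .
qed

lemma cm_norm_nonneg: "0 \<le> cm_norm M \<mu>"
  by (simp add: cm_norm_def)

lemma ennreal_cm_norm:
  "\<mu> \<in> complex_measures M \<Longrightarrow> ennreal (cm_norm M \<mu>) = total_variation M \<mu> (space M)"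
  using total_variation_finite[of \<mu> M "space M"] by (simp add: cm_norm_def less_top)

lemma psum_le_norm:
  assumes "\<mu> \<in> complex_measures M" "P \<in> set_families M"
  shows "psum P \<mu> \<le> cm_norm M \<mu>"
proof -
  have "\<Union>P \<subseteq> space M" by (rule family_subset_space[OF assms(2)])
  then have "ennreal (psum P \<mu>) \<le> ennreal (cm_norm M \<mu>)"
    unfolding ennreal_cm_norm[OF assms(1)] using assms(2) by (intro psum_le_total_variation) auto
  then show ?thesis using cm_norm_nonneg[of M \<mu>] by simp
qed

lemma cm_norm_le:
  assumes "\<And>P. P \<in> set_families M \<Longrightarrow> psum P \<mu> \<le> c"
  shows "cm_norm M \<mu> \<le> c"
proof -
  have "{} \<in> set_families M" by (simp add: set_families_def)
  then have "0 \<le> c" using assms[of "{}"] by (simp add: psum_def)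
  have "total_variation M \<mu> (space M) \<le> ennreal c"
    by (intro total_variation_le ennreal_leI assms)
  then show ?thesis
    unfolding cm_norm_def using enn2real_mono[of _ "ennreal c"] \<open>0 \<le> c\<close> by fastforce
qed

lemma cmod_le_norm:
  assumes "\<mu> \<in> complex_measures M"
  shows "cmod (\<mu> A) \<le> cm_norm M \<mu>"
proof (cases "A \<in> sets M")
  case True
  then show ?thesis using psum_le_norm[OF assms, of "{A}"] by (simp add: psum_def set_families_def)
next
  case False
  then show ?thesis using cm_outside[OF assms] cm_norm_nonneg[of M \<mu>] by simp
qed

lemma cm_norm_approx:
  assumes "\<mu> \<in> complex_measures M" "0 < e"
  shows "\<exists>P\<in>partitions M (space M). cm_norm M \<mu> - e < psum P \<mu>"
proof (rule ccontr)
  assume *: "\<not> ?thesis"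
  have "psum P \<mu> \<le> cm_norm M \<mu> - e" if P: "P \<in> set_families M" for P
  proof -
    have "\<Union>P \<subseteq> space M" by (rule family_subset_space[OF P])
    then have "insert (space M - \<Union>P) P \<in> partitions M (space M)" by (intro partitions_extend P) auto
    then have "psum (insert (space M - \<Union>P) P) \<mu> \<le> cm_norm M \<mu> - e" using * by (meson not_le)
    moreover have "psum P \<mu> \<le> psum (insert (space M - \<Union>P) P) \<mu>"
      using P by (intro psum_mono) (auto simp: set_families_def)
    ultimately show ?thesis by simp
  qed
  then have "cm_norm M \<mu> \<le> cm_norm M \<mu> - e" by (rule cm_norm_le)
  then show False using assms by simp
qed

section \<open>Traces and common refinements\<close>

text \<open>Disjoint sets have the same trace on \<open>A\<close> only if the trace is empty, and
  the empty set contributes nothing, so the image may be summed as if indexed by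
  \<open>P\<close>.\<close>

lemma psum_image_Int:
  assumes "\<mu> {} = 0" "finite P" "disjoint P"
  shows "psum ((\<lambda>B. B \<inter> A) ` P) \<mu> = (\<Sum>B\<in>P. cmod (\<mu> (B \<inter> A)))"
  unfolding psum_def
proof (subst sum.reindex_nontrivial[OF assms(2)])
  fix B C assume BC: "B \<in> P" "C \<in> P" "B \<noteq> C" "B \<inter> A = C \<inter> A"
  then have "B \<inter> C = {}" using assms(3) by (auto simp: disjoint_def)
  then have "B \<inter> A = {}" using BC(4) by auto
  then show "cmod (\<mu> (B \<inter> A)) = 0" using assms(1) by simp
qed simp

lemma family_image_Int:
  assumes "P \<in> set_families M" "A \<in> sets M"
  shows "(\<lambda>B. B \<inter> A) ` P \<in> set_families M"
  using assms by (auto simp: set_families_def disjoint_def)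

text \<open>The refinement is built from \<open>P\<close> and \<open>Q\<close> alone and therefore
  serves every measure at once.\<close>

lemma psum_refine:
  assumes P: "P \<in> partitions M (space M)" and Q: "Q \<in> partitions M (space M)"
  obtains R where "R \<in> partitions M (space M)"
    "\<And>\<mu>. \<mu> \<in> complex_measures M \<Longrightarrow> psum P \<mu> \<le> psum R \<mu>"
    "\<And>\<mu>. \<mu> \<in> complex_measures M \<Longrightarrow> psum Q \<mu> \<le> psum R \<mu>"
proof
  let ?R = "(\<lambda>(A, B). A \<inter> B) ` (P \<times> Q)"
  have dP: "disjoint P" and dQ: "disjoint Q" using P Q by auto
  show "?R \<in> partitions M (space M)"
  proof -
    have "disjoint ?R"
    proof (rule disjointI)
      fix X Y assume "X \<in> ?R" "Y \<in> ?R" "X \<noteq> Y"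
      then obtain A B C D where X: "X = A \<inter> B" "A \<in> P" "B \<in> Q" and Y: "Y = C \<inter> D" "C \<in> P" "D \<in> Q" by auto
      with \<open>X \<noteq> Y\<close> have "A \<noteq> C \<or> B \<noteq> D" by auto
      then have "A \<inter> C = {} \<or> B \<inter> D = {}" using X Y disjointD[OF dP] disjointD[OF dQ] by blast
      then show "X \<inter> Y = {}" unfolding X(1) Y(1) by blast
    qed
    moreover have "\<Union>?R = \<Union>P \<inter> \<Union>Q" by auto
    ultimately show ?thesis using P Q by auto
  qed
  fix \<mu> assume \<mu>: "\<mu> \<in> complex_measures M"
  have R: "psum ?R \<mu> = (\<Sum>(A, B)\<in>P \<times> Q. cmod (\<mu> (A \<inter> B)))"
    unfolding psum_def
  proof (subst sum.reindex_nontrivial)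
    show "finite (P \<times> Q)" using P Q by simp
    fix x y assume xy: "x \<in> P \<times> Q" "y \<in> P \<times> Q" "x \<noteq> y" "(\<lambda>(A, B). A \<inter> B) x = (\<lambda>(A, B). A \<inter> B) y"
    obtain A B C D where *: "x = (A, B)" "y = (C, D)" by (metis surj_pair)
    then have "A \<noteq> C \<or> B \<noteq> D" "A \<in> P" "C \<in> P" "B \<in> Q" "D \<in> Q" using xy by auto
    then have "A \<inter> C = {} \<or> B \<inter> D = {}" using disjointD[OF dP] disjointD[OF dQ] by blast
    moreover have "A \<inter> B = C \<inter> D" using xy(4) * by simp
    ultimately have "A \<inter> B = {}" by blast
    then show "cmod (\<mu> ((\<lambda>(A, B). A \<inter> B) x)) = 0" using * cm_empty[OF \<mu>] by simp
  qed (simp add: case_prod_unfold)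
  have half: "cmod (\<mu> A) \<le> (\<Sum>B\<in>Q. cmod (\<mu> (A \<inter> B)))"
    if A: "A \<in> sets M" and Q: "Q \<in> partitions M (space M)" for A Q
  proof -
    have "(\<Union>B\<in>Q. A \<inter> B) = A" using Q A sets.sets_into_space by auto
    then have "\<mu> A = \<mu> (\<Union>B\<in>Q. A \<inter> B)" by simp
    also have "\<dots> = (\<Sum>B\<in>Q. \<mu> (A \<inter> B))"
      using Q A by (intro cm_UN_finite[OF \<mu>]) (auto simp: disjoint_family_on_def disjoint_def)
    finally show ?thesis by (simp add: norm_sum)
  qed
  have "psum P \<mu> \<le> (\<Sum>A\<in>P. \<Sum>B\<in>Q. cmod (\<mu> (A \<inter> B)))"
    unfolding psum_def using P Q by (intro sum_mono half) auto
  then show "psum P \<mu> \<le> psum ?R \<mu>" unfolding R by (simp add: sum.cartesian_product)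
  have "psum Q \<mu> \<le> (\<Sum>B\<in>Q. \<Sum>A\<in>P. cmod (\<mu> (B \<inter> A)))"
    unfolding psum_def using P Q by (intro sum_mono half) auto
  also have "\<dots> = (\<Sum>A\<in>P. \<Sum>B\<in>Q. cmod (\<mu> (A \<inter> B)))"
    by (subst sum.swap) (simp add: Int_commute)
  finally show "psum Q \<mu> \<le> psum ?R \<mu>" unfolding R by (simp add: sum.cartesian_product)
qed

text \<open>One partition has to detect several norms simultaneously: four in the characterisation
  of singularity, and those along a grid of orbit points in the continuity argument.\<close>

lemma cm_norm_approx_finite:
  assumes "finite F" "F \<subseteq> complex_measures M" "0 < e"
  shows "\<exists>P\<in>partitions M (space M). \<forall>\<mu>\<in>F. cm_norm M \<mu> - e < psum P \<mu>"
  using assms(1,2)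
proof (induction F rule: finite_induct)
  case empty
  have "{space M} \<in> partitions M (space M)" by simp
  then show ?case by blast
next
  case (insert \<mu> F)
  then obtain P where P: "P \<in> partitions M (space M)" "\<And>\<nu>. \<nu> \<in> F \<Longrightarrow> cm_norm M \<nu> - e < psum P \<nu>" by auto
  obtain Q where Q: "Q \<in> partitions M (space M)" "cm_norm M \<mu> - e < psum Q \<mu>"
    using cm_norm_approx[of \<mu> M e] insert assms(3) by auto
  obtain R where R: "R \<in> partitions M (space M)"
    "\<And>\<mu>. \<mu> \<in> complex_measures M \<Longrightarrow> psum P \<mu> \<le> psum R \<mu>"
    "\<And>\<mu>. \<mu> \<in> complex_measures M \<Longrightarrow> psum Q \<mu> \<le> psum R \<mu>"
    using psum_refine[OF P(1) Q(1)] by blast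
  have "cm_norm M \<nu> - e < psum R \<nu>" if "\<nu> \<in> insert \<mu> F" for \<nu>
  proof (cases "\<nu> = \<mu>")
    case True
    then show ?thesis using R(3)[of \<mu>] Q(2) insert by auto
  next
    case False
    then have "\<nu> \<in> F" using that by auto
    then show ?thesis using R(2)[of \<nu>] P(2)[of \<nu>] insert by auto
  qed
  then show ?case using R(1) by blast
qed

lemma partitions_subset_families: "P \<in> partitions M A \<Longrightarrow> P \<in> set_families M"
  by (simp add: set_families_def)

section \<open>Linear structure, null sets and completeness\<close>

lemma cm_add:
  assumes "\<mu> \<in> complex_measures M" "\<nu> \<in> complex_measures M"
  shows "(\<lambda>A. \<mu> A + \<nu> A) \<in> complex_measures M"
  by (rule cmI) (simp_all add: cm_outside[OF assms(1)] cm_outside[OF assms(2)]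
      cm_empty[OF assms(1)] cm_empty[OF assms(2)] sums_add cm_sums[OF assms(1)] cm_sums[OF assms(2)])

lemma cm_diff:
  assumes "\<mu> \<in> complex_measures M" "\<nu> \<in> complex_measures M"
  shows "(\<lambda>A. \<mu> A - \<nu> A) \<in> complex_measures M"
  by (rule cmI) (simp_all add: cm_outside[OF assms(1)] cm_outside[OF assms(2)]
      cm_empty[OF assms(1)] cm_empty[OF assms(2)] sums_diff cm_sums[OF assms(1)] cm_sums[OF assms(2)])

lemma cm_scale:
  assumes "\<mu> \<in> complex_measures M"
  shows "(\<lambda>A. c * \<mu> A) \<in> complex_measures M"
  by (rule cmI) (simp_all add: cm_outside[OF assms] cm_empty[OF assms] sums_mult cm_sums[OF assms])

lemma cm_restrict:
  assumes \<mu>: "\<mu> \<in> complex_measures M" and A: "A \<in> sets M"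
  shows "(\<lambda>B. if B \<in> sets M then \<mu> (B \<inter> A) else 0) \<in> complex_measures M"
proof -
  have "(\<lambda>i. if B i \<in> sets M then \<mu> (B i \<inter> A) else 0) sums
      (if (\<Union>i. B i) \<in> sets M then \<mu> ((\<Union>i. B i) \<inter> A) else 0)"
    if B: "range B \<subseteq> sets M" "disjoint_family B" for B :: "nat \<Rightarrow> _"
  proof -
    have "(\<lambda>i. \<mu> (B i \<inter> A)) sums \<mu> (\<Union>i. B i \<inter> A)"
      using B A by (intro cm_sums[OF \<mu>]) (auto simp: disjoint_family_on_def)
    moreover have "(\<Union>i. B i \<inter> A) = (\<Union>i. B i) \<inter> A" by auto
    moreover have "B i \<in> sets M" for i using B by auto
    ultimately show ?thesis by (simp add: sets.countable_UN B)
  qed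
  then show ?thesis using cm_empty[OF \<mu>] by (intro cmI) auto
qed

lemma psum_triangle: "psum P (\<lambda>A. \<mu> A + \<nu> A) \<le> psum P \<mu> + psum P \<nu>"
  unfolding psum_def sum.distrib[symmetric] by (intro sum_mono norm_triangle_ineq)

lemma psum_triangle_diff: "psum P (\<lambda>A. \<mu> A - \<nu> A) \<le> psum P \<mu> + psum P \<nu>"
  unfolding psum_def sum.distrib[symmetric] by (intro sum_mono norm_triangle_ineq4)

lemma psum_diff_commute: "psum P (\<lambda>A. \<mu> A - \<nu> A) = psum P (\<lambda>A. \<nu> A - \<mu> A)"
  unfolding psum_def by (simp add: norm_minus_commute)

lemma cm_norm_triangle:
  assumes "\<mu> \<in> complex_measures M" "\<nu> \<in> complex_measures M"
  shows "cm_norm M (\<lambda>A. \<mu> A + \<nu> A) \<le> cm_norm M \<mu> + cm_norm M \<nu>"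
  by (intro cm_norm_le order_trans[OF psum_triangle] add_mono psum_le_norm assms)

lemma cm_norm_triangle_diff:
  assumes "\<mu> \<in> complex_measures M" "\<nu> \<in> complex_measures M"
  shows "cm_norm M (\<lambda>A. \<mu> A - \<nu> A) \<le> cm_norm M \<mu> + cm_norm M \<nu>"
  by (intro cm_norm_le order_trans[OF psum_triangle_diff] add_mono psum_le_norm assms)

lemma cm_norm_diff_commute: "cm_norm M (\<lambda>A. \<mu> A - \<nu> A) = cm_norm M (\<lambda>A. \<nu> A - \<mu> A)"
  unfolding cm_norm_def total_variation_psum by (simp only: psum_diff_commute[of _ \<mu> \<nu>])

lemma total_variation_eq_0_iff:
  assumes "\<mu> \<in> complex_measures M" "A \<in> sets M"
  shows "total_variation M \<mu> A = 0 \<longleftrightarrow> cm_null M \<mu> A"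
proof
  assume 0: "total_variation M \<mu> A = 0"
  show "cm_null M \<mu> A"
    unfolding cm_null_def
  proof (intro ballI impI)
    fix B assume B: "B \<in> sets M" "B \<subseteq> A"
    have "ennreal (psum {B} \<mu>) \<le> total_variation M \<mu> A"
      using B assms by (intro psum_le_total_variation) (auto simp: set_families_def)
    then show "\<mu> B = 0" using 0 by (simp add: psum_def)
  qed
next
  assume "cm_null M \<mu> A"
  then have "total_variation M \<mu> A \<le> 0"
  proof (intro total_variation_le)
    fix P assume "cm_null M \<mu> A" "P \<in> set_families M" "\<Union>P = A"
    then have "psum P \<mu> = 0"
      unfolding psum_def by (intro sum.neutral ballI) (auto simp: cm_null_def set_families_def)
    then show "ennreal (psum P \<mu>) \<le> 0" by simp
  qed
  then show "total_variation M \<mu> A = 0" by simp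
qed

lemma cm_null_subset: "cm_null M \<mu> A \<Longrightarrow> B \<subseteq> A \<Longrightarrow> cm_null M \<mu> B"
  by (auto simp: cm_null_def)

lemma cm_null_UN:
  assumes \<mu>: "\<mu> \<in> complex_measures M" and A: "\<And>i::nat. A i \<in> sets M" "\<And>i. cm_null M \<mu> (A i)"
  shows "cm_null M \<mu> (\<Union>i. A i)"
  unfolding cm_null_def
proof (intro ballI impI)
  fix B assume B: "B \<in> sets M" "B \<subseteq> (\<Union>i. A i)"
  have "(\<lambda>i. \<mu> (B \<inter> disjointed A i)) sums \<mu> (\<Union>i. B \<inter> disjointed A i)"
    using A B disjoint_family_disjointed[of A] sets.range_disjointed_sets[of A M]
    by (intro cm_sums[OF \<mu>]) (fastforce simp: disjoint_family_on_def)+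
  moreover have "(\<Union>i. B \<inter> disjointed A i) = B"
    using B UN_disjointed_eq[of A] by auto
  moreover have "\<mu> (B \<inter> disjointed A i) = 0" for i
  proof -
    have "disjointed A i \<in> sets M" using sets.range_disjointed_sets[of A M] A(1) by blast
    then have "B \<inter> disjointed A i \<in> sets M" using B by blast
    then show ?thesis using A(2)[of i] disjointed_subset[of A i] unfolding cm_null_def by blast
  qed
  ultimately show "\<mu> B = 0" by (simp add: sums_unique2[OF _ sums_zero])
qed

text \<open>The norm dominates every value, so the setwise limit is uniform over all sets.
  Uniformity lets countable additivity pass to the limit, and lower semicontinuity of
  \<open>psum\<close> upgrades setwise to norm convergence.\<close>

lemma cm_complete:
  assumes F: "\<And>n::nat. F n \<in> complex_measures M"
    and cauchy: "\<And>e. 0 < e \<Longrightarrow> \<exists>N. \<forall>m\<ge>N. \<forall>n\<ge>N. cm_norm M (\<lambda>A. F m A - F n A) \<le> e"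
  obtains \<nu> where "\<nu> \<in> complex_measures M" "(\<lambda>n. cm_norm M (\<lambda>A. F n A - \<nu> A)) \<longlonglongrightarrow> 0"
proof -
  have d: "cmod (F m A - F n A) \<le> cm_norm M (\<lambda>A. F m A - F n A)" for m n A
    by (rule cmod_le_norm[OF cm_diff[OF F F]])
  have "Cauchy (\<lambda>n. F n A)" for A
  proof (rule metric_CauchyI)
    fix e :: real assume "0 < e"
    then obtain N where N: "\<And>m n. N \<le> m \<Longrightarrow> N \<le> n \<Longrightarrow> cm_norm M (\<lambda>A. F m A - F n A) \<le> e / 2"
      using cauchy[of "e / 2"] by auto
    have "dist (F m A) (F n A) < e" if "N \<le> m" "N \<le> n" for m n
      using order_trans[OF d N[OF that], of A] \<open>0 < e\<close> by (simp add: dist_norm)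
    then show "\<exists>N. \<forall>m\<ge>N. \<forall>n\<ge>N. dist (F m A) (F n A) < e" by blast
  qed
  then have "\<forall>A. \<exists>l. (\<lambda>n. F n A) \<longlonglongrightarrow> l" using Cauchy_convergent_iff convergent_def by blast
  then obtain \<nu> where \<nu>: "\<And>A. (\<lambda>n. F n A) \<longlonglongrightarrow> \<nu> A" by metis
  have unif: "\<exists>N. \<forall>n\<ge>N. \<forall>A. cmod (F n A - \<nu> A) \<le> e" if e: "0 < e" for e
  proof -
    obtain N where N: "\<And>m n. N \<le> m \<Longrightarrow> N \<le> n \<Longrightarrow> cm_norm M (\<lambda>A. F n A - F m A) \<le> e"
      using cauchy[OF e] by auto
    have "cmod (F n A - \<nu> A) \<le> e" if n: "N \<le> n" for n A
    proof (rule LIMSEQ_le_const2)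
      show "(\<lambda>m. cmod (F n A - F m A)) \<longlonglongrightarrow> cmod (F n A - \<nu> A)" by (intro tendsto_intros \<nu>)
      show "\<exists>N. \<forall>m\<ge>N. cmod (F n A - F m A) \<le> e" using N n d order_trans by blast
    qed
    then show ?thesis by blast
  qed
  have un: "\<nu> A = 0" if "A \<notin> sets M" for A
    using \<nu>[of A] cm_outside[OF F that] by (simp add: LIMSEQ_const_iff)
  have em: "\<nu> {} = 0" using \<nu>[of "{}"] cm_empty[OF F] by (simp add: LIMSEQ_const_iff)
  have sums: "(\<lambda>i. \<nu> (A i)) sums \<nu> (\<Union>i. A i)" if A: "range A \<subseteq> sets M" "disjoint_family A" for A :: "nat \<Rightarrow> _"
    unfolding sums_def
  proof (rule metric_LIMSEQ_I)
    fix e :: real assume "0 < e"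
    then obtain n where n: "\<And>A. cmod (F n A - \<nu> A) \<le> e / 3" using unif[of "e / 3"] by auto
    have Am: "A i \<in> sets M" for i using A by auto
    have fin: "(\<Sum>i<k. \<nu> (A i)) = \<nu> (\<Union>i<k. A i)" for k
    proof (rule LIMSEQ_unique)
      show "(\<lambda>n. \<Sum>i<k. F n (A i)) \<longlonglongrightarrow> (\<Sum>i<k. \<nu> (A i))" by (intro tendsto_sum \<nu>)
      have "(\<Sum>i<k. F n (A i)) = F n (\<Union>i<k. A i)" for n
        using Am A(2) by (intro cm_UN_finite[OF F, symmetric]) (auto simp: disjoint_family_on_def)
      then show "(\<lambda>n. \<Sum>i<k. F n (A i)) \<longlonglongrightarrow> \<nu> (\<Union>i<k. A i)" using \<nu> by simp
    qed
    have "(\<lambda>k. \<Sum>i<k. F n (A i)) \<longlonglongrightarrow> F n (\<Union>i. A i)"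
      using cm_sums[OF F A] by (simp add: sums_def)
    then obtain K where K: "\<And>k. K \<le> k \<Longrightarrow> dist (\<Sum>i<k. F n (A i)) (F n (\<Union>i. A i)) < e / 3"
      using metric_LIMSEQ_D[of _ _ "e / 3"] \<open>0 < e\<close> by (metis divide_pos_pos zero_less_numeral)
    have "dist (\<Sum>i<k. \<nu> (A i)) (\<nu> (\<Union>i. A i)) < e" if "K \<le> k" for k
    proof -
      have "(\<Sum>i<k. F n (A i)) = F n (\<Union>i<k. A i)"
        using Am A(2) by (intro cm_UN_finite[OF F, symmetric]) (auto simp: disjoint_family_on_def)
      then have 1: "cmod (F n (\<Union>i<k. A i) - F n (\<Union>i. A i)) < e / 3" using K[OF that] by (simp add: dist_norm)
      have "\<nu> (\<Union>i<k. A i) - \<nu> (\<Union>i. A i) = (F n (\<Union>i<k. A i) - F n (\<Union>i. A i))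
        - (F n (\<Union>i<k. A i) - \<nu> (\<Union>i<k. A i)) + (F n (\<Union>i. A i) - \<nu> (\<Union>i. A i))" by simp
      also have "cmod \<dots> \<le> cmod (F n (\<Union>i<k. A i) - F n (\<Union>i. A i)) +
        cmod (F n (\<Union>i<k. A i) - \<nu> (\<Union>i<k. A i)) + cmod (F n (\<Union>i. A i) - \<nu> (\<Union>i. A i))"
        by (intro order_trans[OF norm_triangle_ineq] add_mono norm_triangle_ineq4 order_refl)
      also have "\<dots> < e / 3 + e / 3 + e / 3" using 1 n by (intro add_less_le_mono) auto
      finally show ?thesis unfolding fin dist_norm by simp
    qed
    then show "\<exists>K. \<forall>k\<ge>K. dist (\<Sum>i<k. \<nu> (A i)) (\<nu> (\<Union>i. A i)) < e" by blast
  qed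
  have cm: "\<nu> \<in> complex_measures M" by (rule cmI) (use un em sums in auto)
  have "(\<lambda>n. cm_norm M (\<lambda>A. F n A - \<nu> A)) \<longlonglongrightarrow> 0"
  proof (rule LIMSEQ_I)
    fix e :: real assume e: "0 < e"
    then obtain N where N: "\<And>m n. N \<le> m \<Longrightarrow> N \<le> n \<Longrightarrow> cm_norm M (\<lambda>A. F n A - F m A) \<le> e / 2"
      using cauchy[of "e / 2"] by auto
    have le: "cm_norm M (\<lambda>A. F n A - \<nu> A) \<le> e / 2" if n: "N \<le> n" for n
    proof (rule cm_norm_le)
      fix P assume P: "P \<in> set_families M"
      show "psum P (\<lambda>A. F n A - \<nu> A) \<le> e / 2"
      proof (rule LIMSEQ_le_const2)
        show "(\<lambda>m. psum P (\<lambda>A. F n A - F m A)) \<longlonglongrightarrow> psum P (\<lambda>A. F n A - \<nu> A)"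
          unfolding psum_def by (intro tendsto_intros \<nu>)
        show "\<exists>N. \<forall>m\<ge>N. psum P (\<lambda>A. F n A - F m A) \<le> e / 2"
          using N n psum_le_norm[OF cm_diff[OF F F] P] order_trans by blast
      qed
    qed
    have "norm (cm_norm M (\<lambda>A. F n A - \<nu> A) - 0) < e" if "N \<le> n" for n
      using le[OF that] cm_norm_nonneg[of M "\<lambda>A. F n A - \<nu> A"] e by simp
    then show "\<exists>N. \<forall>n\<ge>N. norm (cm_norm M (\<lambda>A. F n A - \<nu> A) - 0) < e" by blast
  qed
  then show ?thesis using that cm by blast
qed

lemma cm_eq_0_of_norm_0:
  assumes "\<mu> \<in> complex_measures M" "cm_norm M \<mu> = 0"
  shows "\<mu> A = 0"
  using cmod_le_norm[OF assms(1), of A] assms(2) by simp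

section \<open>Singularity and the norm\<close>

lemma cm_singular_iff:
  assumes "\<mu> \<in> complex_measures M" "\<sigma> \<in> complex_measures M"
  shows "cm_singular M \<mu> \<sigma> \<longleftrightarrow> (\<exists>A\<in>sets M. cm_null M \<sigma> A \<and> cm_null M \<mu> (space M - A))"
  unfolding cm_singular_def by (simp add: total_variation_eq_0_iff assms cong: bex_cong)

lemma psum_concentrated:
  assumes \<mu>: "\<mu> \<in> complex_measures M" and P: "P \<in> set_families M" and A: "A \<in> sets M"
    and null: "cm_null M \<mu> (space M - A)"
  shows "psum ((\<lambda>B. B \<inter> A) ` P) \<mu> = psum P \<mu>"
proof -
  have "psum ((\<lambda>B. B \<inter> A) ` P) \<mu> = (\<Sum>B\<in>P. cmod (\<mu> (B \<inter> A)))"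
    using P by (intro psum_image_Int cm_empty[OF \<mu>]) (auto simp: set_families_def)
  also have "\<dots> = psum P \<mu>"
    unfolding psum_def
  proof (rule sum.cong[OF refl])
    fix B assume "B \<in> P"
    then have B: "B \<in> sets M" using P by (auto simp: set_families_def)
    have "B - A \<subseteq> space M - A" using sets.sets_into_space[OF B] by blast
    then have "\<mu> (B - A) = 0" using null sets.Diff[OF B A] unfolding cm_null_def by blast
    then show "cmod (\<mu> (B \<inter> A)) = cmod (\<mu> B)" using cm_split[OF \<mu> B A] by simp
  qed
  finally show ?thesis .
qed

lemma psum_image_null:
  assumes \<mu>: "\<mu> \<in> complex_measures M" and P: "P \<in> set_families M" and A: "A \<in> sets M"
    and null: "cm_null M \<mu> A" and B: "B \<in> (\<lambda>B. B \<inter> A) ` P"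
  shows "\<mu> B = 0"
  using assms by (auto simp: cm_null_def set_families_def)

text \<open>Near-optimal partitions for \<mu> and \<sigma> are cut down to the two disjoint
  carriers. Together they form one disjoint family on which the sum sees only one measure at a time,
  so the phase \<open>c\<close> has no effect.\<close>

lemma norm_add_of_singular:
  assumes \<mu>: "\<mu> \<in> complex_measures M" and \<sigma>: "\<sigma> \<in> complex_measures M"
    and sing: "cm_singular M \<mu> \<sigma>" and c: "cmod c = 1"
  shows "cm_norm M (\<lambda>B. \<mu> B + c * \<sigma> B) = cm_norm M \<mu> + cm_norm M \<sigma>"
proof (rule antisym)
  let ?\<nu> = "\<lambda>B. \<mu> B + c * \<sigma> B"
  have \<nu>: "?\<nu> \<in> complex_measures M" by (intro cm_add cm_scale \<mu> \<sigma>)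
  have "psum P (\<lambda>B. c * \<sigma> B) = psum P \<sigma>" for P by (simp add: psum_def norm_mult c)
  then have "cm_norm M (\<lambda>B. c * \<sigma> B) = cm_norm M \<sigma>"
    unfolding cm_norm_def total_variation_psum by simp
  then show "cm_norm M ?\<nu> \<le> cm_norm M \<mu> + cm_norm M \<sigma>"
    using cm_norm_triangle[OF \<mu> cm_scale[OF \<sigma>, of c]] by simp
  obtain A where A: "A \<in> sets M" "cm_null M \<sigma> A" "cm_null M \<mu> (space M - A)"
    using sing cm_singular_iff[OF \<mu> \<sigma>] by auto
  have A': "space M - A \<in> sets M" using A(1) by auto
  have AA: "space M - (space M - A) = A" using sets.sets_into_space[OF A(1)] by blast
  show "cm_norm M \<mu> + cm_norm M \<sigma> \<le> cm_norm M ?\<nu>"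
  proof (rule field_le_epsilon)
    fix e :: real assume e: "0 < e"
    obtain P where P: "P \<in> partitions M (space M)" "cm_norm M \<mu> - e / 2 < psum P \<mu>"
      using cm_norm_approx[OF \<mu>, of "e / 2"] e by auto
    obtain Q where Q: "Q \<in> partitions M (space M)" "cm_norm M \<sigma> - e / 2 < psum Q \<sigma>"
      using cm_norm_approx[OF \<sigma>, of "e / 2"] e by auto
    note fP = partitions_subset_families[OF P(1)] and fQ = partitions_subset_families[OF Q(1)]
    let ?P = "(\<lambda>B. B \<inter> A) ` P" and ?Q = "(\<lambda>B. B \<inter> (space M - A)) ` Q"
    have fP': "?P \<in> set_families M" by (rule family_image_Int[OF fP A(1)])
    have fQ': "?Q \<in> set_families M" by (rule family_image_Int[OF fQ A'])
    have cross: "B \<inter> C = {}" if "B \<in> ?P" "C \<in> ?Q" for B C using that by auto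
    have fin: "finite ?P" "finite ?Q" using fP fQ by (auto simp: set_families_def)
    have "?P \<union> ?Q \<in> set_families M"
    proof -
      have "disjoint (?P \<union> ?Q)"
      proof (rule disjointI)
        fix X Y assume "X \<in> ?P \<union> ?Q" "Y \<in> ?P \<union> ?Q" "X \<noteq> Y"
        moreover have "disjoint ?P" "disjoint ?Q" using fP' fQ' by (auto simp: set_families_def)
        ultimately show "X \<inter> Y = {}"
          using cross[of X Y] cross[of Y X] disjointD[of ?P X Y] disjointD[of ?Q X Y]
          by (metis Int_commute UnE)
      qed
      then show ?thesis using fP' fQ' by (auto simp: set_families_def)
    qed
    then have "psum (?P \<union> ?Q) ?\<nu> \<le> cm_norm M ?\<nu>" by (rule psum_le_norm[OF \<nu>])
    moreover have "psum (?P \<union> ?Q) ?\<nu> = psum ?P ?\<nu> + psum ?Q ?\<nu>"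
      unfolding psum_def
    proof (rule sum.union_inter_neutral[OF fin])
      show "\<forall>B\<in>?P \<inter> ?Q. cmod (?\<nu> B) = 0"
      proof
        fix B assume "B \<in> ?P \<inter> ?Q"
        then have "B = {}" using cross[of B B] by blast
        then show "cmod (?\<nu> B) = 0" using cm_empty[OF \<nu>] by simp
      qed
    qed
    moreover have "psum ?P ?\<nu> = psum ?P \<mu>"
      unfolding psum_def using psum_image_null[OF \<sigma> fP A(1,2)] by (intro sum.cong refl) simp
    moreover have "psum ?Q ?\<nu> = psum ?Q \<sigma>"
      unfolding psum_def using psum_image_null[OF \<mu> fQ A' A(3)] c
      by (intro sum.cong refl) (simp add: norm_mult)
    moreover have "psum ?P \<mu> = psum P \<mu>" by (rule psum_concentrated[OF \<mu> fP A(1,3)])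
    moreover have "psum ?Q \<sigma> = psum Q \<sigma>"
      by (rule psum_concentrated[OF \<sigma> fQ A']) (simp only: AA A(2))
    ultimately show "cm_norm M \<mu> + cm_norm M \<sigma> \<le> cm_norm M ?\<nu> + e" using P(2) Q(2) by linarith
  qed
qed

text \<open>A quantitative form of the fact that \<open>a + b\<close> and \<open>a - b\<close> can
  both have modulus \<open>cmod a + cmod b\<close> only if one of the numbers is 0. By the
  parallelogram law the sum of the two moduli is at most
  \<open>2 * sqrt (x\<^sup>2 + y\<^sup>2)\<close>.\<close>

lemma min_le_parallelogram_defect:
  fixes a b :: complex
  shows "min (cmod a) (cmod b) \<le> 2 * cmod a + 2 * cmod b - cmod (a + b) - cmod (a - b)"
proof -
  define x y m where "x = cmod a" and "y = cmod b" and "m = min x y"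
  have nn: "0 \<le> x" "0 \<le> y" "0 \<le> m" "m \<le> x" "m \<le> y" by (auto simp: x_def y_def m_def)
  have par: "(cmod (a + b))\<^sup>2 + (cmod (a - b))\<^sup>2 = 2 * x\<^sup>2 + 2 * y\<^sup>2"
    unfolding x_def y_def by (simp only: cmod_power2) (simp add: power2_eq_square algebra_simps)
  have "(cmod (a + b) + cmod (a - b))\<^sup>2 \<le> 2 * ((cmod (a + b))\<^sup>2 + (cmod (a - b))\<^sup>2)"
    using zero_le_power2[of "cmod (a + b) - cmod (a - b)"] by (simp add: power2_eq_square algebra_simps)
  also have "\<dots> = 4 * (x\<^sup>2 + y\<^sup>2)" unfolding par by simp
  also have "\<dots> \<le> (2 * x + 2 * y - m)\<^sup>2"
  proof -
    have mx: "m * m \<le> x * y" using nn by (intro mult_mono) auto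
    have "m = x \<or> m = y" by (auto simp: m_def)
    then have "(2 * x + 2 * y - m)\<^sup>2 - 4 * (x\<^sup>2 + y\<^sup>2) = m * m + 8 * (x * y) - 4 * (x * m) - 4 * (y * m)"
      by (auto simp: power2_eq_square algebra_simps)
    moreover have "x * m \<le> x * y" "m * y \<le> x * y" using nn by (auto intro: mult_left_mono mult_right_mono)
    ultimately show ?thesis using zero_le_square[of m] unfolding mult.commute[of y m] by linarith
  qed
  finally have sq: "(cmod (a + b) + cmod (a - b))\<^sup>2 \<le> (2 * x + 2 * y - m)\<^sup>2" .
  have "0 \<le> 2 * x + 2 * y - m" using nn by linarith
  with sq have "cmod (a + b) + cmod (a - b) \<le> 2 * x + 2 * y - m" by (rule power2_le_imp_le)
  then have "m \<le> 2 * x + 2 * y - cmod (a + b) - cmod (a - b)" by linarith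
  then show ?thesis unfolding m_def x_def y_def .
qed

text \<open>Replacing the blocks in \<open>Q\<close> by the single set \<open>C\<close> gives
  another disjoint family, whose sum cannot exceed the norm. A near-optimal partition therefore
  leaves room for a gain of at most \<open>e\<close>.\<close>

lemma psum_gap:
  assumes \<mu>: "\<mu> \<in> complex_measures M" and P: "P \<in> partitions M (space M)"
    and near: "cm_norm M \<mu> - e \<le> psum P \<mu>" and Q: "Q \<subseteq> P" and C: "C \<in> sets M" "C \<subseteq> \<Union>Q"
  shows "cmod (\<mu> C) \<le> psum Q \<mu> + e"
proof -
  have fin: "finite P" "finite Q" using P Q finite_subset by auto
  have dP: "disjoint P" using P by auto
  have dj: "C \<inter> B = {}" if "B \<in> P - Q" for B
  proof -
    have "B \<inter> D = {}" if "D \<in> Q" for D using disjointD[OF dP, of B D] \<open>B \<in> P - Q\<close> that Q by auto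
    then show ?thesis using C(2) by blast
  qed
  have fam: "insert C (P - Q) \<in> set_families M"
  proof -
    have "disjoint (insert C (P - Q))"
    proof (rule disjointI)
      fix X Y assume "X \<in> insert C (P - Q)" "Y \<in> insert C (P - Q)" "X \<noteq> Y"
      then show "X \<inter> Y = {}" using dj[of X] dj[of Y] disjointD[OF dP, of X Y] by (metis DiffD1 Int_commute insertE)
    qed
    then show ?thesis using P C(1) by (auto simp: set_families_def)
  qed
  have "psum (insert C (P - Q)) \<mu> = cmod (\<mu> C) + psum (P - Q) \<mu>"
  proof (cases "C \<in> P - Q")
    case True
    then have "C = {}" using dj[OF True] by blast
    then show ?thesis using True cm_empty[OF \<mu>] by (simp add: insert_absorb)
  next
    case False
    then show ?thesis using fin by (simp add: psum_def)
  qed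
  then have "cmod (\<mu> C) + psum (P - Q) \<mu> \<le> cm_norm M \<mu>" using psum_le_norm[OF \<mu> fam] by simp
  moreover have "psum P \<mu> = psum (P - Q) \<mu> + psum Q \<mu>"
    unfolding psum_def using fin Q by (intro sum.subset_diff) auto
  ultimately show ?thesis using near by linarith
qed

text \<open>On a partition nearly optimal for \<mu>, \<sigma>, their sum and their difference, the
  parallelogram defects of the blocks add up to at most \<open>2 * e\<close>. The set
  \<open>E\<close> collects the blocks where \<mu> is the smaller one; \<open>psum_gap\<close> adds
  the third \<open>e\<close>.\<close>

lemma almost_separated:
  assumes \<mu>: "\<mu> \<in> complex_measures M" and \<sigma>: "\<sigma> \<in> complex_measures M" and e: "0 < e"
    and plus: "cm_norm M (\<lambda>B. \<mu> B + \<sigma> B) = cm_norm M \<mu> + cm_norm M \<sigma>"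
    and minus: "cm_norm M (\<lambda>B. \<mu> B - \<sigma> B) = cm_norm M \<mu> + cm_norm M \<sigma>"
  shows "\<exists>E. E \<in> sets M \<and> (\<forall>C\<in>sets M. C \<subseteq> E \<longrightarrow> cmod (\<mu> C) \<le> 3 * e) \<and>
    (\<forall>C\<in>sets M. C \<subseteq> space M - E \<longrightarrow> cmod (\<sigma> C) \<le> 3 * e)"
proof -
  let ?p = "\<lambda>B. \<mu> B + \<sigma> B" and ?m = "\<lambda>B. \<mu> B - \<sigma> B"
  have "\<exists>P\<in>partitions M (space M). \<forall>\<rho>\<in>{\<mu>, \<sigma>, ?p, ?m}. cm_norm M \<rho> - e < psum P \<rho>"
    using \<mu> \<sigma> cm_add[OF \<mu> \<sigma>] cm_diff[OF \<mu> \<sigma>] e by (intro cm_norm_approx_finite) auto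
  then obtain P where P: "P \<in> partitions M (space M)"
    and near: "cm_norm M \<mu> - e < psum P \<mu>" "cm_norm M \<sigma> - e < psum P \<sigma>"
      "cm_norm M ?p - e < psum P ?p" "cm_norm M ?m - e < psum P ?m" by auto
  have fin: "finite P" using P by simp
  have le: "psum P \<mu> \<le> cm_norm M \<mu>" "psum P \<sigma> \<le> cm_norm M \<sigma>"
    by (intro psum_le_norm \<mu> \<sigma> partitions_subset_families[OF P])+
  have "(\<Sum>B\<in>P. min (cmod (\<mu> B)) (cmod (\<sigma> B))) \<le>
     (\<Sum>B\<in>P. 2 * cmod (\<mu> B) + 2 * cmod (\<sigma> B) - cmod (\<mu> B + \<sigma> B) - cmod (\<mu> B - \<sigma> B))"
    by (intro sum_mono min_le_parallelogram_defect)
  also have "\<dots> = 2 * psum P \<mu> + 2 * psum P \<sigma> - psum P ?p - psum P ?m"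
    unfolding psum_def by (simp add: sum_subtractf sum.distrib sum_distrib_left)
  also have "\<dots> \<le> 2 * e" using near le plus minus by linarith
  finally have min: "(\<Sum>B\<in>P. min (cmod (\<mu> B)) (cmod (\<sigma> B))) \<le> 2 * e" .
  define Q where "Q = {B\<in>P. cmod (\<mu> B) \<le> cmod (\<sigma> B)}"
  have QP: "Q \<subseteq> P" "P - Q \<subseteq> P" by (auto simp: Q_def)
  have "psum Q \<mu> = (\<Sum>B\<in>Q. min (cmod (\<mu> B)) (cmod (\<sigma> B)))"
    unfolding psum_def by (intro sum.cong) (auto simp: Q_def)
  also have "\<dots> \<le> (\<Sum>B\<in>P. min (cmod (\<mu> B)) (cmod (\<sigma> B)))"
    using fin QP by (intro sum_mono2) auto
  finally have Q\<mu>: "psum Q \<mu> \<le> 2 * e" using min by simp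
  have "psum (P - Q) \<sigma> = (\<Sum>B\<in>P - Q. min (cmod (\<mu> B)) (cmod (\<sigma> B)))"
    unfolding psum_def by (intro sum.cong) (auto simp: Q_def)
  also have "\<dots> \<le> (\<Sum>B\<in>P. min (cmod (\<mu> B)) (cmod (\<sigma> B)))"
    using fin QP by (intro sum_mono2) auto
  finally have Q\<sigma>: "psum (P - Q) \<sigma> \<le> 2 * e" using min by simp
  show ?thesis
  proof (intro exI[of _ "\<Union>Q"] conjI ballI impI)
    show "\<Union>Q \<in> sets M" using P QP fin finite_subset by (intro sets.finite_Union) auto
    show "cmod (\<mu> C) \<le> 3 * e" if "C \<in> sets M" "C \<subseteq> \<Union>Q" for C
      using psum_gap[OF \<mu> P less_imp_le[OF near(1)] QP(1) that] Q\<mu> by linarith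
    show "cmod (\<sigma> C) \<le> 3 * e" if C: "C \<in> sets M" "C \<subseteq> space M - \<Union>Q" for C
    proof -
      have "C \<subseteq> \<Union>(P - Q)" using C P by blast
      then show ?thesis
        using psum_gap[OF \<sigma> P less_imp_le[OF near(2)] QP(2) C(1)] Q\<sigma> by linarith
    qed
  qed
qed

text \<open>
  Together with \<open>norm_add_of_singular\<close> this expresses singularity through the norm alone, so linear
  isometries preserve it.
\<close>

lemma singular_of_norm_add:
  assumes \<mu>: "\<mu> \<in> complex_measures M" and \<sigma>: "\<sigma> \<in> complex_measures M"
    and plus: "cm_norm M (\<lambda>B. \<mu> B + \<sigma> B) = cm_norm M \<mu> + cm_norm M \<sigma>"
    and minus: "cm_norm M (\<lambda>B. \<mu> B - \<sigma> B) = cm_norm M \<mu> + cm_norm M \<sigma>"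
  shows "cm_singular M \<mu> \<sigma>"
proof -
  have "\<exists>E. E \<in> sets M \<and> (\<forall>C\<in>sets M. C \<subseteq> E \<longrightarrow> cmod (\<mu> C) \<le> 3 * (1/2)^n) \<and>
     (\<forall>C\<in>sets M. C \<subseteq> space M - E \<longrightarrow> cmod (\<sigma> C) \<le> 3 * (1/2)^n)" for n :: nat
  proof -
    have pos: "(0::real) < (1/2)^n" by simp
    show ?thesis by (rule almost_separated[OF \<mu> \<sigma> pos plus minus])
  qed
  then have "\<exists>E. \<forall>n::nat. E n \<in> sets M \<and> (\<forall>C\<in>sets M. C \<subseteq> E n \<longrightarrow> cmod (\<mu> C) \<le> 3 * (1/2)^n) \<and>
     (\<forall>C\<in>sets M. C \<subseteq> space M - E n \<longrightarrow> cmod (\<sigma> C) \<le> 3 * (1/2)^n)" by (intro choice allI)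
  then obtain E where E0: "\<And>n::nat. E n \<in> sets M \<and> (\<forall>C\<in>sets M. C \<subseteq> E n \<longrightarrow> cmod (\<mu> C) \<le> 3 * (1/2)^n) \<and>
     (\<forall>C\<in>sets M. C \<subseteq> space M - E n \<longrightarrow> cmod (\<sigma> C) \<le> 3 * (1/2)^n)" by auto
  have E: "E n \<in> sets M" for n using E0[of n] by simp
  have E\<mu>: "cmod (\<mu> C) \<le> 3 * (1/2)^n" if "C \<in> sets M" "C \<subseteq> E n" for C n
    using E0[of n] that by blast
  have E\<sigma>: "cmod (\<sigma> C) \<le> 3 * (1/2)^n" if "C \<in> sets M" "C \<subseteq> space M - E n" for C n
    using E0[of n] that by blast
  \<comment> \<open>\<open>N\<close> is the limit superior of the complements of the
    \<open>E n\<close>. As in Borel-Cantelli, summability of the bounds makes it null for \<sigma>,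
    while a set avoiding some \<open>U n\<close> lies in all \<open>E (n + k)\<close> and is null
    for \<mu>.\<close>
  define U where "U n = (\<Union>k. space M - E (n + k))" for n
  define N where "N = (\<Inter>n. U n)"
  have U: "U n \<in> sets M" for n unfolding U_def using E by auto
  have N: "N \<in> sets M" unfolding N_def using U by auto
  have p0: "(\<lambda>n. c * (1/2)^n) \<longlonglongrightarrow> 0" for c :: real
    using tendsto_mult[OF tendsto_const LIMSEQ_power_zero[of "1/2::real"]] by simp
  have "cm_null M \<sigma> N"
    unfolding cm_null_def
  proof (intro ballI impI)
    fix C assume C: "C \<in> sets M" "C \<subseteq> N"
    have "cmod (\<sigma> C) \<le> 6 * (1/2)^n" for n
    proof -
      let ?D = "disjointed (\<lambda>k. space M - E (n + k))"
      have D: "?D k \<in> sets M" for k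
        using sets.range_disjointed_sets[of "\<lambda>k. space M - E (n + k)" M] E by blast
      have "(\<lambda>k. \<sigma> (C \<inter> ?D k)) sums \<sigma> (\<Union>k. C \<inter> ?D k)"
      proof (rule cm_sums[OF \<sigma>])
        show "range (\<lambda>k. C \<inter> ?D k) \<subseteq> sets M" using C D by blast
        show "disjoint_family (\<lambda>k. C \<inter> ?D k)"
          using disjoint_family_disjointed[of "\<lambda>k. space M - E (n + k)"] unfolding disjoint_family_on_def by blast
      qed
      moreover have "(\<Union>k. C \<inter> ?D k) = C"
      proof -
        have "C \<subseteq> U n" using C(2) by (auto simp: N_def)
        moreover have "(\<Union>k. ?D k) = U n" unfolding U_def by (rule UN_disjointed_eq)
        ultimately show ?thesis by blast
      qed
      ultimately have s: "(\<lambda>k. \<sigma> (C \<inter> ?D k)) sums \<sigma> C" by simp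
      have b: "cmod (\<sigma> (C \<inter> ?D k)) \<le> 3 * (1/2)^n * (1/2)^k" for k
      proof -
        have "C \<inter> ?D k \<subseteq> space M - E (n + k)"
          using disjointed_subset[of "\<lambda>k. space M - E (n + k)" k] by blast
        then have "cmod (\<sigma> (C \<inter> ?D k)) \<le> 3 * (1/2)^(n + k)" using C D by (intro E\<sigma>) auto
        then show ?thesis by (simp only: power_add mult.assoc)
      qed
      have g: "(\<lambda>k. 3 * (1/2)^n * (1/2)^k) sums (3 * (1/2)^n * (1 / (1 - 1/2::real)))"
        by (intro sums_mult geometric_sums) simp
      have "cmod (\<sigma> C) \<le> (\<Sum>k. 3 * (1/2)^n * (1/2)^k)"
        unfolding sums_unique[OF s] by (rule norm_suminf_le[OF b]) (rule sums_summable[OF g])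
      also have "\<dots> = 6 * (1/2)^n" using sums_unique[OF g] by simp
      finally show ?thesis .
    qed
    then have "cmod (\<sigma> C) \<le> 0" using LIMSEQ_le_const[OF p0] by blast
    then show "\<sigma> C = 0" by simp
  qed
  moreover have "cm_null M \<mu> (space M - N)"
  proof -
    have "cm_null M \<mu> (\<Union>n. space M - U n)"
    proof (rule cm_null_UN[OF \<mu>])
      show "space M - U n \<in> sets M" for n using U by auto
      show "cm_null M \<mu> (space M - U n)" for n
        unfolding cm_null_def
      proof (intro ballI impI)
        fix C assume C: "C \<in> sets M" "C \<subseteq> space M - U n"
        have "cmod (\<mu> C) \<le> 3 * (1/2)^n * (1/2)^k" for k
        proof -
          have "C \<subseteq> E (n + k)" using C(2) unfolding U_def by blast
          then have "cmod (\<mu> C) \<le> 3 * (1/2)^(n + k)" by (rule E\<mu>[OF C(1)])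
          then show ?thesis by (simp only: power_add mult.assoc)
        qed
        then have "cmod (\<mu> C) \<le> 0" using LIMSEQ_le_const[OF p0] by blast
        then show "\<mu> C = 0" by simp
      qed
    qed
    moreover have "space M - N = (\<Union>n. space M - U n)" unfolding N_def by blast
    ultimately show ?thesis by simp
  qed
  ultimately show ?thesis using N cm_singular_iff[OF \<mu> \<sigma>] by blast
qed

section \<open>Integration and densities\<close>

lemma jordan_pos_cong:
  assumes "\<And>A. A \<in> sets M \<Longrightarrow> \<nu> A = \<nu>' A"
  shows "jordan_pos M \<nu> = jordan_pos M \<nu>'"
proof -
  have "(SUP B\<in>{B \<in> sets M. B \<subseteq> A}. ennreal (\<nu> B)) = (SUP B\<in>{B \<in> sets M. B \<subseteq> A}. ennreal (\<nu>' B))" for A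
    by (intro SUP_cong) (auto simp: assms)
  then show ?thesis by (simp add: jordan_pos_def)
qed

text \<open>Only an inequality, since \<open>ennreal\<close> truncates negative terms to 0.\<close>

lemma ennreal_sum_le: "ennreal (\<Sum>i\<in>I. x i) \<le> (\<Sum>i\<in>I. ennreal (x i))"
proof -
  have "ennreal (\<Sum>i\<in>I. x i) \<le> ennreal (\<Sum>i\<in>I. max 0 (x i))"
    by (intro ennreal_leI sum_mono) auto
  also have "\<dots> = (\<Sum>i\<in>I. ennreal (max 0 (x i)))" by (rule sum_ennreal[symmetric]) auto
  also have "\<dots> = (\<Sum>i\<in>I. ennreal (x i))"
  proof -
    have "ennreal (max 0 a) = ennreal a" for a
      by (cases "0 \<le> a") (simp_all add: ennreal_neg max_def)
    then show ?thesis by simp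
  qed
  finally show ?thesis .
qed

lemma ennreal_le_suminf:
  assumes "x sums s"
  shows "ennreal s \<le> (\<Sum>i. ennreal (x i))"
proof (rule LIMSEQ_le_const2)
  show "(\<lambda>n. ennreal (\<Sum>i<n. x i)) \<longlonglongrightarrow> ennreal s"
    using assms by (intro tendsto_ennrealI) (simp add: sums_def)
  show "\<exists>N. \<forall>n\<ge>N. ennreal (\<Sum>i<n. x i) \<le> (\<Sum>i. ennreal (x i))"
    by (intro exI allI impI order_trans[OF ennreal_sum_le] sum_le_suminf) auto
qed

context
  fixes M :: "'a measure" and \<mu> :: "'a set \<Rightarrow> complex"
  assumes \<mu>: "\<mu> \<in> complex_measures M"
begin

text \<open>The set function inside \<open>jordan_pos\<close> for the real part. The other three
  Jordan parts are obtained from it by multiplying \<mu> with -1, \<open>- \<i>\<close> and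
  \<open>\<i>\<close>.\<close>

definition "sup_Re A = (SUP B\<in>{B \<in> sets M. B \<subseteq> A}. ennreal (Re (\<mu> B)))"

lemma sup_Re_upper: "B \<in> sets M \<Longrightarrow> B \<subseteq> A \<Longrightarrow> ennreal (Re (\<mu> B)) \<le> sup_Re A"
  unfolding sup_Re_def by (rule SUP_upper) auto

lemma sup_Re_least: "(\<And>B. B \<in> sets M \<Longrightarrow> B \<subseteq> A \<Longrightarrow> ennreal (Re (\<mu> B)) \<le> c) \<Longrightarrow> sup_Re A \<le> c"
  unfolding sup_Re_def by (rule SUP_least) auto

lemma sup_Re_superadditive:
  assumes "A \<inter> B = {}"
  shows "sup_Re A + sup_Re B \<le> sup_Re (A \<union> B)"
proof -
  have ne: "{C \<in> sets M. C \<subseteq> A} \<noteq> {}" "{C \<in> sets M. C \<subseteq> B} \<noteq> {}" by auto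
  have le: "ennreal (Re (\<mu> C)) + ennreal (Re (\<mu> D)) \<le> sup_Re (A \<union> B)"
    if C: "C \<in> sets M" "C \<subseteq> A" and D: "D \<in> sets M" "D \<subseteq> B" for C D
  proof -
    \<comment> \<open>A negative value is truncated to 0, so the corresponding set is dropped and
      not joined to the other.\<close>
    consider "Re (\<mu> C) \<le> 0" | "Re (\<mu> D) \<le> 0" | "0 \<le> Re (\<mu> C)" "0 \<le> Re (\<mu> D)" by linarith
    then show ?thesis
    proof cases
      case 1
      then show ?thesis using sup_Re_upper[of D "A \<union> B"] D by (auto simp: ennreal_neg)
    next
      case 2
      then show ?thesis using sup_Re_upper[of C "A \<union> B"] C by (auto simp: ennreal_neg)
    next
      case 3
      have "C \<inter> D = {}" using C D assms by blast
      then have "Re (\<mu> (C \<union> D)) = Re (\<mu> C) + Re (\<mu> D)" using cm_Un[OF \<mu> C(1) D(1)] by simp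
      then have "ennreal (Re (\<mu> C)) + ennreal (Re (\<mu> D)) = ennreal (Re (\<mu> (C \<union> D)))"
        using 3 by simp
      also have "\<dots> \<le> sup_Re (A \<union> B)" using C D by (intro sup_Re_upper) auto
      finally show ?thesis .
    qed
  qed
  have "sup_Re A + sup_Re B = (SUP C\<in>{C \<in> sets M. C \<subseteq> A}. ennreal (Re (\<mu> C)) + sup_Re B)"
    unfolding sup_Re_def[of A] by (rule ennreal_SUP_add_left[OF ne(1), symmetric])
  also have "\<dots> \<le> sup_Re (A \<union> B)"
  proof (rule SUP_least)
    fix C assume C: "C \<in> {C \<in> sets M. C \<subseteq> A}"
    have "ennreal (Re (\<mu> C)) + sup_Re B = (SUP D\<in>{D \<in> sets M. D \<subseteq> B}. ennreal (Re (\<mu> C)) + ennreal (Re (\<mu> D)))"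
      unfolding sup_Re_def[of B] by (subst (1 2) add.commute) (rule ennreal_SUP_add_left[OF ne(2), symmetric])
    also have "\<dots> \<le> sup_Re (A \<union> B)" using C le by (intro SUP_least) auto
    finally show "ennreal (Re (\<mu> C)) + sup_Re B \<le> sup_Re (A \<union> B)" .
  qed
  finally show ?thesis .
qed

lemma sup_Re_mono: "A \<subseteq> B \<Longrightarrow> sup_Re A \<le> sup_Re B"
  by (intro sup_Re_least sup_Re_upper) auto

text \<open>One direction is superadditivity on finite unions; for the other, a set \<open>B\<close>
  is cut along the \<open>A i\<close> and the truncated pieces can only add up to more.\<close>

lemma sup_Re_countably_additive: "countably_additive (sets M) sup_Re"
proof (rule countably_additiveI)
  fix A :: "nat \<Rightarrow> 'a set"
  assume A: "range A \<subseteq> sets M" "disjoint_family A" "(\<Union>i. A i) \<in> sets M"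
  show "(\<Sum>i. sup_Re (A i)) = sup_Re (\<Union>i. A i)"
  proof (rule antisym)
    have fin: "(\<Sum>i<n. sup_Re (A i)) \<le> sup_Re (\<Union>i<n. A i)" for n
    proof (induction n)
      case (Suc n)
      have "(\<Sum>i<Suc n. sup_Re (A i)) \<le> sup_Re (\<Union>i<n. A i) + sup_Re (A n)"
        using Suc by (simp add: add_right_mono)
      also have "\<dots> \<le> sup_Re ((\<Union>i<n. A i) \<union> A n)"
      proof (intro sup_Re_superadditive)
        have "A i \<inter> A n = {}" if "i < n" for i using A(2) that by (auto simp: disjoint_family_on_def)
        then show "(\<Union>i<n. A i) \<inter> A n = {}" by blast
      qed
      also have "(\<Union>i<n. A i) \<union> A n = (\<Union>i<Suc n. A i)" by (simp add: lessThan_Suc Un_commute)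
      finally show ?case .
    qed simp
    show "(\<Sum>i. sup_Re (A i)) \<le> sup_Re (\<Union>i. A i)"
      unfolding suminf_eq_SUP by (intro SUP_least order_trans[OF fin] sup_Re_mono) auto
    show "sup_Re (\<Union>i. A i) \<le> (\<Sum>i. sup_Re (A i))"
    proof (rule sup_Re_least)
      fix B assume B: "B \<in> sets M" "B \<subseteq> (\<Union>i. A i)"
      have "(\<lambda>i. \<mu> (B \<inter> A i)) sums \<mu> (\<Union>i. B \<inter> A i)"
        using A B by (intro cm_sums[OF \<mu>]) (auto simp: disjoint_family_on_def)
      moreover have "(\<Union>i. B \<inter> A i) = B" using B by auto
      ultimately have "(\<lambda>i. Re (\<mu> (B \<inter> A i))) sums Re (\<mu> B)" using sums_Re by fastforce
      then have "ennreal (Re (\<mu> B)) \<le> (\<Sum>i. ennreal (Re (\<mu> (B \<inter> A i))))" by (rule ennreal_le_suminf)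
      also have "\<dots> \<le> (\<Sum>i. sup_Re (A i))"
        using A B by (intro suminf_le sup_Re_upper) auto
      finally show "ennreal (Re (\<mu> B)) \<le> (\<Sum>i. sup_Re (A i))" .
    qed
  qed
qed

lemma jordan_pos_Re:
  shows sets_jordan_pos_Re: "sets (jordan_pos M (\<lambda>A. Re (\<mu> A))) = sets M"
    and emeasure_jordan_pos_Re: "A \<in> sets M \<Longrightarrow> emeasure (jordan_pos M (\<lambda>A. Re (\<mu> A))) A = sup_Re A"
proof -
  show "sets (jordan_pos M (\<lambda>A. Re (\<mu> A))) = sets M" by (simp add: jordan_pos_def)
  assume "A \<in> sets M"
  moreover have "positive (sets M) sup_Re"
  proof -
    have "sup_Re {} \<le> 0" by (rule sup_Re_least) (simp add: cm_empty[OF \<mu>])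
    then show ?thesis by (simp add: positive_def)
  qed
  ultimately show "emeasure (jordan_pos M (\<lambda>A. Re (\<mu> A))) A = sup_Re A"
    using sup_Re_countably_additive
    by (intro emeasure_measure_of[where \<Omega> = "space M" and A = "sets M"])
      (auto simp: jordan_pos_def sup_Re_def[abs_def] sets.space_closed)
qed

lemma finite_measure_jordan_pos_Re: "finite_measure (jordan_pos M (\<lambda>A. Re (\<mu> A)))"
proof
  obtain K where K: "\<And>A. cmod (\<mu> A) \<le> K" using cm_bounded[OF \<mu>] by auto
  have sp: "space (jordan_pos M (\<lambda>A. Re (\<mu> A))) = space M"
    by (rule sets_eq_imp_space_eq[OF sets_jordan_pos_Re])
  have "sup_Re (space M) \<le> ennreal K"
    by (intro sup_Re_least ennreal_leI order_trans[OF complex_Re_le_cmod] K)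
  then have "emeasure (jordan_pos M (\<lambda>A. Re (\<mu> A))) (space M) < \<infinity>"
    using emeasure_jordan_pos_Re[of "space M"] by (auto intro: le_less_trans)
  then show "emeasure (jordan_pos M (\<lambda>A. Re (\<mu> A))) (space (jordan_pos M (\<lambda>A. Re (\<mu> A)))) \<noteq> \<infinity>"
    unfolding sp by simp
qed

lemma measure_jordan_pos_Re_upper:
  assumes "A \<in> sets M" "B \<in> sets M" "B \<subseteq> A"
  shows "Re (\<mu> B) \<le> measure (jordan_pos M (\<lambda>A. Re (\<mu> A))) A"
proof -
  interpret J: finite_measure "jordan_pos M (\<lambda>A. Re (\<mu> A))" by (rule finite_measure_jordan_pos_Re)
  have "ennreal (Re (\<mu> B)) \<le> ennreal (measure (jordan_pos M (\<lambda>A. Re (\<mu> A))) A)"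
    using sup_Re_upper[OF assms(2,3)] emeasure_jordan_pos_Re[OF assms(1)] J.emeasure_eq_measure by simp
  then show ?thesis by (simp add: ennreal_le_iff2) (metis measure_nonneg order_trans)
qed

lemma measure_jordan_pos_Re_least:
  assumes "A \<in> sets M" "\<And>B. B \<in> sets M \<Longrightarrow> B \<subseteq> A \<Longrightarrow> Re (\<mu> B) \<le> c"
  shows "measure (jordan_pos M (\<lambda>A. Re (\<mu> A))) A \<le> c"
proof -
  interpret J: finite_measure "jordan_pos M (\<lambda>A. Re (\<mu> A))" by (rule finite_measure_jordan_pos_Re)
  have "0 \<le> c" using assms(2)[of "{}"] cm_empty[OF \<mu>] by simp
  have "sup_Re A \<le> ennreal c" by (intro sup_Re_least ennreal_leI assms(2))
  then show ?thesis
    using \<open>0 \<le> c\<close> unfolding emeasure_jordan_pos_Re[OF assms(1), symmetric] J.emeasure_eq_measure by simp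
qed

end

text \<open>Passing from \<open>B\<close> to \<open>A - B\<close> turns values of the real part into
  its negative, shifted by the constant \<open>Re (\<mu> A)\<close>. The two suprema therefore
  differ by exactly this constant.\<close>

lemma jordan_decomposition_Re:
  assumes \<mu>: "\<mu> \<in> complex_measures M" and A: "A \<in> sets M"
  shows "measure (jordan_pos M (\<lambda>A. Re (\<mu> A))) A - measure (jordan_pos M (\<lambda>A. - Re (\<mu> A))) A = Re (\<mu> A)"
proof -
  have \<mu>': "(\<lambda>A. - 1 * \<mu> A) \<in> complex_measures M" by (rule cm_scale[OF \<mu>])
  have eq: "(\<lambda>A. - Re (\<mu> A)) = (\<lambda>A. Re (- 1 * \<mu> A))" by simp
  let ?p = "measure (jordan_pos M (\<lambda>A. Re (\<mu> A))) A" and ?q = "measure (jordan_pos M (\<lambda>A. Re (- 1 * \<mu> A))) A"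
  have "?p \<le> Re (\<mu> A) + ?q"
  proof (rule measure_jordan_pos_Re_least[OF \<mu> A])
    fix B assume B: "B \<in> sets M" "B \<subseteq> A"
    then have "Re (- 1 * \<mu> (A - B)) \<le> ?q" by (intro measure_jordan_pos_Re_upper[OF \<mu>' A]) (use A in auto)
    then show "Re (\<mu> B) \<le> Re (\<mu> A) + ?q" using cm_Diff[OF \<mu> A B] by simp
  qed
  moreover have "?q \<le> - Re (\<mu> A) + ?p"
  proof (rule measure_jordan_pos_Re_least[OF \<mu>' A])
    fix B assume B: "B \<in> sets M" "B \<subseteq> A"
    then have "Re (\<mu> (A - B)) \<le> ?p" by (intro measure_jordan_pos_Re_upper[OF \<mu> A]) (use A in auto)
    then show "Re (- 1 * \<mu> B) \<le> - Re (\<mu> A) + ?p" using cm_Diff[OF \<mu> A B] by simp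
  qed
  ultimately show ?thesis unfolding eq by simp
qed

lemma jordan_decomposition_Im:
  assumes \<mu>: "\<mu> \<in> complex_measures M" and A: "A \<in> sets M"
  shows "measure (jordan_pos M (\<lambda>A. Im (\<mu> A))) A - measure (jordan_pos M (\<lambda>A. - Im (\<mu> A))) A = Im (\<mu> A)"
  using jordan_decomposition_Re[OF cm_scale[OF \<mu>, of "-\<i>"] A] by simp

lemma jordan_parts:
  assumes \<mu>: "\<mu> \<in> complex_measures M"
    and N: "N \<in> {jordan_pos M (\<lambda>A. Re (\<mu> A)), jordan_pos M (\<lambda>A. - Re (\<mu> A)),
      jordan_pos M (\<lambda>A. Im (\<mu> A)), jordan_pos M (\<lambda>A. - Im (\<mu> A))}"
  shows "finite_measure N" "sets N = sets M"
  using N finite_measure_jordan_pos_Re[OF \<mu>] finite_measure_jordan_pos_Re[OF cm_scale[OF \<mu>, of "-1"]]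
    finite_measure_jordan_pos_Re[OF cm_scale[OF \<mu>, of "-\<i>"]] finite_measure_jordan_pos_Re[OF cm_scale[OF \<mu>, of "\<i>"]]
    sets_jordan_pos_Re[OF \<mu>] sets_jordan_pos_Re[OF cm_scale[OF \<mu>, of "-1"]]
    sets_jordan_pos_Re[OF cm_scale[OF \<mu>, of "-\<i>"]] sets_jordan_pos_Re[OF cm_scale[OF \<mu>, of "\<i>"]]
  by auto

section \<open>Integrals of bounded functions against complex measures\<close>

lemma integral_simple_finite:
  fixes s :: "'a \<Rightarrow> complex"
  assumes "finite_measure N" "sets N = sets M" "simple_function M s"
  shows "integral\<^sup>L N s = (\<Sum>y\<in>s ` space M. of_real (measure N {x\<in>space M. s x = y}) * y)"
proof -
  interpret finite_measure N by fact
  have sp: "space N = space M" by (rule sets_eq_imp_space_eq[OF assms(2)])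
  have fin: "finite (s ` space M)" by (rule simple_functionD(1)[OF assms(3)])
  have A: "{x\<in>space M. s x = y} \<in> sets N" for y
  proof -
    have "{x\<in>space M. s x = y} = s -` {y} \<inter> space M" by auto
    then show ?thesis using simple_functionD(2)[OF assms(3)] assms(2) by simp
  qed
  have "integral\<^sup>L N s = (LINT x|N. (\<Sum>y\<in>s ` space M. indicat_real {x\<in>space M. s x = y} x *\<^sub>R y))"
  proof (rule Bochner_Integration.integral_cong[OF refl])
    fix x assume "x \<in> space N"
    then have x: "x \<in> space M" by (simp add: sp)
    have "(\<Sum>y\<in>s ` space M. indicat_real {x\<in>space M. s x = y} x *\<^sub>R y) = (\<Sum>y\<in>s ` space M. if s x = y then y else 0)"
      using x by (intro sum.cong) auto
    then show "s x = (\<Sum>y\<in>s ` space M. indicat_real {x\<in>space M. s x = y} x *\<^sub>R y)"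
      using x fin by simp
  qed
  also have "\<dots> = (\<Sum>y\<in>s ` space M. (LINT x|N. indicat_real {x\<in>space M. s x = y} x *\<^sub>R y))"
    using A by (intro Bochner_Integration.integral_sum integrable_scaleR_left integrable_real_indicator)
      (auto simp: emeasure_eq_measure)
  also have "\<dots> = (\<Sum>y\<in>s ` space M. of_real (measure N {x\<in>space M. s x = y}) * y)"
    using A sets.sets_into_space[OF A] by (intro sum.cong refl) (simp add: scaleR_conv_of_real Int_absorb2)
  finally show ?thesis .
qed

lemma cm_integral_simple:
  assumes \<mu>: "\<mu> \<in> complex_measures M" and s: "simple_function M s"
  shows "cm_integral M \<mu> s = (\<Sum>y\<in>s ` space M. \<mu> {x\<in>space M. s x = y} * y)"
proof -
  let ?N1 = "jordan_pos M (\<lambda>A. Re (\<mu> A))" and ?N2 = "jordan_pos M (\<lambda>A. - Re (\<mu> A))"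
    and ?N3 = "jordan_pos M (\<lambda>A. Im (\<mu> A))" and ?N4 = "jordan_pos M (\<lambda>A. - Im (\<mu> A))"
  have i: "integral\<^sup>L N s = (\<Sum>y\<in>s ` space M. of_real (measure N {x\<in>space M. s x = y}) * y)"
    if "N \<in> {?N1, ?N2, ?N3, ?N4}" for N
    by (rule integral_simple_finite[OF jordan_parts[OF \<mu> that] s])
  have "cm_integral M \<mu> s = (\<Sum>y\<in>s ` space M.
      (of_real (measure ?N1 {x\<in>space M. s x = y} - measure ?N2 {x\<in>space M. s x = y}) +
       \<i> * of_real (measure ?N3 {x\<in>space M. s x = y} - measure ?N4 {x\<in>space M. s x = y})) * y)"
    unfolding cm_integral_def i[of ?N1, simplified] i[of ?N2, simplified] i[of ?N3, simplified] i[of ?N4, simplified]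
    by (simp add: sum_subtractf sum.distrib sum_distrib_left algebra_simps)
  also have "\<dots> = (\<Sum>y\<in>s ` space M. \<mu> {x\<in>space M. s x = y} * y)"
  proof (rule sum.cong[OF refl])
    fix y
    have "{x\<in>space M. s x = y} = s -` {y} \<inter> space M" by auto
    then have A: "{x\<in>space M. s x = y} \<in> sets M" using simple_functionD(2)[OF s] by simp
    show "(of_real (measure ?N1 {x\<in>space M. s x = y} - measure ?N2 {x\<in>space M. s x = y}) +
       \<i> * of_real (measure ?N3 {x\<in>space M. s x = y} - measure ?N4 {x\<in>space M. s x = y})) * y =
       \<mu> {x\<in>space M. s x = y} * y"
      unfolding jordan_decomposition_Re[OF \<mu> A] jordan_decomposition_Im[OF \<mu> A] by (simp only: complex_eq[symmetric])
  qed
  finally show ?thesis .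
qed

lemma cm_integral_tendsto:
  assumes \<mu>: "\<mu> \<in> complex_measures M"
    and s: "\<And>i::nat. s i \<in> borel_measurable M" "\<And>i x. x \<in> space M \<Longrightarrow> cmod (s i x) \<le> C"
    and h: "h \<in> borel_measurable M" "\<And>x. x \<in> space M \<Longrightarrow> (\<lambda>i. s i x) \<longlonglongrightarrow> h x"
  shows "(\<lambda>i. cm_integral M \<mu> (s i)) \<longlonglongrightarrow> cm_integral M \<mu> h"
proof -
  let ?N1 = "jordan_pos M (\<lambda>A. Re (\<mu> A))" and ?N2 = "jordan_pos M (\<lambda>A. - Re (\<mu> A))"
    and ?N3 = "jordan_pos M (\<lambda>A. Im (\<mu> A))" and ?N4 = "jordan_pos M (\<lambda>A. - Im (\<mu> A))"
  have "(\<lambda>i. integral\<^sup>L N (s i)) \<longlonglongrightarrow> integral\<^sup>L N h" if N: "N \<in> {?N1, ?N2, ?N3, ?N4}" for N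
  proof -
    interpret finite_measure N by (rule jordan_parts(1)[OF \<mu> N])
    have sets: "sets N = sets M" by (rule jordan_parts(2)[OF \<mu> N])
    have sp: "space N = space M" by (rule sets_eq_imp_space_eq[OF sets])
    have meas: "g \<in> borel_measurable N \<longleftrightarrow> g \<in> borel_measurable M" for g :: "_ \<Rightarrow> complex"
      by (rule measurable_cong_sets[OF sets refl, THEN eqset_imp_iff])
    show ?thesis
    proof (rule integral_dominated_convergence[where w = "\<lambda>_. C"])
      show "AE x in N. (\<lambda>i. s i x) \<longlonglongrightarrow> h x" using h(2) by (intro AE_I2) (simp add: sp)
      show "AE x in N. norm (s i x) \<le> C" for i using s(2) by (intro AE_I2) (simp add: sp)
    qed (simp_all add: meas s h)
  qed
  then show ?thesis unfolding cm_integral_def by (intro tendsto_intros) auto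
qed

text \<open>The exceptional set of parameters depends on \<open>A\<close>, but a single
  \<open>h\<close> is a limit of simple functions that together involve only countably many
  sets.\<close>

lemma AE_cm_integral_eq_0:
  fixes \<kappa> :: "'b \<Rightarrow> 'a set \<Rightarrow> complex"
  assumes \<kappa>: "\<And>t. \<kappa> t \<in> complex_measures M" and AE0: "\<And>A. A \<in> sets M \<Longrightarrow> AE t in N. \<kappa> t A = 0"
    and h: "h \<in> borel_measurable M" "\<And>x. x \<in> space M \<Longrightarrow> cmod (h x) \<le> C"
  shows "AE t in N. cm_integral M (\<kappa> t) h = 0"
proof -
  obtain s where s: "\<And>i::nat. simple_function M (s i)"
    "\<And>x. x \<in> space M \<Longrightarrow> (\<lambda>i. s i x) \<longlonglongrightarrow> h x"
    "\<And>i x. x \<in> space M \<Longrightarrow> dist (s i x) 0 \<le> 2 * dist (h x) 0"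
    using borel_measurable_implies_sequence_metric[OF h(1), of 0] by blast
  have "AE t in N. \<kappa> t {x\<in>space M. s i x = y} = 0" for i y
  proof (rule AE0)
    have "{x\<in>space M. s i x = y} = s i -` {y} \<inter> space M" by auto
    then show "{x\<in>space M. s i x = y} \<in> sets M" using simple_functionD(2)[OF s(1)] by simp
  qed
  then have "AE t in N. \<forall>i. \<forall>y\<in>s i ` space M. \<kappa> t {x\<in>space M. s i x = y} = 0"
    unfolding AE_all_countable
    by (intro allI AE_ball_countable[THEN iffD2] ballI countable_finite) (auto intro: simple_functionD(1)[OF s(1)])
  then show ?thesis
  proof eventually_elim
    case (elim t)
    have "(\<lambda>i. cm_integral M (\<kappa> t) (s i)) \<longlonglongrightarrow> cm_integral M (\<kappa> t) h"
    proof (rule cm_integral_tendsto[OF \<kappa>])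
      show "cmod (s i x) \<le> 2 * C" if "x \<in> space M" for i x
        using s(3)[OF that, of i] h(2)[OF that] by simp
    qed (use s h in \<open>auto intro: borel_measurable_simple_function\<close>)
    moreover have "cm_integral M (\<kappa> t) (s i) = 0" for i
      unfolding cm_integral_simple[OF \<kappa> s(1)] using elim by (intro sum.neutral) auto
    ultimately show ?case by (simp add: LIMSEQ_const_iff)
  qed
qed

section \<open>Measures with an integrable density\<close>

text \<open>The supremum over subsets of \<open>A\<close> is attained at
  \<open>A \<inter> {t. 0 < g t}\<close>.\<close>

lemma jordan_pos_density:
  assumes g: "integrable lborel g"
  shows "jordan_pos borel (\<lambda>A. LINT t:A|lborel. g t) = density lborel (\<lambda>t. ennreal (max 0 (g t)))"
proof -
  let ?D = "density lborel (\<lambda>t. ennreal (max 0 (g t)))"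
  have gm [measurable]: "g \<in> borel_measurable borel" using g by auto
  have int: "integrable lborel (\<lambda>t. indicator A t * max 0 (g t))" if "A \<in> sets borel" for A
    using integrable_mult_indicator[OF _ integrable_max[OF integrable_zero g], of A] that by simp
  have D: "emeasure ?D A = ennreal (LINT t|lborel. indicator A t * max 0 (g t))" if A: "A \<in> sets borel" for A
  proof -
    have "emeasure ?D A = (\<integral>\<^sup>+ t. ennreal (max 0 (g t)) * indicator A t \<partial>lborel)"
      using A by (intro emeasure_density) auto
    also have "\<dots> = (\<integral>\<^sup>+ t. ennreal (indicator A t * max 0 (g t)) \<partial>lborel)"
      by (intro nn_integral_cong) (simp add: indicator_def)
    also have "\<dots> = ennreal (LINT t|lborel. indicator A t * max 0 (g t))"
      by (intro nn_integral_eq_integral int A) auto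
    finally show ?thesis .
  qed
  have eq: "(SUP B\<in>{B \<in> sets borel. B \<subseteq> A}. ennreal (LINT t:B|lborel. g t)) = emeasure ?D A"
    if A: "A \<in> sets borel" for A
  proof (rule antisym)
    show "(SUP B\<in>{B \<in> sets borel. B \<subseteq> A}. ennreal (LINT t:B|lborel. g t)) \<le> emeasure ?D A"
    proof (rule SUP_least)
      fix B assume B: "B \<in> {B \<in> sets borel. B \<subseteq> A}"
      have "(LINT t:B|lborel. g t) \<le> (LINT t|lborel. indicator A t * max 0 (g t))"
        unfolding set_lebesgue_integral_def
      proof (rule integral_mono)
        show "integrable lborel (\<lambda>t. indicat_real B t *\<^sub>R g t)" using B by (intro integrable_mult_indicator g) auto
        show "integrable lborel (\<lambda>t. indicator A t * max 0 (g t))" by (rule int[OF A])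
      qed (use B in \<open>auto simp: indicator_def\<close>)
      then show "ennreal (LINT t:B|lborel. g t) \<le> emeasure ?D A" unfolding D[OF A] by (rule ennreal_leI)
    qed
    have "{t. 0 < g t} \<in> sets borel" by measurable
    then have B: "A \<inter> {t. 0 < g t} \<in> {B \<in> sets borel. B \<subseteq> A}" using A by auto
    have "(LINT t|lborel. indicator A t * max 0 (g t)) = (LINT t:A \<inter> {t. 0 < g t}|lborel. g t)"
      unfolding set_lebesgue_integral_def by (intro Bochner_Integration.integral_cong) (auto simp: indicator_def)
    then show "emeasure ?D A \<le> (SUP B\<in>{B \<in> sets borel. B \<subseteq> A}. ennreal (LINT t:B|lborel. g t))"
      unfolding D[OF A] by (intro SUP_upper2[OF B]) simp
  qed
  have "jordan_pos borel (\<lambda>A. LINT t:A|lborel. g t) = measure_of (space ?D) (sets ?D) (emeasure ?D)"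
    unfolding jordan_pos_def space_density sets_density space_lborel sets_lborel
    by (intro measure_of_eq) (use sets.sigma_sets_eq[of borel] eq in auto)
  also have "\<dots> = ?D" by (rule measure_of_of_measure)
  finally show ?thesis .
qed

lemma cm_integral_density:
  assumes f: "integrable lborel f" and h: "h \<in> borel_measurable borel" "\<And>t. cmod (h t) \<le> C"
  shows "cm_integral borel (density_cm f) h = (LINT t|lborel. f t * h t)"
proof -
  have part: "integral\<^sup>L (jordan_pos borel (\<lambda>A. \<phi> (density_cm f A))) h = (LINT t|lborel. of_real (max 0 (g t)) * h t)"
    if g: "integrable lborel g" and eq: "\<And>A. A \<in> sets borel \<Longrightarrow> \<phi> (density_cm f A) = (LINT t:A|lborel. g t)" for g \<phi>
  proof -
    have "jordan_pos borel (\<lambda>A. \<phi> (density_cm f A)) = density lborel (\<lambda>t. ennreal (max 0 (g t)))"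
      using jordan_pos_cong[of borel "\<lambda>A. \<phi> (density_cm f A)", OF eq] jordan_pos_density[OF g] by simp
    moreover have "integral\<^sup>L (density lborel (\<lambda>t. ennreal (max 0 (g t)))) h = (LINT t|lborel. max 0 (g t) *\<^sub>R h t)"
      using g h by (intro integral_density) auto
    ultimately show ?thesis by (simp add: scaleR_conv_of_real)
  qed
  have setf: "integrable lborel (\<lambda>t. indicat_real A t *\<^sub>R f t)" if "A \<in> sets borel" for A
    using that by (intro integrable_mult_indicator f) auto
  have Re_eq: "Re (density_cm f A) = (LINT t:A|lborel. Re (f t))"
    and Im_eq: "Im (density_cm f A) = (LINT t:A|lborel. Im (f t))" if A: "A \<in> sets borel" for A
    using integral_Re[OF setf[OF A]] integral_Im[OF setf[OF A]] A
    by (simp_all add: density_cm_def set_lebesgue_integral_def)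
  have Ref: "integrable lborel (\<lambda>t. Re (f t))" "integrable lborel (\<lambda>t. - Re (f t))"
    and Imf: "integrable lborel (\<lambda>t. Im (f t))" "integrable lborel (\<lambda>t. - Im (f t))"
    using f by auto
  have neg: "- (LINT t:A|lborel. g t) = (LINT t:A|lborel. - g t)" for A and g :: "real \<Rightarrow> real"
    by (simp add: set_lebesgue_integral_def)
  have int: "integrable lborel (\<lambda>t. of_real (max 0 (g t)) * h t)" if g: "integrable lborel g" for g
  proof (rule Bochner_Integration.integrable_bound)
    show "integrable lborel (\<lambda>t. C * g t)" using g by simp
    show "(\<lambda>t. of_real (max 0 (g t)) * h t) \<in> borel_measurable lborel" using g h(1) by simp
    have C: "0 \<le> C" using order_trans[OF norm_ge_zero h(2)] .
    show "AE t in lborel. norm (of_real (max 0 (g t)) * h t) \<le> norm (C * g t)"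
    proof (rule AE_I2)
      fix t
      have "\<bar>max 0 (g t)\<bar> * norm (h t) \<le> \<bar>g t\<bar> * C" using h(2) by (intro mult_mono) auto
      then show "norm (of_real (max 0 (g t)) * h t) \<le> norm (C * g t)"
        using C by (simp add: norm_mult abs_mult mult.commute)
    qed
  qed
  have "cm_integral borel (density_cm f) h =
     (LINT t|lborel. of_real (max 0 (Re (f t))) * h t) - (LINT t|lborel. of_real (max 0 (- Re (f t))) * h t)
     + \<i> * ((LINT t|lborel. of_real (max 0 (Im (f t))) * h t) - (LINT t|lborel. of_real (max 0 (- Im (f t))) * h t))"
    unfolding cm_integral_def
    using part[OF Ref(1), of Re] part[OF Ref(2), of "\<lambda>z. - Re z"] part[OF Imf(1), of Im] part[OF Imf(2), of "\<lambda>z. - Im z"]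
    by (simp add: Re_eq Im_eq neg)
  also have "\<dots> = (LINT t|lborel. (of_real (max 0 (Re (f t))) * h t - of_real (max 0 (- Re (f t))) * h t)
     + \<i> * (of_real (max 0 (Im (f t))) * h t - of_real (max 0 (- Im (f t))) * h t))"
    using int[OF Ref(1)] int[OF Ref(2)] int[OF Imf(1)] int[OF Imf(2)] by simp
  also have "\<dots> = (LINT t|lborel. f t * h t)"
  proof (rule Bochner_Integration.integral_cong[OF refl])
    fix t
    have "(of_real (max 0 (Re (f t))) * h t - of_real (max 0 (- Re (f t))) * h t)
     + \<i> * (of_real (max 0 (Im (f t))) * h t - of_real (max 0 (- Im (f t))) * h t) =
      (of_real (max 0 (Re (f t)) - max 0 (- Re (f t))) + \<i> * of_real (max 0 (Im (f t)) - max 0 (- Im (f t)))) * h t"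
      by (simp add: algebra_simps)
    also have "max 0 (Re (f t)) - max 0 (- Re (f t)) = Re (f t)" by (simp add: max_def)
    also have "max 0 (Im (f t)) - max 0 (- Im (f t)) = Im (f t)" by (simp add: max_def)
    also have "of_real (Re (f t)) + \<i> * of_real (Im (f t)) = f t" by (rule complex_eq[symmetric])
    finally show "(of_real (max 0 (Re (f t))) * h t - of_real (max 0 (- Re (f t))) * h t)
     + \<i> * (of_real (max 0 (Im (f t))) * h t - of_real (max 0 (- Im (f t))) * h t) = f t * h t" .
  qed
  finally show ?thesis .
qed

text \<open>Partial sums over a disjoint sequence are values of \<open>F t\<close> on finite unions,
  hence bounded by \<open>w t\<close> uniformly in their length, and dominated convergence gives
  countable additivity.\<close>

lemma integral_complex_measures:
  fixes F :: "'b \<Rightarrow> 'a set \<Rightarrow> complex"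
  assumes F: "\<And>t. F t \<in> complex_measures M"
    and meas: "\<And>A. A \<in> sets M \<Longrightarrow> (\<lambda>t. F t A) \<in> borel_measurable N"
    and w: "integrable N w" and bound: "\<And>t A. cmod (F t A) \<le> w t"
  shows "(\<lambda>A. if A \<in> sets M then (LINT t|N. F t A) else 0) \<in> complex_measures M"
proof (rule cmI)
  fix A :: "nat \<Rightarrow> 'a set"
  assume A: "range A \<subseteq> sets M" "disjoint_family A"
  have Am: "A i \<in> sets M" for i using A by auto
  have int: "integrable N (\<lambda>t. F t B)" if "B \<in> sets M" for B
    using w by (rule Bochner_Integration.integrable_bound)
      (auto intro!: meas that order_trans[OF bound abs_ge_self])
  have part: "(\<Sum>i<n. F t (A i)) = F t (\<Union>i<n. A i)" for t n
    using Am A(2) by (intro cm_UN_finite[OF F, symmetric]) (auto simp: disjoint_family_on_def)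
  have "(\<lambda>n. LINT t|N. (\<Sum>i<n. F t (A i))) \<longlonglongrightarrow> (LINT t|N. F t (\<Union>i. A i))"
  proof (rule integral_dominated_convergence[OF _ _ w])
    show "AE t in N. (\<lambda>n. \<Sum>i<n. F t (A i)) \<longlonglongrightarrow> F t (\<Union>i. A i)"
      using cm_sums[OF F A] by (simp add: sums_def)
    show "AE t in N. norm (\<Sum>i<n. F t (A i)) \<le> w t" for n unfolding part using bound by simp
  qed (use Am meas in auto)
  moreover have "(LINT t|N. (\<Sum>i<n. F t (A i))) = (\<Sum>i<n. LINT t|N. F t (A i))" for n
    using int Am by (intro Bochner_Integration.integral_sum) auto
  ultimately show "(\<lambda>i. if A i \<in> sets M then (LINT t|N. F t (A i)) else 0) sums
     (if (\<Union>i. A i) \<in> sets M then (LINT t|N. F t (\<Union>i. A i)) else 0)"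
    using Am by (simp add: sums_def sets.countable_UN A)
qed (simp_all add: cm_empty[OF F])

lemma sums_indicator:
  fixes c :: complex
  assumes "disjoint_family A"
  shows "(\<lambda>i::nat. indicat_real (A i) t *\<^sub>R c) sums (indicat_real (\<Union>i. A i) t *\<^sub>R c)"
proof (cases "t \<in> (\<Union>i. A i)")
  case True
  then obtain j where j: "t \<in> A j" by auto
  then have "indicat_real (A i) t *\<^sub>R c = (if i = j then c else 0)" for i
    using assms by (auto simp: disjoint_family_on_def indicator_def)
  then show ?thesis using True sums_single[of j "\<lambda>_. c"] by simp
next
  case False
  then show ?thesis by simp
qed

text \<open>The measure is the integral over \<open>t\<close> of the point masses \<open>f t\<close>
  at \<open>t\<close>.\<close>

lemma density_cm_complex_measure:
  assumes "integrable lborel f"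
  shows "density_cm f \<in> complex_measures borel"
proof -
  have "(\<lambda>A. if A \<in> sets borel then (LINT t|lborel. (if A \<in> sets borel then indicat_real A t *\<^sub>R f t else 0)) else 0)
     \<in> complex_measures borel"
  proof (rule integral_complex_measures[where w = "\<lambda>t. norm (f t)"])
    show "(\<lambda>A. if A \<in> sets borel then indicat_real A t *\<^sub>R f t else 0) \<in> complex_measures borel" for t
    proof (rule cmI)
      fix A :: "nat \<Rightarrow> real set" assume "range A \<subseteq> sets borel" "disjoint_family A"
      moreover from this have "A i \<in> sets borel" "(\<Union>i. A i) \<in> sets borel" for i by auto
      ultimately show "(\<lambda>i. if A i \<in> sets borel then indicat_real (A i) t *\<^sub>R f t else 0) sums
        (if (\<Union>i. A i) \<in> sets borel then indicat_real (\<Union>i. A i) t *\<^sub>R f t else 0)"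
        using sums_indicator[of A t "f t"] by simp
    qed simp_all
  qed (use assms in \<open>auto simp: indicator_def\<close>)
  moreover have "(\<lambda>A. if A \<in> sets borel then (LINT t|lborel. (if A \<in> sets borel then indicat_real A t *\<^sub>R f t else 0)) else 0)
     = density_cm f"
    by (auto simp: density_cm_def set_lebesgue_integral_def)
  ultimately show ?thesis by simp
qed

lemma total_variation_mono:
  assumes "A \<subseteq> B" "B \<in> sets M"
  shows "total_variation M \<mu> A \<le> total_variation M \<mu> B"
  using assms by (intro total_variation_le psum_le_total_variation) auto

lemma total_variation_subadditive:
  assumes \<mu>: "\<mu> \<in> complex_measures M" and A: "A \<in> sets M" and B: "B \<in> sets M"
  shows "total_variation M \<mu> (A \<union> B) \<le> total_variation M \<mu> A + total_variation M \<mu> (B - A)"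
proof (rule total_variation_le)
  fix P assume P: "P \<in> set_families M" "\<Union>P = A \<union> B"
  have BA: "B - A \<in> sets M" using A B by auto
  have fin: "finite P" "disjoint P" using P by (auto simp: set_families_def)
  have "psum P \<mu> \<le> (\<Sum>C\<in>P. cmod (\<mu> (C \<inter> A)) + cmod (\<mu> (C \<inter> (B - A))))"
    unfolding psum_def
  proof (rule sum_mono)
    fix C assume C: "C \<in> P"
    then have "C \<in> sets M" using P by (auto simp: set_families_def)
    moreover have "C - A = C \<inter> (B - A)" using C P(2) by blast
    ultimately show "cmod (\<mu> C) \<le> cmod (\<mu> (C \<inter> A)) + cmod (\<mu> (C \<inter> (B - A)))"
      using cm_split[OF \<mu> _ A, of C] norm_triangle_ineq[of "\<mu> (C \<inter> A)" "\<mu> (C - A)"] by simp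
  qed
  also have "\<dots> = psum ((\<lambda>C. C \<inter> A) ` P) \<mu> + psum ((\<lambda>C. C \<inter> (B - A)) ` P) \<mu>"
    unfolding sum.distrib psum_image_Int[of \<mu>, OF cm_empty[OF \<mu>] fin] ..
  finally have "ennreal (psum P \<mu>) \<le> ennreal (psum ((\<lambda>C. C \<inter> A) ` P) \<mu>) + ennreal (psum ((\<lambda>C. C \<inter> (B - A)) ` P) \<mu>)"
    by (simp add: psum_nonneg ennreal_leI flip: ennreal_plus)
  also have "\<dots> \<le> total_variation M \<mu> A + total_variation M \<mu> (B - A)"
    using A BA by (intro add_mono psum_le_total_variation family_image_Int P(1)) auto
  finally show "ennreal (psum P \<mu>) \<le> total_variation M \<mu> A + total_variation M \<mu> (B - A)" .
qed

text \<open>The commutation law in \<open>sup_path_attaining\<close> is available for regular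
  measures only. Regularity is inherited from the finite measure with density
  \<open>norm (f t)\<close>, which dominates the total variation.\<close>

lemma density_cm_regular:
  assumes f: "integrable lborel f"
  shows "density_cm f \<in> regular_measures"
proof -
  let ?\<nu> = "density_cm f"
  have \<nu>: "?\<nu> \<in> complex_measures borel" by (rule density_cm_complex_measure[OF f])
  have fm [measurable]: "f \<in> borel_measurable borel" using f by auto
  define D where "D = density lborel (\<lambda>t. ennreal (norm (f t)))"
  have sD: "sets D = sets borel" by (simp add: D_def)
  have DA: "emeasure D A = ennreal (LINT t|lborel. indicator A t * norm (f t))" if A: "A \<in> sets borel" for A
  proof -
    have "emeasure D A = (\<integral>\<^sup>+ t. ennreal (norm (f t)) * indicator A t \<partial>lborel)"
      unfolding D_def using A by (intro emeasure_density) auto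
    also have "\<dots> = (\<integral>\<^sup>+ t. ennreal (indicator A t * norm (f t)) \<partial>lborel)"
      by (intro nn_integral_cong) (simp add: indicator_def)
    also have "\<dots> = ennreal (LINT t|lborel. indicator A t * norm (f t))"
      using integrable_mult_indicator[OF _ integrable_norm[OF f], of A] A by (intro nn_integral_eq_integral) auto
    finally show ?thesis .
  qed
  interpret D: finite_measure D
    using DA[of UNIV] by (intro finite_measureI) (simp add: D_def)
  have le: "total_variation borel ?\<nu> A \<le> emeasure D A" if A: "A \<in> sets borel" for A
  proof (rule total_variation_le)
    fix P assume P: "P \<in> set_families borel" "\<Union>P = A"
    have "ennreal (psum P ?\<nu>) = (\<Sum>B\<in>P. ennreal (cmod (?\<nu> B)))" by (simp add: psum_def)
    also have "\<dots> \<le> (\<Sum>B\<in>P. emeasure D B)"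
    proof (rule sum_mono)
      fix B assume "B \<in> P"
      then have B: "B \<in> sets borel" using P by (auto simp: set_families_def)
      have "cmod (?\<nu> B) \<le> (LINT t|lborel. norm (indicat_real B t *\<^sub>R f t))"
        using B by (simp add: density_cm_def set_lebesgue_integral_def del: norm_scaleR)
      then show "ennreal (cmod (?\<nu> B)) \<le> emeasure D B" unfolding DA[OF B] by (intro ennreal_leI) simp
    qed
    also have "\<dots> = emeasure D (\<Union>P)"
      using P sum_emeasure[of "\<lambda>B. B" P D]
      by (auto simp: set_families_def sD disjoint_family_on_def disjoint_def)
    finally show "ennreal (psum P ?\<nu>) \<le> emeasure D A" using P by simp
  qed
  \<comment> \<open>Between nested sets the variation changes by no more than the dominating measure
    does.\<close>
  have close: "total_variation borel ?\<nu> B \<le> total_variation borel ?\<nu> A + ennreal e"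
    if A: "A \<in> sets borel" and B: "B \<in> sets borel" "A \<subseteq> B" and e: "0 \<le> e" "measure D B \<le> measure D A + e" for A B e
  proof -
    have "total_variation borel ?\<nu> (A \<union> B) \<le> total_variation borel ?\<nu> A + total_variation borel ?\<nu> (B - A)"
      by (rule total_variation_subadditive[OF \<nu> A B(1)])
    also have "total_variation borel ?\<nu> (B - A) \<le> emeasure D (B - A)" using A B by (intro le) auto
    also have "emeasure D (B - A) \<le> ennreal e"
      unfolding D.emeasure_eq_measure using D.finite_measure_Diff[of B A] A B e by (intro ennreal_leI) (simp add: sD)
    finally show ?thesis using B by (simp add: Un_absorb1 add_left_mono)
  qed
  have fin: "emeasure D (space D) \<noteq> \<infinity>" by simp
  have outer: "total_variation borel ?\<nu> A = (INF U \<in> {U. open U \<and> A \<subseteq> U}. total_variation borel ?\<nu> U)"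
    if A: "A \<in> sets borel" for A
  proof (rule antisym)
    show "total_variation borel ?\<nu> A \<le> (INF U \<in> {U. open U \<and> A \<subseteq> U}. total_variation borel ?\<nu> U)"
      by (intro INF_greatest total_variation_mono) auto
    show "(INF U \<in> {U. open U \<and> A \<subseteq> U}. total_variation borel ?\<nu> U) \<le> total_variation borel ?\<nu> A"
    proof (rule ennreal_le_epsilon)
      fix e :: real assume e: "0 < e"
      have "emeasure D A < emeasure D A + ennreal e"
        using e by (simp add: D.emeasure_eq_measure ennreal_less_iff flip: ennreal_plus)
      then have "(INF U \<in> {U. A \<subseteq> U \<and> open U}. emeasure D U) < emeasure D A + ennreal e"
        using outer_regular[OF sD fin A] by simp
      then obtain U where U: "A \<subseteq> U" "open U" "emeasure D U < emeasure D A + ennreal e"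
        unfolding INF_less_iff by auto
      then have "measure D U < measure D A + e"
        using e by (simp add: D.emeasure_eq_measure ennreal_less_iff flip: ennreal_plus)
      then have "total_variation borel ?\<nu> U \<le> total_variation borel ?\<nu> A + ennreal e"
        using e U by (intro close A) auto
      then show "(INF U \<in> {U. open U \<and> A \<subseteq> U}. total_variation borel ?\<nu> U) \<le> total_variation borel ?\<nu> A + ennreal e"
        using U by (intro INF_lower2[of U]) auto
    qed
  qed
  have inner: "total_variation borel ?\<nu> A = (SUP K \<in> {K. compact K \<and> K \<subseteq> A}. total_variation borel ?\<nu> K)"
    if A: "A \<in> sets borel" for A
  proof (rule antisym)
    show "(SUP K \<in> {K. compact K \<and> K \<subseteq> A}. total_variation borel ?\<nu> K) \<le> total_variation borel ?\<nu> A"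
      using A by (intro SUP_least total_variation_mono) auto
    show "total_variation borel ?\<nu> A \<le> (SUP K \<in> {K. compact K \<and> K \<subseteq> A}. total_variation borel ?\<nu> K)"
    proof (rule ennreal_le_epsilon)
      fix e :: real assume e: "0 < e"
      obtain K where K: "compact K" "K \<subseteq> A" "measure D (A - K) < e"
        using e D.finite_measure_axioms sD A
        by (metis compact_inner_approx)
      have Km: "K \<in> sets borel" using K by (simp add: borel_compact)
      have "measure D (A - K) = measure D A - measure D K"
        using K A Km by (intro D.finite_measure_Diff) (auto simp: sD)
      then have "total_variation borel ?\<nu> A \<le> total_variation borel ?\<nu> K + ennreal e"
        using e K by (intro close A Km) auto
      also have "\<dots> \<le> (SUP K \<in> {K. compact K \<and> K \<subseteq> A}. total_variation borel ?\<nu> K) + ennreal e"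
        using K by (intro add_right_mono SUP_upper) auto
      finally show "total_variation borel ?\<nu> A \<le> (SUP K \<in> {K. compact K \<and> K \<subseteq> A}. total_variation borel ?\<nu> K) + ennreal e" .
    qed
  qed
  show ?thesis unfolding regular_measures_def using \<nu> outer inner by blast
qed

lemma measurable_cm_integral:
  fixes \<kappa> :: "'b \<Rightarrow> 'a set \<Rightarrow> complex"
  assumes \<kappa>: "\<And>t. \<kappa> t \<in> complex_measures M" and meas: "\<And>A. A \<in> sets M \<Longrightarrow> (\<lambda>t. \<kappa> t A) \<in> borel_measurable N"
    and h: "h \<in> borel_measurable M" "\<And>x. x \<in> space M \<Longrightarrow> cmod (h x) \<le> C"
  shows "(\<lambda>t. cm_integral M (\<kappa> t) h) \<in> borel_measurable N"
proof -
  obtain s where s: "\<And>i::nat. simple_function M (s i)"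
    "\<And>x. x \<in> space M \<Longrightarrow> (\<lambda>i. s i x) \<longlonglongrightarrow> h x"
    "\<And>i x. x \<in> space M \<Longrightarrow> dist (s i x) 0 \<le> 2 * dist (h x) 0"
    using borel_measurable_implies_sequence_metric[OF h(1), of 0] by blast
  show ?thesis
  proof (rule borel_measurable_LIMSEQ_metric)
    show "(\<lambda>i. cm_integral M (\<kappa> t) (s i)) \<longlonglongrightarrow> cm_integral M (\<kappa> t) h" for t
    proof (rule cm_integral_tendsto[OF \<kappa>])
      show "cmod (s i x) \<le> 2 * C" if "x \<in> space M" for i x
        using s(3)[OF that, of i] h(2)[OF that] by simp
    qed (use s h in \<open>auto intro: borel_measurable_simple_function\<close>)
    show "(\<lambda>t. cm_integral M (\<kappa> t) (s i)) \<in> borel_measurable N" for i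
      unfolding cm_integral_simple[OF \<kappa> s(1)]
    proof (intro borel_measurable_sum borel_measurable_times meas borel_measurable_const)
      fix y
      have "{x\<in>space M. s i x = y} = s i -` {y} \<inter> space M" by auto
      then show "{x\<in>space M. s i x = y} \<in> sets M" using simple_functionD(2)[OF s(1)] by simp
    qed
  qed
qed

section \<open>Poisson averages of orbits\<close>

lemma integral_shift:
  fixes f :: "real \<Rightarrow> complex"
  shows "(LINT t|lborel. f (t + u)) = (LINT t|lborel. f t)"
  using lborel_integral_real_affine[of 1 f u] by (simp add: add.commute)

lemma integrable_shift:
  fixes f :: "real \<Rightarrow> complex"
  assumes "integrable lborel f"
  shows "integrable lborel (\<lambda>t. f (t + u))"
  using lborel_integrable_real_affine[OF assms, of 1 u] by (simp add: add.commute)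

lemma H1_shift:
  assumes "g \<in> H1"
  shows "(\<lambda>t. g (t + u)) \<in> H1"
proof -
  have g: "integrable lborel g" and z: "\<And>s. s \<le> 0 \<Longrightarrow> fourier g s = 0" using assms by (auto simp: H1_def)
  have "fourier (\<lambda>t. g (t + u)) s = exp (\<i> * of_real s * of_real u) * fourier g s" for s
  proof -
    have "fourier (\<lambda>t. g (t + u)) s =
      (LINT t|lborel. exp (\<i> * of_real s * of_real u) * (g (t + u) * exp (- (\<i> * of_real s * of_real (t + u)))))"
      unfolding fourier_def
      by (intro Bochner_Integration.integral_cong refl) (simp add: exp_add[symmetric] algebra_simps)
    also have "\<dots> = exp (\<i> * of_real s * of_real u) *
        (LINT t|lborel. g (t + u) * exp (- (\<i> * of_real s * of_real (t + u))))" by simp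
    also have "(LINT t|lborel. g (t + u) * exp (- (\<i> * of_real s * of_real (t + u)))) = fourier g s"
      unfolding fourier_def by (rule integral_shift[of "\<lambda>t. g t * exp (- (\<i> * of_real s * of_real t))"])
    finally show ?thesis .
  qed
  then show ?thesis using z integrable_shift[OF g] by (simp add: H1_def)
qed

lemma iexp_poisson_integrable:
  assumes "0 < y"
  shows "integrable lborel (\<lambda>t. iexp (a * t) * complex_of_real (poisson y t))"
  by (rule integrable_bounded_poisson(3)[OF assms, where B = 1]) auto

lemma fourier_poisson_iexp:
  assumes y: "0 < y"
  shows "fourier (\<lambda>t. of_real (poisson y t) * (iexp (a * t) - c)) s =
    of_real (exp (- (y * \<bar>s - a\<bar>))) - c * of_real (exp (- (y * \<bar>s\<bar>)))"
proof -
  have int: "integrable lborel (\<lambda>t. complex_of_real (poisson y t) * exp (- (\<i> * of_real s * of_real t)))" for s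
    using iexp_poisson_integrable[OF y, of "- s"] by (simp add: mult.commute mult.left_commute)
  have "fourier (\<lambda>t. of_real (poisson y t) * (iexp (a * t) - c)) s =
     (LINT t|lborel. of_real (poisson y t) * exp (- (\<i> * of_real (s - a) * of_real t)) -
       c * (of_real (poisson y t) * exp (- (\<i> * of_real s * of_real t))))"
    unfolding fourier_def
  proof (intro Bochner_Integration.integral_cong refl)
    fix t
    have "iexp (a * t) * exp (- (\<i> * of_real s * of_real t)) = exp (- (\<i> * of_real (s - a) * of_real t))"
      unfolding exp_add[symmetric] by (rule arg_cong[where f = exp]) (simp add: algebra_simps)
    moreover have "k * (X - c) * E = k * (X * E) - c * (k * E)" for k X E :: complex
      by (simp add: algebra_simps)
    ultimately show "of_real (poisson y t) * (iexp (a * t) - c) * exp (- (\<i> * of_real s * of_real t)) =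
      of_real (poisson y t) * exp (- (\<i> * of_real (s - a) * of_real t)) -
       c * (of_real (poisson y t) * exp (- (\<i> * of_real s * of_real t)))"
      by (simp only:)
  qed
  also have "\<dots> = fourier (\<lambda>t. of_real (poisson y t)) (s - a) - c * fourier (\<lambda>t. of_real (poisson y t)) s"
    unfolding fourier_def using int[of "s - a"] int[of s]
    by (subst Bochner_Integration.integral_diff) auto
  finally show ?thesis by (simp only: fourier_poisson[OF y])
qed

text \<open>For \<open>s \<le> 0 \<le> a\<close> one has
  \<open>\<bar>s - a\<bar> = \<bar>s\<bar> + a\<close>, so the two exponentials in the Fourier
  transform cancel. These are the functions that turn pairing with \<open>H1\<close> into
  multiplicativity of Poisson means.\<close>

lemma poisson_iexp_H1:
  assumes y: "0 < y" and a: "0 \<le> a"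
  shows "(\<lambda>t. of_real (poisson y t) * (iexp (a * t) - of_real (exp (- (y * a))))) \<in> H1"
proof -
  have "integrable lborel (\<lambda>t. of_real (poisson y t) * (iexp (a * t) - of_real (exp (- (y * a)))))"
    using iexp_poisson_integrable[OF y, of a] poisson_integrable[OF y] by (simp add: algebra_simps)
  moreover have "fourier (\<lambda>t. of_real (poisson y t) * (iexp (a * t) - of_real (exp (- (y * a))))) s = 0"
    if "s \<le> 0" for s
  proof -
    have "exp (- (y * \<bar>s - a\<bar>)) = exp (- (y * a)) * exp (- (y * \<bar>s\<bar>))"
      using that a by (simp add: exp_add[symmetric] abs_of_nonpos algebra_simps)
    then show ?thesis unfolding fourier_poisson_iexp[OF y] of_real_mult[symmetric] by simp
  qed
  ultimately show ?thesis by (simp add: H1_def)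
qed

text \<open>The value \<open>c = 1\<close> serves iterated averages, where the second kernel is
  translated by the first variable; \<open>c = 0\<close> serves a product of two kernels.\<close>

lemma Fubini_poisson:
  fixes H :: "real \<Rightarrow> real \<Rightarrow> complex"
  assumes a: "0 < a" and b: "0 < b"
    and m: "(\<lambda>(s, t). H s t) \<in> borel_measurable (borel \<Otimes>\<^sub>M borel)"
    and bd: "\<And>s t. cmod (H s t) \<le> B * (poisson a s * poisson b (t - c * s))"
  shows "(LINT s|lborel. (LINT t|lborel. H s t)) = (LINT t|lborel. (LINT s|lborel. H s t))"
proof (rule lborel_pair.Fubini_integral[symmetric])
  have m': "(\<lambda>(s, t). H s t) \<in> borel_measurable (lborel \<Otimes>\<^sub>M lborel)"
    using m by (simp cong: measurable_cong_sets)
  have mt: "H s \<in> borel_measurable borel" for s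
    using measurable_compose[OF measurable_Pair1' m, of s] by simp
  have dom: "integrable lborel (\<lambda>t. B * (poisson a s * poisson b (t - c * s)))" for s
    using integrable_poisson_shift(1)[OF b, of "c * s"] by simp
  have int: "integrable lborel (H s)" for s
    by (rule Bochner_Integration.integrable_bound[OF dom[of s]])
      (auto simp: mt intro: order_trans[OF bd abs_ge_self])
  have le: "(LINT t|lborel. cmod (H s t)) \<le> B * poisson a s" for s
  proof -
    have "(LINT t|lborel. cmod (H s t)) \<le> (LINT t|lborel. B * (poisson a s * poisson b (t - c * s)))"
      using int dom bd by (intro integral_mono) auto
    also have "\<dots> = B * poisson a s" using integrable_poisson_shift(2)[OF b, of "c * s"] by simp
    finally show ?thesis .
  qed
  show "integrable (lborel \<Otimes>\<^sub>M lborel) (\<lambda>(s, t). H s t)"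
  proof (rule lborel_pair.Fubini_integrable[OF m'])
    have "integrable lborel (\<lambda>s. B * poisson a s)" using poisson_integrable[OF a] by simp
    then show "integrable lborel (\<lambda>s. LINT t|lborel. norm (case (s, t) of (s, t) \<Rightarrow> H s t))"
    proof (rule Bochner_Integration.integrable_bound)
      have "(\<lambda>(s, t). norm (H s t)) \<in> borel_measurable (lborel \<Otimes>\<^sub>M lborel)"
        using measurable_compose[OF m' borel_measurable_norm] by (simp add: case_prod_unfold)
      then show "(\<lambda>s. LINT t|lborel. norm (case (s, t) of (s, t) \<Rightarrow> H s t)) \<in> borel_measurable lborel"
        using lborel.borel_measurable_lebesgue_integral[of "\<lambda>s t. norm (H s t)" lborel] by simp
      show "AE s in lborel. norm (LINT t|lborel. norm (case (s, t) of (s, t) \<Rightarrow> H s t)) \<le> norm (B * poisson a s)"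
        using le by (intro AE_I2) (auto intro: order_trans[OF _ abs_ge_self])
    qed
    show "AE s in lborel. integrable lborel (\<lambda>t. case (s, t) of (s, t) \<Rightarrow> H s t)" using int by simp
  qed
qed

section \<open>The Poisson measure as a mean for bounded analytic functions\<close>

lemma prob_space_poisson:
  assumes y: "0 < y"
  shows "prob_space (density lborel (\<lambda>t. ennreal (poisson y t)))"
proof
  have "emeasure (density lborel (\<lambda>t. ennreal (poisson y t))) UNIV = (\<integral>\<^sup>+ t. ennreal (poisson y t) \<partial>lborel)"
    by (subst emeasure_density) auto
  also have "\<dots> = ennreal 1"
    using poisson_integrable[OF y] poisson_integral[OF y] poisson_nonneg[OF y]
    by (subst nn_integral_eq_integral) auto
  finally show "emeasure (density lborel (\<lambda>t. ennreal (poisson y t))) (space (density lborel (\<lambda>t. ennreal (poisson y t)))) = 1"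
    by simp
qed

lemma integral_poisson_density:
  fixes g :: "real \<Rightarrow> 'b :: {banach, second_countable_topology}"
  assumes "0 < y" "g \<in> borel_measurable borel"
  shows "(LINT t|density lborel (\<lambda>t. ennreal (poisson y t)). g t) = (LINT t|lborel. poisson y t *\<^sub>R g t)"
  using assms poisson_nonneg[OF assms(1)] by (intro integral_density) auto

text \<open>The defect \<open>w\<^sup>2 - (cmod c)\<^sup>2\<close> is kept as a product because
  Cauchy-Schwarz over the blocks of a partition treats the two factors separately: the first sums to
  something small, the second stays bounded.\<close>

lemma poisson_mean_deviation:
  fixes f :: "real \<Rightarrow> complex"
  assumes y: "0 < y" and f [measurable]: "f \<in> borel_measurable borel" and B: "\<And>t. cmod (f t) \<le> B"
    and an: "\<And>a. 0 \<le> a \<Longrightarrow> (LINT t|lborel. f t * iexp (a * t) * of_real (poisson y t)) =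
      of_real (exp (- (y * a))) * (LINT t|lborel. f t * of_real (poisson y t))"
  defines "c \<equiv> (LINT t|lborel. f t * of_real (poisson y t))"
  defines "w \<equiv> (LINT t|lborel. cmod (f t) * poisson y t)"
  shows "(LINT t|lborel. cmod (f t - c) * poisson y t) \<le> 7 * sqrt ((w - cmod c) * (w + cmod c))" and "cmod c \<le> w"
proof -
  let ?m = "density lborel (\<lambda>t. ennreal (poisson y t))"
  have conv: "(LINT t|?m. g t) = (LINT t|lborel. g t * of_real (poisson y t))"
    if "g \<in> borel_measurable borel" for g :: "real \<Rightarrow> complex"
    using integral_poisson_density[OF y that] by (simp add: scaleR_conv_of_real mult.commute)
  have convr: "(LINT t|?m. g t) = (LINT t|lborel. g t * poisson y t)"
    if "g \<in> borel_measurable borel" for g :: "real \<Rightarrow> real"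
    using integral_poisson_density[OF y that] by (simp add: mult.commute)
  interpret prob_space ?m by (rule prob_space_poisson[OF y])
  interpret H: half_plane_mean ?m y f B
  proof unfold_locales
    show "sets ?m = sets borel" by simp
    show "(LINT t|?m. iexp (a * t)) = of_real (exp (- (y * a)))" if "0 \<le> a" for a
      by (subst conv) (use poisson_exp[OF y that] in simp_all)
    show "(LINT t|?m. f t * iexp (a * t)) = of_real (exp (- (y * a))) * (LINT t|?m. f t)" if "0 \<le> a" for a
    proof -
      have "(LINT t|?m. f t * iexp (a * t)) = (LINT t|lborel. f t * iexp (a * t) * of_real (poisson y t))"
        by (rule conv) measurable
      also have "\<dots> = of_real (exp (- (y * a))) * (LINT t|lborel. f t * of_real (poisson y t))" by (rule an[OF that])
      also have "(LINT t|lborel. f t * of_real (poisson y t)) = (LINT t|?m. f t)" by (rule conv[symmetric]) measurable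
      finally show ?thesis .
    qed
    show "f \<in> borel_measurable borel" by (rule f)
    show "cmod (f t) \<le> B" for t by (rule B)
  qed
  have c: "H.f0 = c" unfolding H.f0_def c_def by (rule conv[OF f])
  have w: "H.W = w" unfolding H.W_def w_def by (rule convr) measurable
  show "cmod c \<le> w" using H.norm_f0_le by (simp only: c w)
  have "(LINT t|?m. cmod (f t - c)) = (LINT t|lborel. cmod (f t - c) * poisson y t)"
    by (rule convr) measurable
  moreover have "w\<^sup>2 - (cmod c)\<^sup>2 = (w - cmod c) * (w + cmod c)" by (simp add: power2_eq_square algebra_simps)
  ultimately show "(LINT t|lborel. cmod (f t - c) * poisson y t) \<le> 7 * sqrt ((w - cmod c) * (w + cmod c))"
    using H.mean_deviation by (simp only: c w H.S_def)
qed

lemma sum_sqrt_le: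
  assumes "finite Q" "\<And>B. B \<in> Q \<Longrightarrow> 0 \<le> u B" "\<And>B. B \<in> Q \<Longrightarrow> 0 \<le> v B"
  shows "(\<Sum>B\<in>Q. sqrt (u B * v B)) \<le> sqrt ((\<Sum>B\<in>Q. u B) * (\<Sum>B\<in>Q. v B))"
proof (rule real_le_rsqrt)
  have "(\<Sum>B\<in>Q. sqrt (u B) * sqrt (v B))\<^sup>2 \<le> (\<Sum>B\<in>Q. (sqrt (u B))\<^sup>2) * (\<Sum>B\<in>Q. (sqrt (v B))\<^sup>2)"
    by (rule Cauchy_Schwarz_ineq_sum)
  also have "\<dots> = (\<Sum>B\<in>Q. u B) * (\<Sum>B\<in>Q. v B)" using assms by simp
  finally show "(\<Sum>B\<in>Q. sqrt (u B * v B))\<^sup>2 \<le> (\<Sum>B\<in>Q. u B) * (\<Sum>B\<in>Q. v B)"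
    by (simp add: real_sqrt_mult)
qed

section \<open>The representation and its Poisson averages\<close>

locale isometric_rep =
  fixes M :: "'a measure" and T :: "real \<Rightarrow> ('a set \<Rightarrow> complex) \<Rightarrow> ('a set \<Rightarrow> complex)"
  assumes rep: "is_representation M T" and iso: "by_isometries M T" and spa: "sup_path_attaining M T"
begin

lemma T_bounded_op: "bounded_op M (T t)"
  using rep by (simp add: is_representation_def invertible_bounded_op_def)

lemma T_cm: "\<mu> \<in> complex_measures M \<Longrightarrow> T t \<mu> \<in> complex_measures M"
  using T_bounded_op[of t] unfolding bounded_op_def by blast

lemma T_add: "\<mu> \<in> complex_measures M \<Longrightarrow> \<nu> \<in> complex_measures M \<Longrightarrow>
    T t (\<lambda>A. \<mu> A + \<nu> A) = (\<lambda>A. T t \<mu> A + T t \<nu> A)"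
  using T_bounded_op[of t] unfolding bounded_op_def by blast

lemma T_scale: "\<mu> \<in> complex_measures M \<Longrightarrow> T t (\<lambda>A. c * \<mu> A) = (\<lambda>A. c * T t \<mu> A)"
  using T_bounded_op[of t] unfolding bounded_op_def by blast

lemma T_diff:
  assumes "\<mu> \<in> complex_measures M" "\<nu> \<in> complex_measures M"
  shows "T t (\<lambda>A. \<mu> A - \<nu> A) = (\<lambda>A. T t \<mu> A - T t \<nu> A)"
  using T_add[OF assms(1) cm_scale[OF assms(2), of "-1"]] T_scale[OF assms(2), of t "-1"] by simp

lemma T_norm: "\<mu> \<in> complex_measures M \<Longrightarrow> cm_norm M (T t \<mu>) = cm_norm M \<mu>"
  using iso by (simp add: by_isometries_def)

lemma T_T: "\<mu> \<in> complex_measures M \<Longrightarrow> T s (T t \<mu>) = T (s + t) \<mu>"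
  using rep by (simp add: is_representation_def)

text \<open>The homomorphism law makes \<open>T 0\<close> idempotent, and an injective idempotent is
  the identity.\<close>

lemma T_0: "\<mu> \<in> complex_measures M \<Longrightarrow> T 0 \<mu> = \<mu>"
proof -
  assume \<mu>: "\<mu> \<in> complex_measures M"
  obtain V where V: "\<And>\<mu>. \<mu> \<in> complex_measures M \<Longrightarrow> V (T 0 \<mu>) = \<mu>"
  proof -
    have "invertible_bounded_op M (T 0)" using rep by (simp add: is_representation_def)
    then show ?thesis using that unfolding invertible_bounded_op_def by blast
  qed
  have "T 0 \<mu> = V (T 0 (T 0 \<mu>))" using V[OF T_cm[OF \<mu>]] by simp
  also have "\<dots> = \<mu>" using V[OF \<mu>] T_T[OF \<mu>, of 0 0] by simp
  finally show ?thesis .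
qed

lemma T_bound: "\<mu> \<in> complex_measures M \<Longrightarrow> cmod (T t \<mu> A) \<le> cm_norm M \<mu>"
  using cmod_le_norm[OF T_cm] T_norm by metis

lemma T_norm_diff:
  assumes "\<mu> \<in> complex_measures M" "\<nu> \<in> complex_measures M"
  shows "cm_norm M (\<lambda>A. T t \<mu> A - T t \<nu> A) = cm_norm M (\<lambda>A. \<mu> A - \<nu> A)"
  using T_norm[OF cm_diff[OF assms], of t] T_diff[OF assms] by simp

abbreviation "wm \<equiv> weakly_measurable M T"

lemma wm_cm: "\<mu> \<in> wm \<Longrightarrow> \<mu> \<in> complex_measures M"
  by (simp add: weakly_measurable_def)

lemma wm_measurable:
  assumes "\<mu> \<in> wm"
  shows "(\<lambda>t. T t \<mu> A) \<in> borel_measurable borel"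
proof (cases "A \<in> sets M")
  case True
  then show ?thesis using assms by (simp add: weakly_measurable_def)
next
  case False
  then show ?thesis using cm_outside[OF T_cm[OF wm_cm[OF assms]]] by simp
qed

lemma wmI: "\<mu> \<in> complex_measures M \<Longrightarrow> (\<And>A. A \<in> sets M \<Longrightarrow> (\<lambda>t. T t \<mu> A) \<in> borel_measurable borel) \<Longrightarrow> \<mu> \<in> wm"
  by (simp add: weakly_measurable_def)

lemma wm_T:
  assumes "\<mu> \<in> wm"
  shows "T s \<mu> \<in> wm"
proof (rule wmI)
  show "T s \<mu> \<in> complex_measures M" by (rule T_cm[OF wm_cm[OF assms]])
  fix A
  have "(\<lambda>t. T (t + s) \<mu> A) \<in> borel_measurable borel"
    using measurable_compose[OF _ wm_measurable[OF assms, of A], of "\<lambda>t. t + s" borel] by simp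
  then show "(\<lambda>t. T t (T s \<mu>) A) \<in> borel_measurable borel" by (simp add: T_T[OF wm_cm[OF assms]])
qed

text \<open>The encoding through \<open>cm_conv\<close> is the form in which
  \<open>sup_path_attaining\<close> lets \<open>T\<close> commute with the average. The kernel is
  even, so the reflection in \<open>cm_conv\<close> is invisible.\<close>

definition P :: "real \<Rightarrow> ('a set \<Rightarrow> complex) \<Rightarrow> 'a set \<Rightarrow> complex" where
  "P y \<mu> = cm_conv M T (density_cm (\<lambda>t. of_real (poisson y t))) \<mu>"

lemma cm_conv_density:
  assumes \<mu>: "\<mu> \<in> wm" and f: "integrable lborel f" and A: "A \<in> sets M"
  shows "cm_conv M T (density_cm f) \<mu> A = (LINT t|lborel. f (- t) * T t \<mu> A)"
proof -
  have "cm_conv M T (density_cm f) \<mu> A = (LINT t|lborel. f t * T (- t) \<mu> A)"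
    unfolding cm_conv_def using A
  proof (simp, intro cm_integral_density[OF f])
    show "(\<lambda>t. T (- t) \<mu> A) \<in> borel_measurable borel"
      using measurable_compose[OF _ wm_measurable[OF \<mu>, of A], of uminus borel] by simp
  qed (rule T_bound[OF wm_cm[OF \<mu>]])
  also have "\<dots> = (LINT t|lborel. f (- t) * T t \<mu> A)"
    using lborel_integral_real_affine[of "-1" "\<lambda>t. f t * T (- t) \<mu> A" 0] by simp
  finally show ?thesis .
qed

lemma poisson_of_real_integrable: "0 < y \<Longrightarrow> integrable lborel (\<lambda>t. complex_of_real (poisson y t))"
  using poisson_integrable by (intro integrable_of_real) auto

lemma P_eq:
  assumes "0 < y" "\<mu> \<in> wm" "A \<in> sets M"
  shows "P y \<mu> A = (LINT t|lborel. T t \<mu> A * of_real (poisson y t))"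
  unfolding P_def cm_conv_density[OF assms(2) poisson_of_real_integrable[OF assms(1)] assms(3)]
  by (simp add: mult.commute)

lemma P_outside: "A \<notin> sets M \<Longrightarrow> P y \<mu> A = 0"
  by (simp add: P_def cm_conv_def)

lemma T_poisson_integrable:
  assumes "0 < y" "\<mu> \<in> wm"
  shows "integrable lborel (\<lambda>t. T t \<mu> A * of_real (poisson y t))"
    "integrable lborel (\<lambda>t. T t \<mu> A * of_real (poisson y (t - s)))"
  using integrable_bounded_poisson[OF assms(1) wm_measurable[OF assms(2)] T_bound[OF wm_cm[OF assms(2)]]]
  by auto

lemma P_cm:
  assumes y: "0 < y" and \<mu>: "\<mu> \<in> wm"
  shows "P y \<mu> \<in> complex_measures M"
proof -
  have "(\<lambda>A. if A \<in> sets M then (LINT t|lborel. of_real (poisson y t) * T t \<mu> A) else 0) \<in> complex_measures M"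
  proof (rule integral_complex_measures[where w = "\<lambda>t. poisson y t * cm_norm M \<mu>"])
    show "(\<lambda>A. of_real (poisson y t) * T t \<mu> A) \<in> complex_measures M" for t
      by (intro cm_scale T_cm wm_cm \<mu>)
    show "(\<lambda>t. of_real (poisson y t) * T t \<mu> A) \<in> borel_measurable lborel" for A
      using wm_measurable[OF \<mu>, of A] by simp
    show "integrable lborel (\<lambda>t. poisson y t * cm_norm M \<mu>)" using poisson_integrable[OF y] by simp
    show "cmod (of_real (poisson y t) * T t \<mu> A) \<le> poisson y t * cm_norm M \<mu>" for t A
      using poisson_nonneg[OF y] T_bound[OF wm_cm[OF \<mu>]] by (simp add: norm_mult mult_left_mono)
  qed
  also have "(\<lambda>A. if A \<in> sets M then (LINT t|lborel. of_real (poisson y t) * T t \<mu> A) else 0) = P y \<mu>"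
    by (auto simp: P_eq[OF y \<mu>] P_outside mult.commute)
  finally show ?thesis .
qed

lemma T_P:
  assumes "0 < y" "\<mu> \<in> wm"
  shows "T s (P y \<mu>) = P y (T s \<mu>)"
  using spa density_cm_regular[OF poisson_of_real_integrable[OF assms(1)]] assms(2)
  unfolding sup_path_attaining_def P_def by blast

lemma T_P_eq:
  assumes y: "0 < y" and \<mu>: "\<mu> \<in> wm" and A: "A \<in> sets M"
  shows "T s (P y \<mu>) A = (LINT t|lborel. T (t + s) \<mu> A * of_real (poisson y t))"
    and "T s (P y \<mu>) A = (LINT t|lborel. T t \<mu> A * of_real (poisson y (t - s)))"
proof -
  show 1: "T s (P y \<mu>) A = (LINT t|lborel. T (t + s) \<mu> A * of_real (poisson y t))"
    unfolding T_P[OF y \<mu>] P_eq[OF y wm_T[OF \<mu>] A] T_T[OF wm_cm[OF \<mu>]] ..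
  show "T s (P y \<mu>) A = (LINT t|lborel. T t \<mu> A * of_real (poisson y (t - s)))"
    unfolding 1 using integral_shift[of "\<lambda>t. T t \<mu> A * of_real (poisson y (t - s))" s] by simp
qed

lemma P_wm:
  assumes y: "0 < y" and \<mu>: "\<mu> \<in> wm"
  shows "P y \<mu> \<in> wm"
proof (rule wmI[OF P_cm[OF assms]])
  fix A assume A: "A \<in> sets M"
  note [measurable] = wm_measurable[OF \<mu>, of A]
  show "(\<lambda>t. T t (P y \<mu>) A) \<in> borel_measurable borel"
    unfolding T_P_eq(2)[OF y \<mu> A] by measurable
qed

lemma psum_T_le: "\<mu> \<in> complex_measures M \<Longrightarrow> Q \<in> set_families M \<Longrightarrow> psum Q (T t \<mu>) \<le> cm_norm M \<mu>"
  using psum_le_norm[OF T_cm] T_norm by metis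

text \<open>On a finite family the sum and the integral can be exchanged, and isometry bounds the
  sum of moduli for \<open>T t \<mu>\<close> by the norm of \<mu>, uniformly in
  \<open>t\<close>.\<close>

lemma norm_integral_le:
  assumes \<mu>: "\<mu> \<in> wm" and g: "integrable lborel g"
    and eq: "\<And>A. A \<in> sets M \<Longrightarrow> \<nu> A = (LINT t|lborel. T t \<mu> A * of_real (g t))"
  shows "cm_norm M \<nu> \<le> cm_norm M \<mu> * (LINT t|lborel. \<bar>g t\<bar>)"
proof (rule cm_norm_le)
  fix Q assume Q: "Q \<in> set_families M"
  have gm: "g \<in> borel_measurable borel" using g by auto
  have int: "integrable lborel (\<lambda>t. cmod (T t \<mu> A) * \<bar>g t\<bar>)" for A
  proof (rule Bochner_Integration.integrable_bound)
    show "integrable lborel (\<lambda>t. cm_norm M \<mu> * g t)" using g by simp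
    show "(\<lambda>t. cmod (T t \<mu> A) * \<bar>g t\<bar>) \<in> borel_measurable lborel"
      using wm_measurable[OF \<mu>, of A] gm by simp
    show "AE t in lborel. norm (cmod (T t \<mu> A) * \<bar>g t\<bar>) \<le> norm (cm_norm M \<mu> * g t)"
      using T_bound[OF wm_cm[OF \<mu>]] cm_norm_nonneg[of M \<mu>]
      by (intro AE_I2) (simp add: abs_mult mult_right_mono)
  qed
  have "psum Q \<nu> \<le> (\<Sum>B\<in>Q. LINT t|lborel. cmod (T t \<mu> B) * \<bar>g t\<bar>)"
    unfolding psum_def
  proof (rule sum_mono)
    fix B assume "B \<in> Q"
    then have B: "B \<in> sets M" using Q by (auto simp: set_families_def)
    show "cmod (\<nu> B) \<le> (LINT t|lborel. cmod (T t \<mu> B) * \<bar>g t\<bar>)"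
      unfolding eq[OF B] by (rule order_trans[OF integral_norm_bound]) (simp add: norm_mult)
  qed
  also have "\<dots> = (LINT t|lborel. (\<Sum>B\<in>Q. cmod (T t \<mu> B) * \<bar>g t\<bar>))"
    using int by (intro Bochner_Integration.integral_sum[symmetric]) auto
  also have "\<dots> \<le> (LINT t|lborel. cm_norm M \<mu> * \<bar>g t\<bar>)"
  proof (rule integral_mono)
    show "(\<Sum>B\<in>Q. cmod (T t \<mu> B) * \<bar>g t\<bar>) \<le> cm_norm M \<mu> * \<bar>g t\<bar>" for t
      using psum_T_le[OF wm_cm[OF \<mu>] Q, of t]
      unfolding psum_def sum_distrib_right[symmetric] by (intro mult_right_mono) auto
  qed (use int g in auto)
  finally show "psum Q \<nu> \<le> cm_norm M \<mu> * (LINT t|lborel. \<bar>g t\<bar>)" by simp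
qed

lemma norm_P:
  assumes y: "0 < y" and \<mu>: "\<mu> \<in> wm"
  shows "cm_norm M (P y \<mu>) \<le> cm_norm M \<mu>"
  using norm_integral_le[OF \<mu> poisson_integrable[OF y] P_eq[OF y \<mu>]] poisson_nonneg[OF y] poisson_integral[OF y]
  by simp

text \<open>The translation is moved from the orbit to the kernel. Averages thus have norm
  continuous orbits although the orbit of \<mu> itself is only known to be weakly
  measurable.\<close>

lemma T_P_continuous:
  assumes y: "0 < y" and \<mu>: "\<mu> \<in> wm"
  shows "cm_norm M (\<lambda>A. T s (P y \<mu>) A - P y \<mu> A) \<le> cm_norm M \<mu> * (\<bar>s\<bar> / y + s\<^sup>2 / y\<^sup>2)"
proof -
  have i: "integrable lborel (\<lambda>t. poisson y (t - s) - poisson y t)"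
    using integrable_poisson_shift(1)[OF y] poisson_integrable[OF y] by simp
  have "cm_norm M (\<lambda>A. T s (P y \<mu>) A - P y \<mu> A) \<le>
      cm_norm M \<mu> * (LINT t|lborel. \<bar>poisson y (t - s) - poisson y t\<bar>)"
  proof (rule norm_integral_le[OF \<mu> i])
    fix A assume A: "A \<in> sets M"
    show "T s (P y \<mu>) A - P y \<mu> A = (LINT t|lborel. T t \<mu> A * of_real (poisson y (t - s) - poisson y t))"
      unfolding T_P_eq(2)[OF y \<mu> A] P_eq[OF y \<mu> A]
      using T_poisson_integrable[OF y \<mu>, of A] by (simp add: right_diff_distrib)
  qed
  also have "(LINT t|lborel. \<bar>poisson y (t - s) - poisson y t\<bar>) \<le>
      (LINT t|lborel. poisson y t * (\<bar>s\<bar> / y + s\<^sup>2 / y\<^sup>2))"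
    using i poisson_integrable[OF y] by (intro integral_mono poisson_shift_diff y) auto
  also have "\<dots> = \<bar>s\<bar> / y + s\<^sup>2 / y\<^sup>2" using poisson_integral[OF y] by simp
  finally show ?thesis by (simp add: cm_norm_nonneg mult_left_mono)
qed

lemma P_P:
  assumes a: "0 < a" and b: "0 < b" and \<mu>: "\<mu> \<in> wm"
  shows "P a (P b \<mu>) = P (a + b) \<mu>"
proof
  fix A
  show "P a (P b \<mu>) A = P (a + b) \<mu> A"
  proof (cases "A \<in> sets M")
    case True
    note [measurable] = wm_measurable[OF \<mu>, of A]
    have "P a (P b \<mu>) A = (LINT s|lborel. (LINT t|lborel. T t \<mu> A * of_real (poisson b (t - s))) * of_real (poisson a s))"
      unfolding P_eq[OF a P_wm[OF b \<mu>] True] T_P_eq(2)[OF b \<mu> True] ..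
    also have "\<dots> = (LINT s|lborel. LINT t|lborel. T t \<mu> A * of_real (poisson b (t - s)) * of_real (poisson a s))"
      by simp
    also have "\<dots> = (LINT t|lborel. LINT s|lborel. T t \<mu> A * of_real (poisson b (t - s)) * of_real (poisson a s))"
    proof (rule Fubini_poisson[OF a b, where B = "cm_norm M \<mu>" and c = 1])
      show "(\<lambda>(s, t). T t \<mu> A * of_real (poisson b (t - s)) * of_real (poisson a s)) \<in> borel_measurable (borel \<Otimes>\<^sub>M borel)"
        by measurable
      show "cmod (T t \<mu> A * of_real (poisson b (t - s)) * of_real (poisson a s))
        \<le> cm_norm M \<mu> * (poisson a s * poisson b (t - 1 * s))" for s t
        using poisson_nonneg[OF a, of s] poisson_nonneg[OF b, of "t - s"] T_bound[OF wm_cm[OF \<mu>], of t A]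
        by (simp add: norm_mult mult.assoc mult.commute[of "poisson b _"] mult_right_mono)
    qed
    also have "\<dots> = (LINT t|lborel. T t \<mu> A * of_real (poisson (a + b) t))"
    proof (intro Bochner_Integration.integral_cong refl)
      fix t
      have "(LINT s|lborel. T t \<mu> A * of_real (poisson b (t - s)) * of_real (poisson a s)) =
        (LINT s|lborel. T t \<mu> A * complex_of_real (poisson a s * poisson b (t - s)))"
        by (simp add: ac_simps)
      also have "\<dots> = T t \<mu> A * of_real (LINT s|lborel. poisson a s * poisson b (t - s))"
        by (simp only: integral_mult_right_zero integral_complex_of_real)
      finally show "(LINT s|lborel. T t \<mu> A * of_real (poisson b (t - s)) * of_real (poisson a s)) =
        T t \<mu> A * of_real (poisson (a + b) t)" by (simp only: poisson_conv[OF a b])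
    qed
    also have "\<dots> = P (a + b) \<mu> A" using P_eq[OF _ \<mu> True, of "a + b"] a b by simp
    finally show ?thesis .
  qed (simp add: P_outside)
qed

text \<open>
  Weak analyticity tested against Poisson kernels only. In this form it passes from \<open>\<mu>\<close> to \<open>P y \<mu>\<close>
  by Fubini's theorem.
\<close>

definition analytic :: "('a set \<Rightarrow> complex) \<Rightarrow> bool" where
  "analytic \<mu> \<longleftrightarrow> \<mu> \<in> wm \<and> (\<forall>A\<in>sets M. \<forall>y>0. \<forall>a\<ge>0. \<forall>u.
    (LINT t|lborel. T (t + u) \<mu> A * iexp (a * t) * of_real (poisson y t)) =
    of_real (exp (- (y * a))) * (LINT t|lborel. T (t + u) \<mu> A * of_real (poisson y t)))"

lemma T_shift_measurable: "\<mu> \<in> wm \<Longrightarrow> (\<lambda>t. T (t + u) \<mu> A) \<in> borel_measurable borel"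
  using measurable_compose[OF _ wm_measurable, of "\<lambda>t. t + u" borel] by simp

lemma analytic_of_weakly_analytic:
  assumes "weakly_analytic M T \<mu>"
  shows "analytic \<mu>"
  unfolding analytic_def
proof (intro conjI ballI allI impI)
  show \<mu>: "\<mu> \<in> wm" using assms by (simp add: weakly_analytic_def)
  fix A and y a u :: real assume A: "A \<in> sets M" and y: "0 < y" and a: "0 \<le> a"
  let ?c = "complex_of_real (exp (- (y * a)))"
  let ?g = "\<lambda>t. of_real (poisson y t) * (iexp (a * t) - ?c)"
  \<comment> \<open>The translate by \<open>- u\<close> matches the shifted orbit in the definition
    of \<open>analytic\<close>; a change of variables then moves the shift back onto the
    orbit.\<close>
  have g: "(\<lambda>t. ?g (t + (- u))) \<in> H1" by (rule H1_shift[OF poisson_iexp_H1[OF y a]])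
  have "(\<lambda>t. T t \<mu> A) \<in> Hinf" using assms A by (simp add: weakly_analytic_def)
  then have "\<forall>g\<in>H1. (LINT t|lborel. T t \<mu> A * g t) = 0" by (simp add: Hinf_def)
  then have "(LINT t|lborel. T t \<mu> A * ?g (t + (- u))) = 0" by (rule bspec[OF _ g])
  then have 0: "(LINT t|lborel. T (t + u) \<mu> A * ?g t) = 0"
    using integral_shift[of "\<lambda>t. T t \<mu> A * ?g (t + (- u))" u] by simp
  note [measurable] = T_shift_measurable[OF \<mu>, of u A]
  have i1: "integrable lborel (\<lambda>t. T (t + u) \<mu> A * iexp (a * t) * of_real (poisson y t))"
    by (rule integrable_bounded_poisson(3)[OF y, where B = "cm_norm M \<mu>"])
      (use T_bound[OF wm_cm[OF \<mu>]] in \<open>auto simp: norm_mult\<close>)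
  have i2: "integrable lborel (\<lambda>t. T (t + u) \<mu> A * of_real (poisson y t))"
    by (rule integrable_bounded_poisson(3)[OF y, where B = "cm_norm M \<mu>"])
      (use T_bound[OF wm_cm[OF \<mu>]] in auto)
  have "(LINT t|lborel. T (t + u) \<mu> A * ?g t) =
    (LINT t|lborel. T (t + u) \<mu> A * iexp (a * t) * of_real (poisson y t) - ?c * (T (t + u) \<mu> A * of_real (poisson y t)))"
    by (intro Bochner_Integration.integral_cong refl) (simp only: right_diff_distrib ac_simps)
  also have "\<dots> = (LINT t|lborel. T (t + u) \<mu> A * iexp (a * t) * of_real (poisson y t)) -
     ?c * (LINT t|lborel. T (t + u) \<mu> A * of_real (poisson y t))"
    using i1 i2 by (subst Bochner_Integration.integral_diff) auto
  finally show "(LINT t|lborel. T (t + u) \<mu> A * iexp (a * t) * of_real (poisson y t)) =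
     ?c * (LINT t|lborel. T (t + u) \<mu> A * of_real (poisson y t))" using 0 by simp
qed

lemma analytic_P:
  assumes b: "0 < b" and an: "analytic \<mu>"
  shows "analytic (P b \<mu>)"
  unfolding analytic_def
proof (intro conjI ballI allI impI)
  have \<mu>: "\<mu> \<in> wm" using an by (simp add: analytic_def)
  show "P b \<mu> \<in> wm" by (rule P_wm[OF b \<mu>])
  fix A and y a u :: real assume A: "A \<in> sets M" and y: "0 < y" and a: "0 \<le> a"
  note [measurable] = wm_measurable[OF \<mu>, of A]
  \<comment> \<open>Stated for a general bounded weight \<open>e\<close> because it is used with the
    exponential and with the constant 1.\<close>
  have eq: "(LINT t|lborel. T (t + u) (P b \<mu>) A * e t * of_real (poisson y t)) =
     (LINT s|lborel. (LINT t|lborel. T (t + (s + u)) \<mu> A * e t * of_real (poisson y t)) * of_real (poisson b s))"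
    if e: "e \<in> borel_measurable borel" "\<And>t. cmod (e t) \<le> 1" for e :: "real \<Rightarrow> complex"
  proof -
    note [measurable] = e(1)
    have "(LINT t|lborel. T (t + u) (P b \<mu>) A * e t * of_real (poisson y t)) =
      (LINT t|lborel. LINT s|lborel. T (s + (t + u)) \<mu> A * of_real (poisson b s) * (e t * of_real (poisson y t)))"
      unfolding T_P_eq(1)[OF b \<mu> A]
      by (intro Bochner_Integration.integral_cong refl) (simp only: integral_mult_left_zero, simp only: mult.assoc)
    also have "\<dots> = (LINT s|lborel. LINT t|lborel. T (s + (t + u)) \<mu> A * of_real (poisson b s) * (e t * of_real (poisson y t)))"
    proof (rule Fubini_poisson[OF y b, where B = "cm_norm M \<mu>" and c = 0])
      show "(\<lambda>(t, s). T (s + (t + u)) \<mu> A * of_real (poisson b s) * (e t * of_real (poisson y t))) \<in> borel_measurable (borel \<Otimes>\<^sub>M borel)"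
        by measurable
      fix s t
      have "cmod (T (s + (t + u)) \<mu> A * of_real (poisson b s) * (e t * of_real (poisson y t))) =
        (cmod (T (s + (t + u)) \<mu> A) * cmod (e t)) * (poisson y t * poisson b s)"
        using poisson_nonneg[OF y, of t] poisson_nonneg[OF b, of s] by (simp add: norm_mult)
      also have "\<dots> \<le> (cm_norm M \<mu> * 1) * (poisson y t * poisson b s)"
        using poisson_nonneg[OF y, of t] poisson_nonneg[OF b, of s] T_bound[OF wm_cm[OF \<mu>]] e(2) cm_norm_nonneg
        by (intro mult_right_mono mult_mono) auto
      finally show "cmod (T (s + (t + u)) \<mu> A * of_real (poisson b s) * (e t * of_real (poisson y t)))
        \<le> cm_norm M \<mu> * (poisson y t * poisson b (s - 0 * t))" by simp
    qed
    also have "\<dots> = (LINT s|lborel. (LINT t|lborel. T (t + (s + u)) \<mu> A * e t * of_real (poisson y t)) * of_real (poisson b s))"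
    proof (intro Bochner_Integration.integral_cong refl)
      fix s
      have "T (s + (t + u)) \<mu> A * of_real (poisson b s) * (e t * of_real (poisson y t)) =
        (T (t + (s + u)) \<mu> A * e t * of_real (poisson y t)) * of_real (poisson b s)" for t
      proof -
        have "s + (t + u) = t + (s + u)" by simp
        then show ?thesis by (simp only: mult.assoc mult.commute mult.left_commute)
      qed
      then show "(LINT t|lborel. T (s + (t + u)) \<mu> A * of_real (poisson b s) * (e t * of_real (poisson y t))) =
        (LINT t|lborel. T (t + (s + u)) \<mu> A * e t * of_real (poisson y t)) * of_real (poisson b s)"
        by (simp only: integral_mult_left_zero)
    qed
    finally show ?thesis .
  qed
  let ?c = "complex_of_real (exp (- (y * a)))"
  have "(LINT t|lborel. T (t + u) (P b \<mu>) A * iexp (a * t) * of_real (poisson y t)) =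
    (LINT s|lborel. (LINT t|lborel. T (t + (s + u)) \<mu> A * iexp (a * t) * of_real (poisson y t)) * of_real (poisson b s))"
    by (rule eq) auto
  also have "\<dots> = (LINT s|lborel. ?c * ((LINT t|lborel. T (t + (s + u)) \<mu> A * of_real (poisson y t)) * of_real (poisson b s)))"
  proof (intro Bochner_Integration.integral_cong refl)
    fix s
    have "(LINT t|lborel. T (t + (s + u)) \<mu> A * iexp (a * t) * of_real (poisson y t)) =
      ?c * (LINT t|lborel. T (t + (s + u)) \<mu> A * of_real (poisson y t))"
      using an A y a unfolding analytic_def by blast
    then show "(LINT t|lborel. T (t + (s + u)) \<mu> A * iexp (a * t) * of_real (poisson y t)) * of_real (poisson b s) =
      ?c * ((LINT t|lborel. T (t + (s + u)) \<mu> A * of_real (poisson y t)) * of_real (poisson b s))"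
      by (simp only: mult.assoc)
  qed
  also have "\<dots> = ?c * (LINT s|lborel. (LINT t|lborel. T (t + (s + u)) \<mu> A * of_real (poisson y t)) * of_real (poisson b s))"
    by (rule integral_mult_right_zero)
  also have "(LINT s|lborel. (LINT t|lborel. T (t + (s + u)) \<mu> A * of_real (poisson y t)) * of_real (poisson b s)) =
    (LINT t|lborel. T (t + u) (P b \<mu>) A * of_real (poisson y t))"
    using eq[of "\<lambda>_. 1"] by simp
  finally show "(LINT t|lborel. T (t + u) (P b \<mu>) A * iexp (a * t) * of_real (poisson y t)) =
     ?c * (LINT t|lborel. T (t + u) (P b \<mu>) A * of_real (poisson y t))" .
qed

lemma analytic_wm: "analytic \<mu> \<Longrightarrow> \<mu> \<in> wm"
  by (simp add: analytic_def)

text \<open>Each block contributes a square root of its deficit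
  \<open>w B - cmod (P y \<mu> B)\<close> times a sum of moduli. Isometry bounds the total of the
  \<open>w B\<close> by the norm of \<mu>, so the deficits add up to at most that norm minus
  \<open>psum Q (P y \<mu>)\<close>, independently of the number of blocks.\<close>

lemma mean_psum_le:
  assumes an: "analytic \<mu>" and y: "0 < y" and Q: "Q \<in> set_families M"
  shows "(LINT t|lborel. psum Q (\<lambda>A. T t \<mu> A - P y \<mu> A) * poisson y t) \<le>
    7 * sqrt (2 * cm_norm M \<mu> * (cm_norm M \<mu> - psum Q (P y \<mu>)))"
    and "integrable lborel (\<lambda>t. psum Q (\<lambda>A. T t \<mu> A - P y \<mu> A) * poisson y t)"
proof -
  let ?N = "cm_norm M \<mu>"
  have \<mu>: "\<mu> \<in> wm" by (rule analytic_wm[OF an])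
  note cm = wm_cm[OF \<mu>]
  have fin: "finite Q" and Qs: "\<And>B. B \<in> Q \<Longrightarrow> B \<in> sets M" using Q by (auto simp: set_families_def)
  define w where "w B = (LINT t|lborel. cmod (T t \<mu> B) * poisson y t)" for B
  have dev: "(LINT t|lborel. cmod (T t \<mu> B - P y \<mu> B) * poisson y t) \<le>
      7 * sqrt ((w B - cmod (P y \<mu> B)) * (w B + cmod (P y \<mu> B)))" "cmod (P y \<mu> B) \<le> w B" if B: "B \<in> Q" for B
  proof -
    have an': "(LINT t|lborel. T t \<mu> B * iexp (a * t) * of_real (poisson y t)) =
      of_real (exp (- (y * a))) * (LINT t|lborel. T t \<mu> B * of_real (poisson y t))" if "0 \<le> a" for a
    proof -
      have "(LINT t|lborel. T (t + 0) \<mu> B * iexp (a * t) * of_real (poisson y t)) =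
        of_real (exp (- (y * a))) * (LINT t|lborel. T (t + 0) \<mu> B * of_real (poisson y t))"
        using an Qs[OF B] y that unfolding analytic_def by blast
      then show ?thesis by (simp only: add_0_right)
    qed
    note * = poisson_mean_deviation[OF y wm_measurable[OF \<mu>, of B] T_bound[OF cm] an', folded P_eq[OF y \<mu> Qs[OF B]] w_def]
    show "(LINT t|lborel. cmod (T t \<mu> B - P y \<mu> B) * poisson y t) \<le>
      7 * sqrt ((w B - cmod (P y \<mu> B)) * (w B + cmod (P y \<mu> B)))" by (rule *(1))
    show "cmod (P y \<mu> B) \<le> w B" by (rule *(2))
  qed
  have int1: "integrable lborel (\<lambda>t. cmod (T t \<mu> B - c) * poisson y t)" for B c
  proof -
    have "integrable lborel (\<lambda>t. (T t \<mu> B - c) * of_real (poisson y t))"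
      using T_poisson_integrable(1)[OF y \<mu>, of B] poisson_of_real_integrable[OF y] by (simp add: left_diff_distrib)
    from integrable_norm[OF this] show ?thesis using poisson_nonneg[OF y] by (simp add: norm_mult)
  qed
  have psum_eq: "psum Q \<nu> * poisson y t = (\<Sum>B\<in>Q. cmod (\<nu> B) * poisson y t)" for \<nu> t
    by (simp add: psum_def sum_distrib_right)
  show "integrable lborel (\<lambda>t. psum Q (\<lambda>A. T t \<mu> A - P y \<mu> A) * poisson y t)"
    unfolding psum_eq by (intro Bochner_Integration.integrable_sum int1)
  have "(\<Sum>B\<in>Q. w B) = (LINT t|lborel. psum Q (T t \<mu>) * poisson y t)"
    unfolding psum_eq w_def using int1[of _ 0] by (intro Bochner_Integration.integral_sum[symmetric]) auto
  also have "\<dots> \<le> (LINT t|lborel. ?N * poisson y t)"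
  proof (rule integral_mono)
    show "integrable lborel (\<lambda>t. psum Q (T t \<mu>) * poisson y t)"
      unfolding psum_eq using int1[of _ 0] by (intro Bochner_Integration.integrable_sum) simp
    show "psum Q (T t \<mu>) * poisson y t \<le> ?N * poisson y t" for t
      by (intro mult_right_mono psum_T_le cm Q poisson_nonneg[OF y])
  qed (use poisson_integrable[OF y] in simp)
  also have "\<dots> = ?N" using poisson_integral[OF y] by simp
  finally have sw: "(\<Sum>B\<in>Q. w B) \<le> ?N" .
  have p: "psum Q (P y \<mu>) \<le> ?N"
    using psum_le_norm[OF P_cm[OF y \<mu>] Q] norm_P[OF y \<mu>] by linarith
  have "(LINT t|lborel. psum Q (\<lambda>A. T t \<mu> A - P y \<mu> A) * poisson y t) =
      (\<Sum>B\<in>Q. LINT t|lborel. cmod (T t \<mu> B - P y \<mu> B) * poisson y t)"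
    unfolding psum_eq by (intro Bochner_Integration.integral_sum int1)
  also have "\<dots> \<le> (\<Sum>B\<in>Q. 7 * sqrt ((w B - cmod (P y \<mu> B)) * (w B + cmod (P y \<mu> B))))"
    by (intro sum_mono dev)
  also have "\<dots> = 7 * (\<Sum>B\<in>Q. sqrt ((w B - cmod (P y \<mu> B)) * (w B + cmod (P y \<mu> B))))"
    by (simp add: sum_distrib_left)
  also have "\<dots> \<le> 7 * sqrt ((\<Sum>B\<in>Q. w B - cmod (P y \<mu> B)) * (\<Sum>B\<in>Q. w B + cmod (P y \<mu> B)))"
  proof -
    have "0 \<le> w B - cmod (P y \<mu> B)" "0 \<le> w B + cmod (P y \<mu> B)" if "B \<in> Q" for B
      using dev(2)[OF that] norm_ge_zero[of "P y \<mu> B"] by linarith+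
    then show ?thesis using sum_sqrt_le[OF fin, of "\<lambda>B. w B - cmod (P y \<mu> B)" "\<lambda>B. w B + cmod (P y \<mu> B)"] by simp
  qed
  also have "\<dots> \<le> 7 * sqrt (2 * ?N * (?N - psum Q (P y \<mu>)))"
  proof -
    have 1: "(\<Sum>B\<in>Q. w B - cmod (P y \<mu> B)) = (\<Sum>B\<in>Q. w B) - psum Q (P y \<mu>)"
      by (simp add: psum_def sum_subtractf)
    have 2: "(\<Sum>B\<in>Q. w B + cmod (P y \<mu> B)) = (\<Sum>B\<in>Q. w B) + psum Q (P y \<mu>)"
      by (simp add: psum_def sum.distrib)
    have 3: "psum Q (P y \<mu>) \<le> (\<Sum>B\<in>Q. w B)" unfolding psum_def by (intro sum_mono dev(2))
    have "((\<Sum>B\<in>Q. w B) - psum Q (P y \<mu>)) * ((\<Sum>B\<in>Q. w B) + psum Q (P y \<mu>)) \<le> (?N - psum Q (P y \<mu>)) * (2 * ?N)"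
      using sw p 3 psum_nonneg[of Q "P y \<mu>"] by (intro mult_mono) auto
    then show ?thesis unfolding 1 2 by (simp add: mult.commute)
  qed
  finally show "(LINT t|lborel. psum Q (\<lambda>A. T t \<mu> A - P y \<mu> A) * poisson y t) \<le>
    7 * sqrt (2 * cm_norm M \<mu> * (cm_norm M \<mu> - psum Q (P y \<mu>)))" .
qed

end

section \<open>Continuity of analytic orbits\<close>

text \<open>On \<open>[-u, u]\<close> the kernel is at least \<open>1 / (2 * pi * u)\<close> and the
  interval has length \<open>2 * u\<close>, so a fraction of at least \<open>1 / pi\<close>
  survives.\<close>

lemma poisson_lower_bound:
  assumes u: "0 < u" and i: "integrable lborel (\<lambda>t. \<psi> t * poisson u t)"
    and nn: "\<And>t. 0 \<le> \<psi> t" and c: "0 \<le> c" "\<And>t. \<bar>t\<bar> \<le> u \<Longrightarrow> c \<le> \<psi> t"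
  shows "c \<le> pi * (LINT t|lborel. \<psi> t * poisson u t)"
proof -
  have "(LINT t|lborel. (c / (2 * pi * u)) * indicator {-u..u} t) \<le> (LINT t|lborel. \<psi> t * poisson u t)"
  proof (rule integral_mono[OF _ i])
    show "integrable lborel (\<lambda>t. (c / (2 * pi * u)) * indicator {-u..u} t)"
      by (intro integrable_mult_right integrable_real_indicator) (auto simp: emeasure_lborel_Icc_eq)
    fix t
    show "(c / (2 * pi * u)) * indicator {-u..u} t \<le> \<psi> t * poisson u t"
    proof (cases "t \<in> {-u..u}")
      case True
      then have t: "\<bar>t\<bar> \<le> u" by auto
      have "t\<^sup>2 \<le> u\<^sup>2" using t u by (intro abs_le_square_iff[THEN iffD1]) auto
      then have "u / (pi * (u\<^sup>2 + u\<^sup>2)) \<le> poisson u t"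
        unfolding poisson_def using u by (intro divide_left_mono mult_left_mono mult_pos_pos) (auto simp: add_nonneg_pos)
      moreover have "u / (pi * (u\<^sup>2 + u\<^sup>2)) = 1 / (2 * pi * u)" using u by (simp add: power2_eq_square)
      ultimately have "c * (1 / (2 * pi * u)) \<le> \<psi> t * poisson u t"
        using c t nn u by (intro mult_mono) auto
      then show ?thesis using True by simp
    next
      case False
      then show ?thesis using nn[of t] poisson_nonneg[OF u] by simp
    qed
  qed
  moreover have "(LINT t|lborel. (c / (2 * pi * u)) * indicator {-u..u} t) = c / pi"
    using u by simp
  ultimately have "c / pi \<le> (LINT t|lborel. \<psi> t * poisson u t)" by simp
  then show ?thesis by (simp add: divide_le_eq mult.commute)
qed

lemma grid_point:
  fixes t u d :: real
  assumes "0 < d" "\<bar>t\<bar> \<le> u" "2 * u / d \<le> real n"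
  shows "\<exists>j\<le>n. \<bar>t - (- u + real j * d)\<bar> \<le> d"
proof -
  define x where "x = (t + u) / d"
  have x: "0 \<le> x" using assms by (simp add: x_def abs_le_iff)
  define j where "j = nat \<lfloor>x\<rfloor>"
  have jx: "real j \<le> x" "x < real j + 1" using x by (auto simp: j_def)
  have "x \<le> 2 * u / d" using assms by (simp add: x_def divide_right_mono)
  then have "real j \<le> real n" using jx assms(3) by linarith
  moreover have "real j * d \<le> t + u" "t + u < (real j + 1) * d"
    using jx assms(1) by (auto simp: x_def field_simps)
  then have "\<bar>t - (- u + real j * d)\<bar> \<le> d" by (simp add: abs_le_iff algebra_simps)
  ultimately show ?thesis by auto
qed

lemma psum_le_diff: "psum Q \<mu> \<le> psum Q (\<lambda>A. \<mu> A - \<nu> A) + psum Q \<nu>"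
  using psum_triangle[of Q "\<lambda>A. \<mu> A - \<nu> A" \<nu>] by simp

context isometric_rep
begin

section \<open>Norm convergence of the averages\<close>

lemma wm_diff:
  assumes "\<mu> \<in> wm" "\<nu> \<in> wm"
  shows "(\<lambda>A. \<mu> A - \<nu> A) \<in> wm"
proof (rule wmI)
  show "(\<lambda>A. \<mu> A - \<nu> A) \<in> complex_measures M" by (intro cm_diff wm_cm assms)
  show "(\<lambda>t. T t (\<lambda>A. \<mu> A - \<nu> A) A) \<in> borel_measurable borel" for A
    using wm_measurable[OF assms(1), of A] wm_measurable[OF assms(2), of A]
    by (simp add: T_diff[OF wm_cm[OF assms(1)] wm_cm[OF assms(2)]])
qed

lemma psum_poisson_integrable:
  assumes "\<nu> \<in> wm" "0 < y"
  shows "integrable lborel (\<lambda>t. psum Q (T t \<nu>) * poisson y t)"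
proof -
  have int: "integrable lborel (\<lambda>t. cmod (T t \<nu> B) * poisson y t)" for B
    using integrable_norm[OF T_poisson_integrable(1)[OF assms(2,1), of B]] poisson_nonneg[OF assms(2)]
    by (simp add: norm_mult)
  show ?thesis unfolding psum_def sum_distrib_right by (intro Bochner_Integration.integrable_sum int)
qed

text \<open>By the semigroup law \<open>P u \<mu>\<close> is the average at height
  \<open>u - y\<close> of \<open>P y \<mu>\<close>, so \<open>mean_psum_le\<close> applies to the
  latter. Returning from height \<open>u - y\<close> to \<open>u\<close> doubles the constant
  7.\<close>

lemma P_step:
  assumes an: "analytic \<mu>" and L: "\<And>y. 0 < y \<Longrightarrow> cm_norm M (P y \<mu>) \<le> L"
    and u: "L - e < cm_norm M (P u \<mu>)" and e: "0 < e" and y: "0 < y" "y \<le> u / 2"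
    and R: "R \<in> set_families M" "cm_norm M (P u \<mu>) - e < psum R (P u \<mu>)"
  shows "(LINT t|lborel. psum R (\<lambda>A. T t (P y \<mu>) A - P u \<mu> A) * poisson u t) \<le> 14 * sqrt (4 * L * e)"
    and "integrable lborel (\<lambda>t. psum R (\<lambda>A. T t (P y \<mu>) A - P u \<mu> A) * poisson u t)"
proof -
  have pos: "0 < u - y" "0 < u" using y by auto
  have \<mu>: "\<mu> \<in> wm" by (rule analytic_wm[OF an])
  have PP: "P (u - y) (P y \<mu>) = P u \<mu>" using P_P[OF pos(1) y(1) \<mu>] by simp
  note mean = mean_psum_le[OF analytic_P[OF y(1) an] pos(1) R(1), unfolded PP]
  let ?\<psi> = "\<lambda>t. psum R (\<lambda>A. T t (P y \<mu>) A - P u \<mu> A)"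
  have le: "?\<psi> t * poisson u t \<le> 2 * (?\<psi> t * poisson (u - y) t)" for t
  proof -
    have "?\<psi> t * poisson u t \<le> ?\<psi> t * (2 * poisson (u - y) t)"
      using y by (intro mult_left_mono poisson_le_twice psum_nonneg) auto
    then show ?thesis by simp
  qed
  have cmod_m: "(\<lambda>t. cmod (T t (P y \<mu>) B - P u \<mu> B)) \<in> borel_measurable borel" for B
    using wm_measurable[OF P_wm[OF y(1) \<mu>], of B] by measurable
  have psum_m: "(\<lambda>t. ?\<psi> t) \<in> borel_measurable borel"
    unfolding psum_def by (intro borel_measurable_sum cmod_m)
  show int: "integrable lborel (\<lambda>t. ?\<psi> t * poisson u t)"
  proof (rule Bochner_Integration.integrable_bound)
    show "integrable lborel (\<lambda>t. 2 * (?\<psi> t * poisson (u - y) t))" using mean(2) by simp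
    show "(\<lambda>t. ?\<psi> t * poisson u t) \<in> borel_measurable lborel" using psum_m by simp
    show "AE t in lborel. norm (?\<psi> t * poisson u t) \<le> norm (2 * (?\<psi> t * poisson (u - y) t))"
    proof (rule AE_I2)
      fix t
      have "0 \<le> ?\<psi> t * poisson u t"
        by (intro mult_nonneg_nonneg psum_nonneg poisson_nonneg pos)
      then show "norm (?\<psi> t * poisson u t) \<le> norm (2 * (?\<psi> t * poisson (u - y) t))"
        using le[of t] unfolding real_norm_def by linarith
    qed
  qed
  let ?N = "cm_norm M (P y \<mu>)"
  have N: "?N \<le> L" "0 \<le> ?N" by (rule L[OF y(1)]) (rule cm_norm_nonneg)
  have "psum R (P u \<mu>) \<le> cm_norm M (P u \<mu>)" by (rule psum_le_norm[OF P_cm[OF pos(2) \<mu>] R(1)])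
  also have "\<dots> \<le> ?N" using norm_P[OF pos(1) P_wm[OF y(1) \<mu>]] by (simp only: PP)
  finally have "0 \<le> ?N - psum R (P u \<mu>)" by simp
  \<comment> \<open>One \<open>e\<close> comes from near-maximality of the norm at \<open>u\<close>,
    the other from near-optimality of the partition \<open>R\<close>.\<close>
  moreover have "?N - psum R (P u \<mu>) \<le> 2 * e" using N(1) R(2) u by linarith
  ultimately have "2 * ?N * (?N - psum R (P u \<mu>)) \<le> 2 * L * (2 * e)"
    using N by (intro mult_mono) auto
  then have sq: "sqrt (2 * ?N * (?N - psum R (P u \<mu>))) \<le> sqrt (4 * L * e)" by simp
  have "(LINT t|lborel. ?\<psi> t * poisson u t) \<le> (LINT t|lborel. 2 * (?\<psi> t * poisson (u - y) t))"
    using int mean(2) le by (intro integral_mono) auto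
  also have "\<dots> = 2 * (LINT t|lborel. ?\<psi> t * poisson (u - y) t)" by simp
  also have "\<dots> \<le> 2 * (7 * sqrt (4 * L * e))" using mean(1) sq by linarith
  finally show "(LINT t|lborel. ?\<psi> t * poisson u t) \<le> 14 * sqrt (4 * L * e)" by simp
qed

text \<open>In the mean over \<open>t\<close>, the translates of both averages are close to the same
  measure \<open>P u \<mu>\<close>, so the translates of their difference \<rho> are small; but
  these all have the norm of \<rho>. The mean estimate holds for one fixed partition, so a partition
  that detects the norm of \<open>T t \<rho>\<close> for all \<open>t\<close> in
  \<open>[-u, u]\<close> is needed.\<close>

lemma P_cauchy_bound:
  assumes an: "analytic \<mu>" and L: "\<And>y. 0 < y \<Longrightarrow> cm_norm M (P y \<mu>) \<le> L"
    and u: "L - e < cm_norm M (P u \<mu>)" and e: "0 < e"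
    and y1: "0 < y1" "y1 \<le> u / 2" and y2: "0 < y2" "y2 \<le> u / 2"
  shows "cm_norm M (\<lambda>A. P y1 \<mu> A - P y2 \<mu> A) \<le> 2 * e + 28 * pi * sqrt (4 * L * e)"
proof -
  have \<mu>: "\<mu> \<in> wm" by (rule analytic_wm[OF an])
  have u0: "0 < u" using y1 by simp
  let ?N = "cm_norm M \<mu>"
  define \<rho> where "\<rho> = (\<lambda>A. P y1 \<mu> A - P y2 \<mu> A)"
  have \<rho>: "\<rho> \<in> wm" unfolding \<rho>_def by (intro wm_diff P_wm y1 y2 \<mu>)
  note cm\<rho> = wm_cm[OF \<rho>] and cm1 = P_cm[OF y1(1) \<mu>] and cm2 = P_cm[OF y2(1) \<mu>]
  \<comment> \<open>A modulus of continuity for the orbit of \<rho>. It may depend badly on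
    \<open>y1\<close> and \<open>y2\<close>, since it only determines how fine the grid is.\<close>
  define \<phi> where "\<phi> s = ?N * (\<bar>s\<bar> / y1 + s\<^sup>2 / y1\<^sup>2) + ?N * (\<bar>s\<bar> / y2 + s\<^sup>2 / y2\<^sup>2)" for s
  have T\<rho>: "cm_norm M (\<lambda>A. T s \<rho> A - \<rho> A) \<le> \<phi> s" for s
  proof -
    have "(\<lambda>A. T s \<rho> A - \<rho> A) = (\<lambda>A. (T s (P y1 \<mu>) A - P y1 \<mu> A) - (T s (P y2 \<mu>) A - P y2 \<mu> A))"
      unfolding \<rho>_def T_diff[OF cm1 cm2] by (intro ext) simp
    then have "cm_norm M (\<lambda>A. T s \<rho> A - \<rho> A) \<le>
      cm_norm M (\<lambda>A. T s (P y1 \<mu>) A - P y1 \<mu> A) + cm_norm M (\<lambda>A. T s (P y2 \<mu>) A - P y2 \<mu> A)"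
      using cm_norm_triangle_diff[OF cm_diff[OF T_cm[OF cm1] cm1] cm_diff[OF T_cm[OF cm2] cm2], of s s] by simp
    also have "\<dots> \<le> \<phi> s" unfolding \<phi>_def by (intro add_mono T_P_continuous y1 y2 \<mu>)
    finally show ?thesis .
  qed
  have "isCont \<phi> 0" unfolding \<phi>_def using y1 y2 by (intro continuous_intros) auto
  then obtain d where d: "0 < d" "\<And>s. dist s 0 < d \<Longrightarrow> dist (\<phi> s) (\<phi> 0) < e"
    using e unfolding continuous_at_eps_delta by blast
  have small: "\<phi> s \<le> e" if "\<bar>s\<bar> \<le> d / 2" for s
  proof -
    have "dist (\<phi> s) (\<phi> 0) < e" using that d(1) by (intro d(2)) simp
    then show ?thesis by (simp add: dist_real_def \<phi>_def)
  qed
  obtain n :: nat where n: "2 * u / (d / 2) \<le> real n" using real_arch_simple by blast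
  let ?t = "\<lambda>j. - u + real j * (d / 2)"
  let ?F = "insert (P u \<mu>) ((\<lambda>j. T (?t j) \<rho>) ` {..n})"
  have "\<exists>R\<in>partitions M (space M). \<forall>\<nu>\<in>?F. cm_norm M \<nu> - e < psum R \<nu>"
    using T_cm[OF cm\<rho>] P_cm[OF u0 \<mu>] e by (intro cm_norm_approx_finite) auto
  then obtain R where R0: "R \<in> partitions M (space M)" and R1: "cm_norm M (P u \<mu>) - e < psum R (P u \<mu>)"
    and R2: "\<And>j. j \<le> n \<Longrightarrow> cm_norm M (T (?t j) \<rho>) - e < psum R (T (?t j) \<rho>)" by auto
  note R = partitions_subset_families[OF R0]
  \<comment> \<open>One \<open>e\<close> is lost by moving to a grid point and one by the
    partition.\<close>
  have lower: "cm_norm M \<rho> - 2 * e \<le> psum R (T t \<rho>)" if t: "\<bar>t\<bar> \<le> u" for t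
  proof -
    obtain j where j: "j \<le> n" "\<bar>t - ?t j\<bar> \<le> d / 2" using grid_point[OF _ t n] d(1) by auto
    have eq: "T t \<rho> = T (?t j) (T (t - ?t j) \<rho>)" using T_T[OF cm\<rho>, of "?t j" "t - ?t j"] by simp
    have "psum R (T (?t j) \<rho>) \<le> psum R (\<lambda>A. T (?t j) \<rho> A - T t \<rho> A) + psum R (T t \<rho>)"
      by (rule psum_le_diff)
    also have "psum R (\<lambda>A. T (?t j) \<rho> A - T t \<rho> A) \<le> cm_norm M (\<lambda>A. T (?t j) \<rho> A - T t \<rho> A)"
      by (intro psum_le_norm R cm_diff T_cm cm\<rho>)
    also have "\<dots> = cm_norm M (\<lambda>A. \<rho> A - T (t - ?t j) \<rho> A)"
      unfolding eq by (intro T_norm_diff T_cm cm\<rho>)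
    also have "\<dots> = cm_norm M (\<lambda>A. T (t - ?t j) \<rho> A - \<rho> A)" by (rule cm_norm_diff_commute)
    also have "\<dots> \<le> e" using T\<rho> small[OF j(2)] by (rule order_trans)
    finally have "psum R (T (?t j) \<rho>) \<le> e + psum R (T t \<rho>)" by simp
    then show ?thesis using R2[OF j(1)] T_norm[OF cm\<rho>, of "?t j"] by linarith
  qed
  show ?thesis
  proof (cases "cm_norm M \<rho> \<le> 2 * e")
    case True
    have "0 \<le> L" using L[OF u0] cm_norm_nonneg[of M "P u \<mu>"] by linarith
    then have "0 \<le> 28 * pi * sqrt (4 * L * e)" using e by simp
    then show ?thesis using True unfolding \<rho>_def by linarith
  next
    case False
    note s1 = P_step[OF an L u e y1 R R1] and s2 = P_step[OF an L u e y2 R R1]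
    have "cm_norm M \<rho> - 2 * e \<le> pi * (LINT t|lborel. psum R (T t \<rho>) * poisson u t)"
      using False by (intro poisson_lower_bound u0 psum_poisson_integrable \<rho> psum_nonneg lower) auto
    also have "(LINT t|lborel. psum R (T t \<rho>) * poisson u t) \<le>
      (LINT t|lborel. psum R (\<lambda>A. T t (P y1 \<mu>) A - P u \<mu> A) * poisson u t +
        psum R (\<lambda>A. T t (P y2 \<mu>) A - P u \<mu> A) * poisson u t)"
    proof (rule integral_mono)
      show "integrable lborel (\<lambda>t. psum R (T t \<rho>) * poisson u t)" by (intro psum_poisson_integrable \<rho> u0)
      show "psum R (T t \<rho>) * poisson u t \<le> psum R (\<lambda>A. T t (P y1 \<mu>) A - P u \<mu> A) * poisson u t +
        psum R (\<lambda>A. T t (P y2 \<mu>) A - P u \<mu> A) * poisson u t" for t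
      proof -
        have "T t \<rho> = (\<lambda>A. (T t (P y1 \<mu>) A - P u \<mu> A) - (T t (P y2 \<mu>) A - P u \<mu> A))"
          unfolding \<rho>_def T_diff[OF cm1 cm2] by (intro ext) simp
        then have "psum R (T t \<rho>) \<le> psum R (\<lambda>A. T t (P y1 \<mu>) A - P u \<mu> A) + psum R (\<lambda>A. T t (P y2 \<mu>) A - P u \<mu> A)"
          using psum_triangle_diff[of R "\<lambda>A. T t (P y1 \<mu>) A - P u \<mu> A" "\<lambda>A. T t (P y2 \<mu>) A - P u \<mu> A"] by simp
        then show ?thesis unfolding distrib_right[symmetric]
          by (intro mult_right_mono poisson_nonneg u0)
      qed
    qed (use s1(2) s2(2) in auto)
    also have "\<dots> = (LINT t|lborel. psum R (\<lambda>A. T t (P y1 \<mu>) A - P u \<mu> A) * poisson u t) +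
        (LINT t|lborel. psum R (\<lambda>A. T t (P y2 \<mu>) A - P u \<mu> A) * poisson u t)"
      using s1(2) s2(2) by (rule Bochner_Integration.integral_add)
    also have "\<dots> \<le> 14 * sqrt (4 * L * e) + 14 * sqrt (4 * L * e)" by (intro add_mono s1(1) s2(1))
    finally have "cm_norm M \<rho> - 2 * e \<le> pi * (14 * sqrt (4 * L * e) + 14 * sqrt (4 * L * e))" by simp
    then show ?thesis unfolding \<rho>_def by simp
  qed
qed

definition yseq :: "nat \<Rightarrow> real" where "yseq n = 1 / real (Suc n)"

lemma yseq: "0 < yseq n" "yseq n \<le> 1" "yseq \<longlonglongrightarrow> 0"
  unfolding yseq_def[abs_def] using LIMSEQ_Suc[OF lim_1_over_n[where 'a = real]] by auto

lemma P_limit: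
  assumes an: "analytic \<mu>"
  obtains \<nu> where "\<nu> \<in> complex_measures M" "(\<lambda>n. cm_norm M (\<lambda>A. P (yseq n) \<mu> A - \<nu> A)) \<longlonglongrightarrow> 0"
proof -
  have \<mu>: "\<mu> \<in> wm" by (rule analytic_wm[OF an])
  let ?S = "{cm_norm M (P y \<mu>) |y. 0 < y}"
  define L where "L = Sup ?S"
  have bdd: "bdd_above ?S" using norm_P[OF _ \<mu>] by (auto intro!: bdd_aboveI[of _ "cm_norm M \<mu>"])
  have ne: "?S \<noteq> {}" using zero_less_one by blast
  have L: "cm_norm M (P y \<mu>) \<le> L" if "0 < y" for y
    unfolding L_def using that by (intro cSup_upper[OF _ bdd]) auto
  have cauchy: "\<exists>N. \<forall>m\<ge>N. \<forall>n\<ge>N. cm_norm M (\<lambda>A. P (yseq m) \<mu> A - P (yseq n) \<mu> A) \<le> \<eta>" if \<eta>: "0 < \<eta>" for \<eta>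
  proof -
    \<comment> \<open>Here \<open>yseq\<close> plays the role of the tolerance \<open>e\<close>;
      later in the same argument it is the sequence of heights.\<close>
    have "(\<lambda>n. 2 * yseq n + 28 * pi * sqrt (4 * L * yseq n)) \<longlonglongrightarrow> 2 * 0 + 28 * pi * sqrt (4 * L * 0)"
      by (intro tendsto_intros yseq)
    then have "eventually (\<lambda>n. 2 * yseq n + 28 * pi * sqrt (4 * L * yseq n) < \<eta>) sequentially"
      using \<eta> by (intro order_tendstoD(2)) auto
    then obtain k where k: "2 * yseq k + 28 * pi * sqrt (4 * L * yseq k) < \<eta>"
      by (auto simp: eventually_sequentially)
    have "L - yseq k < Sup ?S" using yseq(1)[of k] by (simp add: L_def)
    then have "\<exists>x\<in>?S. L - yseq k < x" using less_cSup_iff[OF ne bdd] by blast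
    then obtain u where u: "0 < u" "L - yseq k < cm_norm M (P u \<mu>)" by auto
    have "eventually (\<lambda>n. yseq n < u / 2) sequentially"
      using u(1) by (intro order_tendstoD(2)[OF yseq(3)]) auto
    then obtain N where N: "\<And>n. N \<le> n \<Longrightarrow> yseq n < u / 2" by (auto simp: eventually_sequentially)
    have "cm_norm M (\<lambda>A. P (yseq m) \<mu> A - P (yseq n) \<mu> A) \<le> \<eta>" if "N \<le> m" "N \<le> n" for m n
      using P_cauchy_bound[OF an L u(2) yseq(1) yseq(1) less_imp_le[OF N[OF that(1)]] yseq(1) less_imp_le[OF N[OF that(2)]]] k
      by linarith
    then show ?thesis by blast
  qed
  show ?thesis
    by (rule cm_complete[of "\<lambda>n. P (yseq n) \<mu>" M]) (use P_cm[OF yseq(1) \<mu>] cauchy that in auto)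
qed

text \<open>Isometry makes the convergence of the averaged orbits uniform in \<open>t\<close>, so
  continuity passes to the limit by an \<open>e / 3\<close> argument.\<close>

lemma limit_orbit:
  assumes \<mu>: "\<mu> \<in> wm" and \<nu>: "\<nu> \<in> complex_measures M"
    and lim: "(\<lambda>n. cm_norm M (\<lambda>A. P (yseq n) \<mu> A - \<nu> A)) \<longlonglongrightarrow> 0"
  shows "(\<lambda>n. T t (P (yseq n) \<mu>) A) \<longlonglongrightarrow> T t \<nu> A"
    and "isCont (\<lambda>t. T t \<nu> A) t"
proof -
  note cmP = P_cm[OF yseq(1) \<mu>]
  have d: "cmod (T t (P (yseq n) \<mu>) A - T t \<nu> A) \<le> cm_norm M (\<lambda>A. P (yseq n) \<mu> A - \<nu> A)" for n t
    unfolding T_norm_diff[OF cmP[of n] \<nu>, of t, symmetric]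
    by (rule cmod_le_norm[OF cm_diff[OF T_cm[OF cmP] T_cm[OF \<nu>]]])
  show "(\<lambda>n. T t (P (yseq n) \<mu>) A) \<longlonglongrightarrow> T t \<nu> A"
    by (rule LIM_zero_cancel) (rule Lim_null_comparison[OF always_eventually lim], use d in blast)
  show "isCont (\<lambda>t. T t \<nu> A) t"
    unfolding continuous_at_eps_delta
  proof (intro allI impI)
    fix e :: real assume e: "0 < e"
    then have "eventually (\<lambda>n. cm_norm M (\<lambda>A. P (yseq n) \<mu> A - \<nu> A) < e / 3) sequentially"
      by (intro order_tendstoD(2)[OF lim]) auto
    then obtain n where n: "cm_norm M (\<lambda>A. P (yseq n) \<mu> A - \<nu> A) < e / 3"
      by (auto simp: eventually_sequentially)
    let ?y = "yseq n"
    define \<phi> where "\<phi> s = cm_norm M \<mu> * (\<bar>s\<bar> / ?y + s\<^sup>2 / ?y\<^sup>2)" for s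
    have "isCont \<phi> 0" unfolding \<phi>_def using yseq(1)[of n] by (intro continuous_intros) auto
    then obtain k where k: "0 < k" "\<And>s. dist s 0 < k \<Longrightarrow> dist (\<phi> s) (\<phi> 0) < e / 3"
      using e unfolding continuous_at_eps_delta by (metis divide_pos_pos zero_less_numeral)
    have "dist (T t' \<nu> A) (T t \<nu> A) < e" if t': "dist t' t < k" for t'
    proof -
      have "T t' (P ?y \<mu>) = T t (T (t' - t) (P ?y \<mu>))" using T_T[OF cmP[of n], of t "t' - t"] by simp
      then have "cmod (T t' (P ?y \<mu>) A - T t (P ?y \<mu>) A) =
          cmod (T t (T (t' - t) (P ?y \<mu>)) A - T t (P ?y \<mu>) A)" by (simp only:)
      also have "\<dots> \<le> cm_norm M (\<lambda>A. T t (T (t' - t) (P ?y \<mu>)) A - T t (P ?y \<mu>) A)"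
        by (rule cmod_le_norm[OF cm_diff[OF T_cm[OF T_cm[OF cmP]] T_cm[OF cmP]]])
      also have "\<dots> = cm_norm M (\<lambda>A. T (t' - t) (P ?y \<mu>) A - P ?y \<mu> A)"
        by (rule T_norm_diff[OF T_cm[OF cmP] cmP])
      also have "\<dots> \<le> \<phi> (t' - t)" unfolding \<phi>_def by (intro T_P_continuous yseq \<mu>)
      also have "\<dots> < e / 3" using k(2)[of "t' - t"] t' by (simp add: dist_real_def \<phi>_def)
      finally have 1: "cmod (T t' (P ?y \<mu>) A - T t (P ?y \<mu>) A) < e / 3" .
      have tri: "cmod (v - w) \<le> cmod (a - b) + cmod (a - v) + cmod (b - w)" for a b v w :: complex
        using norm_triangle_ineq[of "(a - b) - (a - v)" "b - w"] norm_triangle_ineq4[of "a - b" "a - v"]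
        by simp
      have "cmod (T t' \<nu> A - T t \<nu> A) \<le> cmod (T t' (P ?y \<mu>) A - T t (P ?y \<mu>) A) +
        cmod (T t' (P ?y \<mu>) A - T t' \<nu> A) + cmod (T t (P ?y \<mu>) A - T t \<nu> A)"
        by (rule tri)
      also have "\<dots> < e / 3 + e / 3 + e / 3"
        by (intro add_strict_mono 1 le_less_trans[OF d n])
      also have "e / 3 + e / 3 + e / 3 = e" by simp
      finally show ?thesis unfolding dist_norm .
    qed
    then show "\<exists>k>0. \<forall>t'. dist t' t < k \<longrightarrow> dist (T t' \<nu> A) (T t \<nu> A) < e" using k(1) by blast
  qed
qed

section \<open>Identifying the limit with the original measure\<close>

text \<open>Vanishing almost everywhere on each set extends to integrals of each bounded
  \<open>h\<close>, so all essential suprema in the sup path attaining inequality are 0.\<close>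

lemma eq_0_of_AE:
  assumes \<mu>: "\<mu> \<in> wm" and AE0: "\<And>A. A \<in> sets M \<Longrightarrow> AE t in lborel. T t \<mu> A = 0"
  shows "\<mu> A = 0"
proof -
  obtain C where "ennreal (cm_norm M \<mu>) \<le> ennreal C *
      (SUP h \<in> {h \<in> borel_measurable M. \<forall>x\<in>space M. cmod (h x) \<le> 1}.
         esssup lborel (\<lambda>t. ennreal (cmod (cm_integral M (T t \<mu>) h))))"
    using spa \<mu> unfolding sup_path_attaining_def by blast
  moreover have "(SUP h \<in> {h \<in> borel_measurable M. \<forall>x\<in>space M. cmod (h x) \<le> 1}.
         esssup lborel (\<lambda>t. ennreal (cmod (cm_integral M (T t \<mu>) h)))) \<le> 0"
  proof (rule SUP_least)
    fix h assume "h \<in> {h \<in> borel_measurable M. \<forall>x\<in>space M. cmod (h x) \<le> 1}"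
    then have h: "h \<in> borel_measurable M" "\<And>x. x \<in> space M \<Longrightarrow> cmod (h x) \<le> 1" by auto
    have m: "(\<lambda>t. cm_integral M (T t \<mu>) h) \<in> borel_measurable lborel"
      using wm_measurable[OF \<mu>] by (intro measurable_cm_integral[OF T_cm[OF wm_cm[OF \<mu>]] _ h]) simp
    have "AE t in lborel. cm_integral M (T t \<mu>) h = 0"
      by (rule AE_cm_integral_eq_0[OF T_cm[OF wm_cm[OF \<mu>]] AE0 h])
    then have "AE t in lborel. ennreal (cmod (cm_integral M (T t \<mu>) h)) \<le> 0" by eventually_elim simp
    then show "esssup lborel (\<lambda>t. ennreal (cmod (cm_integral M (T t \<mu>) h))) \<le> 0"
      using m by (intro esssup_I) auto
  qed
  ultimately have "ennreal (cm_norm M \<mu>) = 0" by simp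
  then have "cm_norm M \<mu> = 0" using cm_norm_nonneg[of M \<mu>] by simp
  then show ?thesis by (rule cm_eq_0_of_norm_0[OF wm_cm[OF \<mu>]])
qed

theorem orbit_isCont:
  assumes an: "analytic \<mu>"
  shows "isCont (\<lambda>t. T t \<mu> A) t"
proof -
  have \<mu>: "\<mu> \<in> wm" by (rule analytic_wm[OF an])
  obtain \<nu> where \<nu>: "\<nu> \<in> complex_measures M" "(\<lambda>n. cm_norm M (\<lambda>A. P (yseq n) \<mu> A - \<nu> A)) \<longlonglongrightarrow> 0"
    using P_limit[OF an] by blast
  note lim = limit_orbit[OF \<mu> \<nu>]
  have \<nu>wm: "\<nu> \<in> wm"
    by (rule wmI[OF \<nu>(1)])
      (use lim(2) in \<open>auto intro!: borel_measurable_continuous_onI continuous_at_imp_continuous_on\<close>)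
  define B where "B = max (cm_norm M \<mu>) (cm_norm M \<nu>)"
  have "\<mu> A - \<nu> A = 0" for A
  proof (rule eq_0_of_AE[OF wm_diff[OF \<mu> \<nu>wm]])
    fix A assume A: "A \<in> sets M"
    have "AE t in lborel. T t \<mu> A = T t \<nu> A"
    proof (rule AE_eq_of_poisson_tendsto[OF wm_measurable[OF \<mu>] _ wm_measurable[OF \<nu>wm] _ yseq])
      show "cmod (T t \<mu> A) \<le> B" for t using T_bound[OF wm_cm[OF \<mu>], of t A] by (simp add: B_def)
      show "cmod (T t \<nu> A) \<le> B" for t using T_bound[OF \<nu>(1), of t A] by (simp add: B_def)
      show "(\<lambda>n. LINT t|lborel. T t \<mu> A * of_real (poisson (yseq n) (x - t))) \<longlonglongrightarrow> T x \<nu> A" for x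
        using lim(1)[of x A] unfolding T_P_eq(2)[OF yseq(1) \<mu> A] by (simp only: poisson_minus_commute[of _ x])
    qed
    then show "AE t in lborel. T t (\<lambda>A. \<mu> A - \<nu> A) A = 0"
      unfolding T_diff[OF wm_cm[OF \<mu>] \<nu>(1)] by eventually_elim simp
  qed
  then have "\<mu> A = \<nu> A" for A by simp
  then have "\<mu> = \<nu>" by (rule ext)
  then show ?thesis using lim(2) by simp
qed

section \<open>Lebesgue decomposition along orbits\<close>

lemma T_singular:
  assumes "\<mu> \<in> complex_measures M" "\<sigma> \<in> complex_measures M" "cm_singular M \<mu> \<sigma>"
  shows "cm_singular M (T t \<mu>) (T t \<sigma>)"
proof (rule singular_of_norm_add[OF T_cm[OF assms(1)] T_cm[OF assms(2)]])
  show "cm_norm M (\<lambda>B. T t \<mu> B + T t \<sigma> B) = cm_norm M (T t \<mu>) + cm_norm M (T t \<sigma>)"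
    using norm_add_of_singular[OF assms, of 1] T_norm[OF cm_add[OF assms(1,2)], of t]
    unfolding T_add[OF assms(1,2)] T_norm[OF assms(1)] T_norm[OF assms(2)] by simp
  show "cm_norm M (\<lambda>B. T t \<mu> B - T t \<sigma> B) = cm_norm M (T t \<mu>) + cm_norm M (T t \<sigma>)"
    using norm_add_of_singular[OF assms, of "-1"] T_norm[OF cm_diff[OF assms(1,2)], of t]
    unfolding T_diff[OF assms(1,2)] T_norm[OF assms(1)] T_norm[OF assms(2)] by simp
qed

section \<open>Orbits relative to a quasi-invariant measure\<close>

context
  fixes \<sigma> assumes quasi: "quasi_invariant M T \<sigma>"
begin

lemma \<sigma>_cm: "\<sigma> \<in> complex_measures M"
  using quasi by (simp add: quasi_invariant_def weakly_measurable_def)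

lemma null_T_iff: "A \<in> sets M \<Longrightarrow> cm_null M (T t \<sigma>) A \<longleftrightarrow> cm_null M \<sigma> A"
  using quasi total_variation_eq_0_iff[OF T_cm[OF \<sigma>_cm], of A t] total_variation_eq_0_iff[OF \<sigma>_cm, of A]
  by (simp add: quasi_invariant_def)

lemma T_singular_quasi:
  assumes "\<nu> \<in> complex_measures M" "cm_singular M \<nu> \<sigma>"
  shows "cm_singular M (T t \<nu>) \<sigma>"
proof -
  obtain A where A: "A \<in> sets M" "cm_null M (T t \<sigma>) A" "cm_null M (T t \<nu>) (space M - A)"
    using T_singular[OF assms(1) \<sigma>_cm assms(2), of t] cm_singular_iff[OF T_cm[OF assms(1)] T_cm[OF \<sigma>_cm]] by auto
  then have "A \<in> sets M \<and> cm_null M \<sigma> A \<and> cm_null M (T t \<nu>) (space M - A)"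
    using null_T_iff[OF A(1)] by simp
  then show ?thesis
    using cm_singular_iff[OF T_cm[OF assms(1)] \<sigma>_cm] by auto
qed

text \<open>Absolute continuity is reached through singularity. The restriction \<kappa> of
  \<open>T t \<nu>\<close> to a \<sigma>-null set is singular to \<sigma>, hence so is
  \<open>T (- t) \<kappa>\<close>, which is then singular to \<nu>. Applying \<open>T t\<close>
  makes \<kappa> singular to \<open>T t \<nu>\<close>, of which it is a part, so it
  vanishes.\<close>

lemma T_abs_cont_quasi:
  assumes \<nu>: "\<nu> \<in> complex_measures M" and ac: "cm_abs_cont M \<nu> \<sigma>"
  shows "cm_abs_cont M (T t \<nu>) \<sigma>"
  unfolding cm_abs_cont_def
proof (intro ballI impI)
  fix A assume A: "A \<in> sets M" and "total_variation M \<sigma> A = 0"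
  then have nA: "cm_null M \<sigma> A" using total_variation_eq_0_iff[OF \<sigma>_cm A] by simp
  define \<kappa> where "\<kappa> = (\<lambda>B. if B \<in> sets M then T t \<nu> (B \<inter> A) else 0)"
  have \<kappa>: "\<kappa> \<in> complex_measures M" unfolding \<kappa>_def by (rule cm_restrict[OF T_cm[OF \<nu>] A])
  have "cm_null M \<kappa> (space M - A)"
    unfolding cm_null_def
  proof (intro ballI impI)
    fix B assume "B \<in> sets M" "B \<subseteq> space M - A"
    then have "B \<inter> A = {}" by blast
    then show "\<kappa> B = 0" using cm_empty[OF T_cm[OF \<nu>]] by (simp add: \<kappa>_def)
  qed
  then have "cm_singular M \<kappa> \<sigma>" using A nA cm_singular_iff[OF \<kappa> \<sigma>_cm] by blast
  then have "cm_singular M (T (- t) \<kappa>) \<sigma>" by (rule T_singular_quasi[OF \<kappa>])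
  then obtain C where C: "C \<in> sets M" "cm_null M \<sigma> C" "cm_null M (T (- t) \<kappa>) (space M - C)"
    using cm_singular_iff[OF T_cm[OF \<kappa>] \<sigma>_cm] by blast
  have "cm_null M \<nu> C"
    unfolding cm_null_def
  proof (intro ballI impI)
    fix B assume B: "B \<in> sets M" "B \<subseteq> C"
    then have "total_variation M \<sigma> B = 0"
      using total_variation_eq_0_iff[OF \<sigma>_cm B(1)] cm_null_subset[OF C(2)] by simp
    then show "\<nu> B = 0" using ac B(1) by (simp add: cm_abs_cont_def)
  qed
  moreover have "space M - (space M - C) = C" using sets.sets_into_space[OF C(1)] by blast
  ultimately have "cm_singular M \<nu> (T (- t) \<kappa>)"
    using C cm_singular_iff[OF \<nu> T_cm[OF \<kappa>]] sets.compl_sets[OF C(1)] by metis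
  then have "cm_singular M (T t \<nu>) (T t (T (- t) \<kappa>))" by (rule T_singular[OF \<nu> T_cm[OF \<kappa>]])
  moreover have "T t (T (- t) \<kappa>) = \<kappa>" using T_T[OF \<kappa>, of t "-t"] T_0[OF \<kappa>] by simp
  ultimately obtain D where D: "D \<in> sets M" "cm_null M \<kappa> D" "cm_null M (T t \<nu>) (space M - D)"
    using cm_singular_iff[OF T_cm[OF \<nu>] \<kappa>] by auto
  have "T t \<nu> A = T t \<nu> (A \<inter> D) + T t \<nu> (A - D)" by (rule cm_split[OF T_cm[OF \<nu>] A D(1)])
  also have "T t \<nu> (A \<inter> D) = \<kappa> (A \<inter> D)"
  proof -
    have "A \<inter> D \<inter> A = A \<inter> D" by blast
    then show ?thesis using A D(1) by (simp add: \<kappa>_def)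
  qed
  also have "\<kappa> (A \<inter> D) = 0" using D(2)[unfolded cm_null_def, rule_format, OF sets.Int[OF A D(1)]] by simp
  also have "T t \<nu> (A - D) = 0"
    using D(3)[unfolded cm_null_def, rule_format, OF sets.Diff[OF A D(1)]] sets.sets_into_space[OF A] by blast
  finally show "T t \<nu> A = 0" by simp
qed

text \<open>
  A single \<open>\<sigma>\<close>-null set \<open>N\<close> carries the singular parts of the whole orbit: it carries those with
  rational parameter by construction, and the others by continuity of the orbit of \<open>\<mu>\<close>.
\<close>

lemma common_null_set:
  assumes an: "analytic \<mu>" and \<mu>a: "\<mu>\<^sub>a \<in> complex_measures M" and \<mu>s: "\<mu>\<^sub>s \<in> complex_measures M"
    and \<mu>: "\<mu> = (\<lambda>A. \<mu>\<^sub>a A + \<mu>\<^sub>s A)"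
    and ac: "cm_abs_cont M \<mu>\<^sub>a \<sigma>" and sing: "cm_singular M \<mu>\<^sub>s \<sigma>"
  shows "\<exists>N\<in>sets M. \<forall>t. \<forall>A\<in>sets M. T t \<mu>\<^sub>s A = T t \<mu> (A \<inter> N) \<and> T t \<mu>\<^sub>a A = T t \<mu> (A - N)"
proof -
  have T\<mu>: "T t \<mu> A = T t \<mu>\<^sub>a A + T t \<mu>\<^sub>s A" for t A unfolding \<mu> T_add[OF \<mu>a \<mu>s] ..
  have cm: "\<mu> \<in> complex_measures M" by (rule wm_cm[OF analytic_wm[OF an]])
  have "\<forall>t. \<exists>A. A \<in> sets M \<and> cm_null M \<sigma> A \<and> cm_null M (T t \<mu>\<^sub>s) (space M - A)"
    using T_singular_quasi[OF \<mu>s sing] cm_singular_iff[OF T_cm[OF \<mu>s] \<sigma>_cm] by blast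
  from choice[OF this] obtain E where E0: "\<And>t. E t \<in> sets M \<and> cm_null M \<sigma> (E t) \<and> cm_null M (T t \<mu>\<^sub>s) (space M - E t)"
    by auto
  have E: "E t \<in> sets M" "cm_null M \<sigma> (E t)" "cm_null M (T t \<mu>\<^sub>s) (space M - E t)" for t
    using E0[of t] by auto
  define r where "r = from_nat_into (\<rat> :: real set)"
  have r: "range r = \<rat>"
    unfolding r_def by (rule range_from_nat_into) (use Rats_0 countable_rat in auto)
  define N where "N = (\<Union>n. E (r n))"
  have N: "N \<in> sets M" unfolding N_def using E(1) by auto
  have N\<sigma>: "cm_null M \<sigma> N" unfolding N_def by (rule cm_null_UN[OF \<sigma>_cm E(1,2)])
  have ac0: "T t \<mu>\<^sub>a A = 0" if "A \<in> sets M" "cm_null M \<sigma> A" for t A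
    using T_abs_cont_quasi[OF \<mu>a ac, of t] that total_variation_eq_0_iff[OF \<sigma>_cm that(1)] by (simp add: cm_abs_cont_def)
  \<comment> \<open>Inside \<open>E t\<close> the absolutely continuous parts vanish for every
    parameter, so there the orbit of \<open>\<mu>\<^sub>s\<close> agrees with that of \<mu> and
    inherits its continuity. Off \<open>E t\<close> the measure \<open>T t \<mu>\<^sub>s\<close>
    vanishes anyway.\<close>
  have off: "T t \<mu>\<^sub>s C = 0" if C: "C \<in> sets M" "C \<subseteq> space M - N" for t C
  proof -
    have D: "C \<inter> E t \<in> sets M" using C E(1) by blast
    have "cm_null M \<sigma> (C \<inter> E t)" by (rule cm_null_subset[OF E(2)]) blast
    note a0 = ac0[OF D this]
    have rat: "T q \<mu> (C \<inter> E t) = 0" if "q \<in> \<rat>" for q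
    proof -
      have "q \<in> range r" using that r by simp
      then obtain n where n: "q = r n" by auto
      have "C \<inter> E t \<subseteq> space M - E q" using C(2) n unfolding N_def by blast
      then have "T q \<mu>\<^sub>s (C \<inter> E t) = 0" using E(3)[of q] D unfolding cm_null_def by blast
      then show ?thesis by (simp add: T\<mu> a0)
    qed
    have "T t \<mu> (C \<inter> E t) = 0"
    proof (rule ccontr)
      assume *: "T t \<mu> (C \<inter> E t) \<noteq> 0"
      then have "0 < cmod (T t \<mu> (C \<inter> E t))" by simp
      then obtain d where d: "0 < d"
        "\<And>t'. dist t' t < d \<Longrightarrow> dist (T t' \<mu> (C \<inter> E t)) (T t \<mu> (C \<inter> E t)) < cmod (T t \<mu> (C \<inter> E t))"
        using orbit_isCont[OF an, where A = "C \<inter> E t" and t = t] unfolding continuous_at_eps_delta by blast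
      obtain q where q: "q \<in> \<rat>" "t < q" "q < t + d" using Rats_dense_in_real[of t "t + d"] d(1) by auto
      then have "dist q t < d" by (simp add: dist_real_def)
      from d(2)[OF this] show False using rat[OF q(1)] by (simp add: dist_norm)
    qed
    then have 1: "T t \<mu>\<^sub>s (C \<inter> E t) = 0" by (simp add: T\<mu> a0)
    have "C - E t \<subseteq> space M - E t" using sets.sets_into_space[OF C(1)] by blast
    then have 2: "T t \<mu>\<^sub>s (C - E t) = 0"
      using E(3)[of t] sets.Diff[OF C(1) E(1)] unfolding cm_null_def by blast
    show ?thesis using cm_split[OF T_cm[OF \<mu>s] C(1) E(1), of t t] 1 2 by simp
  qed
  have s: "T t \<mu>\<^sub>s A = T t \<mu> (A \<inter> N)" if A: "A \<in> sets M" for t A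
  proof -
    have "A - N \<subseteq> space M - N" using sets.sets_into_space[OF A] by blast
    then have "T t \<mu>\<^sub>s (A - N) = 0" by (rule off[OF sets.Diff[OF A N]])
    then have "T t \<mu>\<^sub>s A = T t \<mu>\<^sub>s (A \<inter> N)" using cm_split[OF T_cm[OF \<mu>s] A N, of t] by simp
    also have "\<dots> = T t \<mu> (A \<inter> N)"
      using ac0[OF sets.Int[OF A N] cm_null_subset[OF N\<sigma>]] by (simp add: T\<mu>)
    finally show ?thesis .
  qed
  moreover have "T t \<mu>\<^sub>a A = T t \<mu> (A - N)" if A: "A \<in> sets M" for t A
    using T\<mu>[of t A] s[OF A, of t] cm_split[OF T_cm[OF cm] A N, of t] by simp
  ultimately show ?thesis by (intro bexI[OF _ N] allI ballI conjI) simp_all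
qed

end

section \<open>The spectrum of a weakly analytic measure\<close>

text \<open>A negative \<open>s\<close> is excluded by one explicit function that annihilates \<nu>
  under convolution and has nonzero Fourier transform at \<open>s\<close>.\<close>

lemma spec_weakly_analytic:
  assumes wa: "weakly_analytic M T \<nu>"
  shows "spec M T \<nu> \<subseteq> {0..}"
proof
  fix s assume s: "s \<in> spec M T \<nu>"
  show "s \<in> {0..}"
  proof (rule ccontr)
    assume "s \<notin> {0..}"
    then have neg: "s < 0" by simp
    \<comment> \<open>The frequency \<open>- s\<close> is positive, so \<open>g\<close> lies in
      \<open>H1\<close>; its transform at \<open>- s\<close> is \<open>1 - exp (2 * s)\<close>,
      which is nonzero. The reflection \<open>g (- t)\<close> compensates the \<open>T (- t)\<close>
      in \<open>cm_conv\<close> and moves this value to \<open>s\<close>.\<close>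
    define g where "g = (\<lambda>t. complex_of_real (poisson 1 t) * (iexp (- s * t) - of_real (exp (- (1 * (- s))))))"
    have gH: "g \<in> H1" unfolding g_def by (rule poisson_iexp_H1) (use neg in simp_all)
    then have gi: "integrable lborel g" by (simp add: H1_def)
    have fi: "integrable lborel (\<lambda>t. g (- t))"
      using lborel_integrable_real_affine[OF gi, of "-1" 0] by simp
    have "\<nu> \<in> wm" using wa by (simp add: weakly_analytic_def)
    have "cm_conv M T (density_cm (\<lambda>t. g (- t))) \<nu> = (\<lambda>A. 0)"
    proof
      fix A
      show "cm_conv M T (density_cm (\<lambda>t. g (- t))) \<nu> A = 0"
      proof (cases "A \<in> sets M")
        case True
        have "cm_conv M T (density_cm (\<lambda>t. g (- t))) \<nu> A = (LINT t|lborel. g t * T t \<nu> A)"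
          unfolding cm_conv_density[OF \<open>\<nu> \<in> wm\<close> fi True] by simp
        also have "\<dots> = (LINT t|lborel. T t \<nu> A * g t)" by (simp add: mult.commute)
        also have "\<dots> = 0" using wa True gH unfolding weakly_analytic_def Hinf_def by blast
        finally show ?thesis .
      qed (simp add: cm_conv_def)
    qed
    then have "fourier (\<lambda>t. g (- t)) s = 0" using s fi unfolding spec_def by blast
    moreover have "fourier (\<lambda>t. g (- t)) s = fourier g (- s)"
      unfolding fourier_def
      using lborel_integral_real_affine[of "-1" "\<lambda>t. g t * exp (- (\<i> * of_real (- s) * of_real t))" 0] by simp
    moreover have "fourier g (- s) = of_real (1 - exp s * exp s)"
      unfolding g_def fourier_poisson_iexp[OF zero_less_one] using neg by (simp add: of_real_diff)
    moreover have "exp s * exp s < 1" using neg by (simp flip: exp_add)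
    ultimately show False by (metis less_irrefl of_real_eq_0_iff right_minus_eq)
  qed
qed

end

theorem theorem4p10:
  fixes M :: "'a measure"
    and T :: "real \<Rightarrow> ('a set \<Rightarrow> complex) \<Rightarrow> ('a set \<Rightarrow> complex)"
    and \<mu> \<sigma> \<mu>\<^sub>a \<mu>\<^sub>s :: "'a set \<Rightarrow> complex"
  assumes "is_representation M T"
    and "by_isometries M T"
    and "sup_path_attaining M T"
    and "\<mu> \<in> complex_measures M" and "weakly_analytic M T \<mu>"
    and "\<sigma> \<in> complex_measures M" and "quasi_invariant M T \<sigma>"
    and "\<mu>\<^sub>a \<in> complex_measures M" and "\<mu>\<^sub>s \<in> complex_measures M"
    and "\<mu> = (\<lambda>A. \<mu>\<^sub>a A + \<mu>\<^sub>s A)"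
    and "cm_abs_cont M \<mu>\<^sub>a \<sigma>" and "cm_singular M \<mu>\<^sub>s \<sigma>"
  shows "weakly_analytic M T \<mu>\<^sub>a \<and> weakly_analytic M T \<mu>\<^sub>s \<and>
         spec M T \<mu>\<^sub>a \<subseteq> {0..} \<and> spec M T \<mu>\<^sub>s \<subseteq> {0..}"
proof -
  interpret isometric_rep M T by unfold_locales (rule assms)+
  obtain N where N: "N \<in> sets M"
    and N': "\<forall>t. \<forall>A\<in>sets M. T t \<mu>\<^sub>s A = T t \<mu> (A \<inter> N) \<and> T t \<mu>\<^sub>a A = T t \<mu> (A - N)"
    using common_null_set[OF assms(7) analytic_of_weakly_analytic[OF assms(5)] assms(8-12)]
    by (elim bexE) simp
  have s: "T t \<mu>\<^sub>s A = T t \<mu> (A \<inter> N)" and a: "T t \<mu>\<^sub>a A = T t \<mu> (A - N)" if "A \<in> sets M" for t A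
    using N' that by auto
  have wm: "(\<lambda>t. T t \<mu> A) \<in> borel_measurable borel" "(\<lambda>t. T t \<mu> A) \<in> Hinf" if "A \<in> sets M" for A
    using assms(5) that by (auto simp: weakly_analytic_def weakly_measurable_def)
  have "weakly_analytic M T \<mu>\<^sub>s" "weakly_analytic M T \<mu>\<^sub>a"
    unfolding weakly_analytic_def weakly_measurable_def using wm N assms(8,9) by (simp_all add: s a)
  then show ?thesis using spec_weakly_analytic by blast
qed

end
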